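(* Let $(P,G,B,\pi_P)$ be a smooth finite-dimensional principal bundle, trivial over the members of an open cover $\{U_\alpha\}_{\alpha\in I}$ of $B$, with natural sections $\{s_\alpha\}$ and transition functions $\{g_{\alpha\beta}\}$. Let $\mathcal{P}$ be the sheaf of germs of smooth sections of $P$, $\mathcal{G}$ the sheaf of germs of smooth $G$-valued maps on $B$, and $\Omega^1(\mathcal{L})$ the sheaf of germs of smooth $\mathfrak{g}$-valued 1-forms on $B$, where $\mathfrak{g}=T_eG$. Let $\sigma_\alpha\in\mathcal{P}(U_\alpha)$ and $\gamma_{\alpha\beta}\in\mathcal{G}(U_\alpha\cap U_\beta)$ be the sections corresponding to $s_\alpha$ and $g_{\alpha\beta}$. If $\{\theta_\alpha\in\Omega^1(\mathcal{L})(U_\alpha)\mid\alpha\in I\}$ is a family of sections satisfying $$\theta_\beta=\mathcal{A}d(\gamma_{\alpha\beta}^{-1}).\theta_\alpha+\partial(\gamma_{\alpha\beta})\quad\text{on }U_\alpha\cap U_\beta,\qquad\text{for all }\alpha,\beta\in I,$$ then there is a unique morphism of sheaves (of sets) $D\colon\mathcal{P}\to\Omega^1(\mathcal{L})$ such that $$D(w\cdot a)=\mathcal{A}d(a^{-1}).D(w)+\partial(a)\qquad\text{for all }(w,a)\in\mathcal{P}\times_B\mathcal{G},$$ and $D(\sigma_\alpha)=\theta_\alpha$ for every $\alpha\in I$.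
   Context: $G$ acts on $P$ on the right. Given $G$-equivariant local trivializations $\Phi_\alpha\colon\pi_P^{-1}(U_\alpha)\to U_\alpha\times G$, the natural sections are $s_\alpha(x)=\Phi_\alpha^{-1}(x,e)$ and the transition functions $g_{\alpha\beta}\colon U_\alpha\cap U_\beta\to G$ are the smooth maps with $s_\beta=s_\alpha\cdot g_{\alpha\beta}$. Sheaves are viewed as étalé spaces over $B$; morphisms of sheaves are continuous maps commuting with the projections to $B$, and the same symbol denotes a sheaf morphism and the induced maps on sections. $\mathcal{P}$ is the sheaf generated by $U\mapsto\Gamma(U,P)$ (smooth sections of $P$ over $U$), so $\mathcal{P}(U)\cong\Gamma(U,P)$; $\mathcal{G}$ is the sheaf with $\mathcal{G}(U)\cong C^\infty(U,G)$; $\mathcal{L}$ is the sheaf with $\mathcal{L}(U)\cong C^\infty(U,\mathfrak{g})$; $\mathcal{A}$ is the sheaf of germs of smooth real-valued functions on $B$; $\Omega^1_B$ is the sheaf of germs of real-valued smooth 1-forms on $B$; and $\Omega^1(\mathcal{L}):=\Omega^1_B\otimes_{\mathcal{A}}\mathcal{L}$, which is identified with the sheaf of germs of $\mathfrak{g}$-valued smooth 1-forms on $B$, so that $\Omega^1(\mathcal{L})(U)\cong\Lambda^1(U,\mathfrak{g})$. $\mathcal{G}$ acts on the right of $\mathcal{P}$ via the sheafification of $\Gamma(U,P)\times C^\infty(U,G)\to\Gamma(U,P)$, $(s,g)\mapsto s\cdot g$. $\mathcal{P}\times_B\mathcal{G}$ denotes the pairs of germs over the same point of $B$. $\partial\colon\mathcal{G}\to\Omega^1(\mathcal{L})$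 is the morphism of sheaves of sets generated by $C^\infty(U,G)\ni f\mapsto f^{-1}df\in\Lambda^1(U,\mathfrak{g})$, where $(f^{-1}df)_x(v)=(T_{f(x)}\lambda_{f(x)^{-1}}\circ T_xf)(v)$ and $\lambda_g$ is left translation by $g$ in $G$ (left Maurer–Cartan differential). $\mathcal{A}d\colon\mathcal{G}\to\mathcal{A}ut(\mathcal{L})$ is the morphism of sheaves generated by $\mathrm{Ad}_U\colon C^\infty(U,G)\to\mathrm{Aut}(\mathcal{L}|_U)$, $(\mathrm{Ad}_U(g)(f))(x)=\mathrm{Ad}(g(x))(f(x))$ for $f\in C^\infty(V,\mathfrak{g})$, $x\in V$, $V\subseteq U$ open. It induces a left action of $\mathcal{G}$ on $\Omega^1(\mathcal{L})$, determined on decomposable elements by $\mathcal{A}d(g).(w\otimes u)=w\otimes\mathcal{A}d(g)(u)$; on $\mathfrak{g}$-valued 1-forms it is $(\mathcal{A}d(g).\theta)_x=\mathrm{Ad}(g(x))\circ\theta_x$. *)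

theory Defs
  imports "HOL-Analysis.Analysis" "HOL-Algebra.Group"
begin

text \<open>The model space of a manifold is a type of class \<open>real_inner\<close> that is spanned by a finite set
  (see \<open>smooth_manifold\<close> below). The class \<open>euclidean_space\<close> is not used because it
  excludes dimension 0, and hence discrete structure groups.

  For finite-dimensional \<open>'a\<close> and open \<open>S\<close>, being \<open>C\<^sup>k\<close> means that all iterated directional
  derivatives up to order \<open>k\<close> exist and are continuous.\<close>

primrec Ck_on :: "nat \<Rightarrow> 'a::real_normed_vector set \<Rightarrow> ('a \<Rightarrow> 'b::real_normed_vector) \<Rightarrow> bool" where
  "Ck_on 0 = (\<lambda>S f. continuous_on S f)"
| "Ck_on (Suc k) = (\<lambda>S f. (\<forall>x\<in>S. f differentiable at x) \<and>
      (\<forall>v. Ck_on k S (\<lambda>x. frechet_derivative f (at x) v)))"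

definition smooth_on :: "'a::real_normed_vector set \<Rightarrow> ('a \<Rightarrow> 'b::real_normed_vector) \<Rightarrow> bool" where
  "smooth_on S f \<longleftrightarrow> (\<forall>k. Ck_on k S f)"

text \<open>A chart is a pair of its domain and its coordinate map; the values of the coordinate
  map outside the domain are irrelevant.\<close>

type_synonym ('a, 'e) chart = "'a set \<times> ('a \<Rightarrow> 'e)"

record ('a, 'e) mfd =
  mtop :: "'a topology"
  atlas :: "('a, 'e) chart set"

definition chart_inv :: "('a, 'e) chart \<Rightarrow> 'e \<Rightarrow> 'a" where
  "chart_inv k = inv_into (fst k) (snd k)"

definition smooth_manifold :: "('a, 'e::real_inner) mfd \<Rightarrow> bool" where
  "smooth_manifold M \<longleftrightarrow>
     (\<exists>S::'e set. finite S \<and> span S = UNIV) \<and>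
     Hausdorff_space (mtop M) \<and> second_countable (mtop M) \<and>
     (\<Union>k\<in>atlas M. fst k) = topspace (mtop M) \<and>
     (\<forall>k\<in>atlas M. openin (mtop M) (fst k) \<and> open (snd k ` fst k) \<and>
        homeomorphic_map (subtopology (mtop M) (fst k)) (top_of_set (snd k ` fst k)) (snd k)) \<and>
     (\<forall>k\<in>atlas M. \<forall>l\<in>atlas M. smooth_on (snd k ` (fst k \<inter> fst l)) (snd l \<circ> chart_inv k))"

text \<open>Smooth maps to \<open>N\<close> defined on an open subset \<open>S\<close> of \<open>M\<close>.\<close>

definition smooth_map_on ::
  "('a, 'e::real_inner) mfd \<Rightarrow> ('b, 'f::real_inner) mfd \<Rightarrow> 'a set \<Rightarrow> ('a \<Rightarrow> 'b) \<Rightarrow> bool" where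
  "smooth_map_on M N S f \<longleftrightarrow>
     continuous_map (subtopology (mtop M) S) (mtop N) f \<and>
     (\<forall>k\<in>atlas M. \<forall>l\<in>atlas N.
        smooth_on (snd k ` (S \<inter> fst k \<inter> f -` fst l)) (snd l \<circ> f \<circ> chart_inv k))"

definition prod_mfd :: "('a, 'e) mfd \<Rightarrow> ('b, 'f) mfd \<Rightarrow> ('a \<times> 'b, 'e \<times> 'f) mfd" where
  "prod_mfd M N = \<lparr>mtop = prod_topology (mtop M) (mtop N),
     atlas = {(fst k \<times> fst l, map_prod (snd k) (snd l)) | k l. k \<in> atlas M \<and> l \<in> atlas N}\<rparr>"

text \<open>A tangent vector at \<open>x\<close> is the family of its coordinate vectors in all charts around \<open>x\<close>,
  related by the derivatives of the chart transitions. Outside the charts around \<open>x\<close> the family is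
  set to 0, so that the vector space operations are the pointwise ones.\<close>

type_synonym ('a, 'e) tvec = "('a, 'e) chart \<Rightarrow> 'e"

definition charts_at :: "('a, 'e) mfd \<Rightarrow> 'a \<Rightarrow> ('a, 'e) chart set" where
  "charts_at M x = {k \<in> atlas M. x \<in> fst k}"

definition tangent_space :: "('a, 'e::real_inner) mfd \<Rightarrow> 'a \<Rightarrow> ('a, 'e) tvec set" where
  "tangent_space M x = {v.
     (\<forall>k\<in>charts_at M x. \<forall>l\<in>charts_at M x.
        v l = frechet_derivative (snd l \<circ> chart_inv k) (at (snd k x)) (v k)) \<and>
     (\<forall>k. k \<notin> charts_at M x \<longrightarrow> v k = 0)}"

definition tv_add :: "('a, 'e::real_vector) tvec \<Rightarrow> ('a, 'e) tvec \<Rightarrow> ('a, 'e) tvec" where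
  "tv_add v w = (\<lambda>k. v k + w k)"

definition tv_scale :: "real \<Rightarrow> ('a, 'e::real_vector) tvec \<Rightarrow> ('a, 'e) tvec" where
  "tv_scale r v = (\<lambda>k. r *\<^sub>R v k)"

text \<open>The tangent vector at \<open>x\<close> with coordinate vector \<open>e\<close> in the chart \<open>k\<close> around \<open>x\<close>.\<close>

definition coord_vec ::
  "('a, 'e::real_inner) mfd \<Rightarrow> ('a, 'e) chart \<Rightarrow> 'a \<Rightarrow> 'e \<Rightarrow> ('a, 'e) tvec" where
  "coord_vec M k x e = (\<lambda>l. if l \<in> charts_at M x
     then frechet_derivative (snd l \<circ> chart_inv k) (at (snd k x)) e else 0)"

text \<open>The tangent map \<open>T\<^sub>x f\<close>; the result does not depend on the chosen chart \<open>k\<close> around \<open>x\<close>.\<close>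

definition tangent_map ::
  "('a, 'e::real_inner) mfd \<Rightarrow> ('b, 'f::real_inner) mfd \<Rightarrow> ('a \<Rightarrow> 'b) \<Rightarrow> 'a \<Rightarrow>
     ('a, 'e) tvec \<Rightarrow> ('b, 'f) tvec" where
  "tangent_map M N f x v = (\<lambda>l. if l \<in> charts_at N (f x)
     then let k = (SOME k. k \<in> charts_at M x)
          in frechet_derivative (snd l \<circ> f \<circ> chart_inv k) (at (snd k x)) (v k)
     else 0)"

record ('a, 'e) lie_group_data = "'a monoid" +
  gmfd :: "('a, 'e) mfd"

definition lie_group :: "('a, 'e::real_inner) lie_group_data \<Rightarrow> bool" where
  "lie_group G \<longleftrightarrow> group G \<and> smooth_manifold (gmfd G) \<and> topspace (mtop (gmfd G)) = carrier G \<and>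
     smooth_map_on (prod_mfd (gmfd G) (gmfd G)) (gmfd G) (carrier G \<times> carrier G)
       (\<lambda>(g, h). g \<otimes>\<^bsub>G\<^esub> h) \<and>
     smooth_map_on (gmfd G) (gmfd G) (carrier G) (\<lambda>g. inv\<^bsub>G\<^esub> g)"

definition lie_algebra :: "('a, 'e::real_inner) lie_group_data \<Rightarrow> ('a, 'e) tvec set" where
  "lie_algebra G = tangent_space (gmfd G) \<one>\<^bsub>G\<^esub>"

definition Ad :: "('a, 'e::real_inner) lie_group_data \<Rightarrow> 'a \<Rightarrow> ('a, 'e) tvec \<Rightarrow> ('a, 'e) tvec" where
  "Ad G g = tangent_map (gmfd G) (gmfd G) (\<lambda>h. g \<otimes>\<^bsub>G\<^esub> h \<otimes>\<^bsub>G\<^esub> inv\<^bsub>G\<^esub> g) \<one>\<^bsub>G\<^esub>"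

definition local_trivialization ::
  "('p, 'ep::real_inner) mfd \<Rightarrow> ('g, 'eg::real_inner) lie_group_data \<Rightarrow> ('b, 'eb::real_inner) mfd \<Rightarrow>
     ('p \<Rightarrow> 'b) \<Rightarrow> ('p \<Rightarrow> 'g \<Rightarrow> 'p) \<Rightarrow> 'b set \<Rightarrow> ('p \<Rightarrow> 'b \<times> 'g) \<Rightarrow> bool" where
  "local_trivialization P G B pr act U \<Phi> \<longleftrightarrow>
     (let PU = {p \<in> topspace (mtop P). pr p \<in> U} in
      openin (mtop B) U \<and>
      bij_betw \<Phi> PU (U \<times> carrier G) \<and>
      smooth_map_on P (prod_mfd B (gmfd G)) PU \<Phi> \<and>
      smooth_map_on (prod_mfd B (gmfd G)) P (U \<times> carrier G) (inv_into PU \<Phi>) \<and>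
      (\<forall>p\<in>PU. fst (\<Phi> p) = pr p) \<and>
      (\<forall>p\<in>PU. \<forall>g\<in>carrier G. \<Phi> (act p g) = (pr p, snd (\<Phi> p) \<otimes>\<^bsub>G\<^esub> g)))"

definition principal_bundle ::
  "('p, 'ep::real_inner) mfd \<Rightarrow> ('g, 'eg::real_inner) lie_group_data \<Rightarrow> ('b, 'eb::real_inner) mfd \<Rightarrow>
     ('p \<Rightarrow> 'b) \<Rightarrow> ('p \<Rightarrow> 'g \<Rightarrow> 'p) \<Rightarrow> bool" where
  "principal_bundle P G B pr act \<longleftrightarrow>
     smooth_manifold P \<and> lie_group G \<and> smooth_manifold B \<and>
     smooth_map_on P B (topspace (mtop P)) pr \<and>
     smooth_map_on (prod_mfd P (gmfd G)) P (topspace (mtop P) \<times> carrier G) (\<lambda>(p, g). act p g) \<and>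
     (\<forall>p\<in>topspace (mtop P). act p \<one>\<^bsub>G\<^esub> = p) \<and>
     (\<forall>p\<in>topspace (mtop P). \<forall>g\<in>carrier G. \<forall>h\<in>carrier G.
        act p (g \<otimes>\<^bsub>G\<^esub> h) = act (act p g) h) \<and>
     (\<forall>p\<in>topspace (mtop P). \<forall>g\<in>carrier G. pr (act p g) = pr p) \<and>
     (\<forall>x\<in>topspace (mtop B). \<exists>U \<Phi>. x \<in> U \<and> local_trivialization P G B pr act U \<Phi>)"

definition natural_section ::
  "('p, 'ep) mfd \<Rightarrow> ('g, 'eg) lie_group_data \<Rightarrow> ('p \<Rightarrow> 'b) \<Rightarrow> 'b set \<Rightarrow>
     ('p \<Rightarrow> 'b \<times> 'g) \<Rightarrow> 'b \<Rightarrow> 'p" where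
  "natural_section P G pr U \<Phi> x = inv_into {p \<in> topspace (mtop P). pr p \<in> U} \<Phi> (x, \<one>\<^bsub>G\<^esub>)"

text \<open>The function \<open>g\<close> with \<open>t x = s x \<cdot> g x\<close> for given local sections \<open>s\<close> and \<open>t\<close>.\<close>

definition transition_function ::
  "('g, 'eg) lie_group_data \<Rightarrow> ('p \<Rightarrow> 'g \<Rightarrow> 'p) \<Rightarrow> ('b \<Rightarrow> 'p) \<Rightarrow> ('b \<Rightarrow> 'p) \<Rightarrow> 'b \<Rightarrow> 'g" where
  "transition_function G act s t x = (THE g. g \<in> carrier G \<and> t x = act (s x) g)"

text \<open>Smooth \<open>\<gg>\<close>-valued 1-forms on an open set \<open>U \<subseteq> B\<close>: \<open>\<theta> x\<close> is linear from
  \<open>T\<^sub>x B\<close> to \<open>\<gg> = T\<^sub>e G\<close> (and \<open>undefined\<close> outside \<open>T\<^sub>x B\<close>). Smoothness is that of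
  the components of \<open>\<theta>\<close> in the charts \<open>k\<close> of \<open>B\<close>, where \<open>\<gg>\<close> is identified with the
  model space of \<open>G\<close> by the linear isomorphisms \<open>u \<mapsto> u l\<close>, for charts \<open>l\<close> around \<open>e\<close>.\<close>

type_synonym ('b, 'eb, 'g, 'eg) form1 = "'b \<Rightarrow> ('b, 'eb) tvec \<Rightarrow> ('g, 'eg) tvec"

definition smooth_form1_on ::
  "('b, 'eb::real_inner) mfd \<Rightarrow> ('g, 'eg::real_inner) lie_group_data \<Rightarrow> 'b set \<Rightarrow>
     ('b, 'eb, 'g, 'eg) form1 \<Rightarrow> bool" where
  "smooth_form1_on B G U \<theta> \<longleftrightarrow>
     (\<forall>x\<in>U. \<theta> x \<in> tangent_space B x \<rightarrow>\<^sub>E lie_algebra G \<and>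
        (\<forall>v\<in>tangent_space B x. \<forall>w\<in>tangent_space B x. \<theta> x (tv_add v w) = tv_add (\<theta> x v) (\<theta> x w)) \<and>
        (\<forall>r. \<forall>v\<in>tangent_space B x. \<theta> x (tv_scale r v) = tv_scale r (\<theta> x v))) \<and>
     (\<forall>k\<in>atlas B. \<forall>l\<in>charts_at (gmfd G) \<one>\<^bsub>G\<^esub>. \<forall>e.
        smooth_on (snd k ` (U \<inter> fst k))
          (\<lambda>y. \<theta> (chart_inv k y) (coord_vec B k (chart_inv k y) e) l))"

definition form1_add ::
  "('b, 'eb::real_inner) mfd \<Rightarrow> ('b, 'eb, 'g, 'eg::real_inner) form1 \<Rightarrow>
     ('b, 'eb, 'g, 'eg) form1 \<Rightarrow> ('b, 'eb, 'g, 'eg) form1" where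
  "form1_add B \<theta> \<eta> = (\<lambda>x. \<lambda>v\<in>tangent_space B x. tv_add (\<theta> x v) (\<eta> x v))"

definition form1_Ad ::
  "('b, 'eb::real_inner) mfd \<Rightarrow> ('g, 'eg::real_inner) lie_group_data \<Rightarrow> ('b \<Rightarrow> 'g) \<Rightarrow>
     ('b, 'eb, 'g, 'eg) form1 \<Rightarrow> ('b, 'eb, 'g, 'eg) form1" where
  "form1_Ad B G g \<theta> = (\<lambda>x. \<lambda>v\<in>tangent_space B x. Ad G (g x) (\<theta> x v))"

text \<open>The left Maurer--Cartan differential \<open>f\<^sup>-\<^sup>1 df\<close>.\<close>

definition maurer_cartan ::
  "('b, 'eb::real_inner) mfd \<Rightarrow> ('g, 'eg::real_inner) lie_group_data \<Rightarrow> ('b \<Rightarrow> 'g) \<Rightarrow>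
     ('b, 'eb, 'g, 'eg) form1" where
  "maurer_cartan B G f = (\<lambda>x. \<lambda>v\<in>tangent_space B x.
     tangent_map (gmfd G) (gmfd G) (\<lambda>h. inv\<^bsub>G\<^esub> (f x) \<otimes>\<^bsub>G\<^esub> h) (f x)
       (tangent_map B (gmfd G) f x v))"

text \<open>A presheaf of functions assigns to an open set \<open>U\<close> a set of functions, whose
  values outside \<open>U\<close> are irrelevant: a germ at \<open>x\<close> is the point \<open>x\<close> together with
  a class of functions that agree near \<open>x\<close>. The projection of the etale space is \<open>fst\<close>.\<close>

type_synonym ('b, 'c) germ = "'b \<times> ('b \<Rightarrow> 'c) set"
type_synonym ('b, 'c) presheaf = "'b set \<Rightarrow> ('b \<Rightarrow> 'c) set"

definition germ_at :: "'b topology \<Rightarrow> ('b \<Rightarrow> 'c) \<Rightarrow> 'b \<Rightarrow> ('b, 'c) germ" where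
  "germ_at T s x = (x, {t. \<exists>W. openin T W \<and> x \<in> W \<and> (\<forall>y\<in>W. t y = s y)})"

definition etale :: "'b topology \<Rightarrow> ('b, 'c) presheaf \<Rightarrow> ('b, 'c) germ topology" where
  "etale T F = topology_generated_by {germ_at T s ` U | U s. openin T U \<and> s \<in> F U}"

definition sheaf_sections :: "'b topology \<Rightarrow> ('b, 'c) germ topology \<Rightarrow> 'b set \<Rightarrow> ('b \<Rightarrow> ('b, 'c) germ) set" where
  "sheaf_sections T E U = {\<sigma>. continuous_map (subtopology T U) E \<sigma> \<and> (\<forall>x\<in>U. fst (\<sigma> x) = x)}"

text \<open>Morphisms are taken to be \<open>undefined\<close> outside the etale space, so that equality of
  morphisms is equality of functions.\<close>

definition sheaf_morphism ::
  "('b, 'c) germ topology \<Rightarrow> ('b, 'd) germ topology \<Rightarrow> (('b, 'c) germ \<Rightarrow> ('b, 'd) germ) \<Rightarrow> bool" where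
  "sheaf_morphism E E' D \<longleftrightarrow> D \<in> extensional (topspace E) \<and> continuous_map E E' D \<and>
     (\<forall>w\<in>topspace E. fst (D w) = fst w)"

text \<open>Sheafification of the local operations \<open>F U \<ni> s \<mapsto> \<phi> s\<close> and
  \<open>F U \<times> F' U \<ni> (s, t) \<mapsto> \<phi> s t\<close>.\<close>

definition germ_map ::
  "'b topology \<Rightarrow> ('b, 'c) presheaf \<Rightarrow> (('b \<Rightarrow> 'c) \<Rightarrow> ('b \<Rightarrow> 'd)) \<Rightarrow>
     ('b, 'c) germ \<Rightarrow> ('b, 'd) germ" where
  "germ_map T F \<phi> a = (THE b. \<exists>U s. openin T U \<and> fst a \<in> U \<and> s \<in> F U \<and>
     a = germ_at T s (fst a) \<and> b = germ_at T (\<phi> s) (fst a))"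

definition germ_map2 ::
  "'b topology \<Rightarrow> ('b, 'c) presheaf \<Rightarrow> ('b, 'd) presheaf \<Rightarrow>
     (('b \<Rightarrow> 'c) \<Rightarrow> ('b \<Rightarrow> 'd) \<Rightarrow> ('b \<Rightarrow> 'e)) \<Rightarrow>
     ('b, 'c) germ \<Rightarrow> ('b, 'd) germ \<Rightarrow> ('b, 'e) germ" where
  "germ_map2 T F F' \<phi> a a' = (THE b. \<exists>U s t. openin T U \<and> fst a \<in> U \<and> s \<in> F U \<and> t \<in> F' U \<and>
     a = germ_at T s (fst a) \<and> a' = germ_at T t (fst a) \<and> b = germ_at T (\<phi> s t) (fst a))"

definition bundle_sections ::
  "('p, 'ep::real_inner) mfd \<Rightarrow> ('b, 'eb::real_inner) mfd \<Rightarrow> ('p \<Rightarrow> 'b) \<Rightarrow> ('b, 'p) presheaf" where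
  "bundle_sections P B pr U = {s. smooth_map_on B P U s \<and> (\<forall>x\<in>U. pr (s x) = x)}"

definition group_maps ::
  "('b, 'eb::real_inner) mfd \<Rightarrow> ('g, 'eg::real_inner) lie_group_data \<Rightarrow> ('b, 'g) presheaf" where
  "group_maps B G U = {f. smooth_map_on B (gmfd G) U f}"

definition lie_forms ::
  "('b, 'eb::real_inner) mfd \<Rightarrow> ('g, 'eg::real_inner) lie_group_data \<Rightarrow>
     ('b, ('b, 'eb) tvec \<Rightarrow> ('g, 'eg) tvec) presheaf" where
  "lie_forms B G U = {\<theta>. smooth_form1_on B G U \<theta>}"

definition sheaf_P ::
  "('p, 'ep::real_inner) mfd \<Rightarrow> ('b, 'eb::real_inner) mfd \<Rightarrow> ('p \<Rightarrow> 'b) \<Rightarrow> ('b, 'p) germ topology" where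
  "sheaf_P P B pr = etale (mtop B) (bundle_sections P B pr)"

definition sheaf_G ::
  "('b, 'eb::real_inner) mfd \<Rightarrow> ('g, 'eg::real_inner) lie_group_data \<Rightarrow> ('b, 'g) germ topology" where
  "sheaf_G B G = etale (mtop B) (group_maps B G)"

definition sheaf_Omega1 ::
  "('b, 'eb::real_inner) mfd \<Rightarrow> ('g, 'eg::real_inner) lie_group_data \<Rightarrow>
     ('b, ('b, 'eb) tvec \<Rightarrow> ('g, 'eg) tvec) germ topology" where
  "sheaf_Omega1 B G = etale (mtop B) (lie_forms B G)"

text \<open>The right action of \<open>\<G>\<close> on \<open>\<P>\<close>, inversion in \<open>\<G>\<close>, addition in
  \<open>\<Omega>\<^sup>1(\<L>)\<close>, the left action of \<open>\<G>\<close> on \<open>\<Omega>\<^sup>1(\<L>)\<close> via \<open>Ad\<close>, and \<open>\<partial>\<close>.\<close>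

definition germ_act ::
  "('p, 'ep::real_inner) mfd \<Rightarrow> ('g, 'eg::real_inner) lie_group_data \<Rightarrow> ('b, 'eb::real_inner) mfd \<Rightarrow>
     ('p \<Rightarrow> 'b) \<Rightarrow> ('p \<Rightarrow> 'g \<Rightarrow> 'p) \<Rightarrow> ('b, 'p) germ \<Rightarrow> ('b, 'g) germ \<Rightarrow> ('b, 'p) germ" where
  "germ_act P G B pr act = germ_map2 (mtop B) (bundle_sections P B pr) (group_maps B G)
     (\<lambda>s g x. act (s x) (g x))"

definition germ_inv ::
  "('b, 'eb::real_inner) mfd \<Rightarrow> ('g, 'eg::real_inner) lie_group_data \<Rightarrow> ('b, 'g) germ \<Rightarrow> ('b, 'g) germ" where
  "germ_inv B G = germ_map (mtop B) (group_maps B G) (\<lambda>f x. inv\<^bsub>G\<^esub> (f x))"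

definition germ_add ::
  "('b, 'eb::real_inner) mfd \<Rightarrow> ('g, 'eg::real_inner) lie_group_data \<Rightarrow>
     ('b, ('b, 'eb) tvec \<Rightarrow> ('g, 'eg) tvec) germ \<Rightarrow> ('b, ('b, 'eb) tvec \<Rightarrow> ('g, 'eg) tvec) germ \<Rightarrow>
     ('b, ('b, 'eb) tvec \<Rightarrow> ('g, 'eg) tvec) germ" where
  "germ_add B G = germ_map2 (mtop B) (lie_forms B G) (lie_forms B G) (form1_add B)"

definition germ_Ad ::
  "('b, 'eb::real_inner) mfd \<Rightarrow> ('g, 'eg::real_inner) lie_group_data \<Rightarrow> ('b, 'g) germ \<Rightarrow>
     ('b, ('b, 'eb) tvec \<Rightarrow> ('g, 'eg) tvec) germ \<Rightarrow> ('b, ('b, 'eb) tvec \<Rightarrow> ('g, 'eg) tvec) germ" where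
  "germ_Ad B G = germ_map2 (mtop B) (group_maps B G) (lie_forms B G) (form1_Ad B G)"

definition germ_mc ::
  "('b, 'eb::real_inner) mfd \<Rightarrow> ('g, 'eg::real_inner) lie_group_data \<Rightarrow> ('b, 'g) germ \<Rightarrow>
     ('b, ('b, 'eb) tvec \<Rightarrow> ('g, 'eg) tvec) germ" where
  "germ_mc B G = germ_map (mtop B) (group_maps B G) (maurer_cartan B G)"

end

theory Submission
  imports Defs
begin

text \<open>
  Write \<open>\<theta> \<bullet> a = Ad(a\<^sup>-\<^sup>1) \<theta> + a\<^sup>-\<^sup>1 da\<close> for the gauge transform of a \<open>\<gg>\<close>-valued 1-form \<open>\<theta>\<close> by
  a smooth \<open>G\<close>-valued map \<open>a\<close>. The whole argument rests on the identity
  \<open>(\<theta> \<bullet> a) \<bullet> b = \<theta> \<bullet> (a b)\<close> (\<open>gauge_transform_mult\<close>), that is, on \<open>Ad\<close> being a homomorphism and on the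
  Leibniz rule \<open>(a b)\<^sup>-\<^sup>1 d(a b) = Ad(b\<^sup>-\<^sup>1) (a\<^sup>-\<^sup>1 da) + b\<^sup>-\<^sup>1 db\<close> (\<open>maurer_cartan_mult\<close>). It passes to germs.

  Over a trivializing set \<open>U\<^sub>\<alpha>\<close> every local section is \<open>t = s\<^sub>\<alpha> \<cdot> a\<^sub>\<alpha>\<close>, where the smooth map \<open>a\<^sub>\<alpha>\<close> is the
  fibre coordinate of \<open>t\<close> in the trivialization (\<open>section_eq_natural_section_act\<close>). Since \<open>\<sigma>\<^sub>\<alpha>\<close> must go to
  \<open>\<theta>\<^sub>\<alpha>\<close>, equivariance forces \<open>D(t) = \<theta>\<^sub>\<alpha> \<bullet> a\<^sub>\<alpha>\<close>; this is uniqueness. Conversely this formula does not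
  depend on \<open>\<alpha>\<close>: from \<open>a\<^sub>\<alpha> = g\<^sub>\<alpha>\<^sub>\<beta> a\<^sub>\<beta>\<close> and the compatibility \<open>\<theta>\<^sub>\<beta> = \<theta>\<^sub>\<alpha> \<bullet> g\<^sub>\<alpha>\<^sub>\<beta>\<close> it follows that
  \<open>\<theta>\<^sub>\<beta> \<bullet> a\<^sub>\<beta> = (\<theta>\<^sub>\<alpha> \<bullet> g\<^sub>\<alpha>\<^sub>\<beta>) \<bullet> a\<^sub>\<beta> = \<theta>\<^sub>\<alpha> \<bullet> a\<^sub>\<alpha>\<close>. So it defines \<open>D\<close> on all germs. \<open>D\<close> is equivariant because the
  fibre coordinate of \<open>t \<cdot> f\<close> is \<open>a\<^sub>\<alpha> f\<close>, and \<open>D(\<sigma>\<^sub>\<alpha>) = \<theta>\<^sub>\<alpha> \<bullet> g\<^sub>\<alpha>\<^sub>\<alpha> = \<theta>\<^sub>\<alpha>\<close> is the compatibility condition for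
  \<open>\<beta> = \<alpha>\<close>. It is continuous because a continuous section of the etale space is locally the family of
  germs of one section of the presheaf (\<open>sheaf_section_germE\<close>), so that \<open>D\<close> maps germs of a local section
  of \<open>P\<close> to germs of a smooth form.

  The analytic input is that \<open>\<theta> \<bullet> a\<close> is smooth when \<open>\<theta>\<close> and \<open>a\<close> are. In charts, both \<open>Ad(g(x))\<close> and
  \<open>f\<^sup>-\<^sup>1 df\<close> at \<open>x\<close> are partial derivatives, in the second variable, of smooth functions of two variables:
  of \<open>(x, h) \<mapsto> g(x) h g(x)\<^sup>-\<^sup>1\<close> at \<open>h = e\<close>, and of \<open>(x, y) \<mapsto> f(x)\<^sup>-\<^sup>1 f(y)\<close> at \<open>y = x\<close>
  (\<open>smooth_on_partial_derivative\<close>). The Leibniz rule comes from the derivative of a function of two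
  variables along the diagonal (\<open>tangent_map_diagonal\<close>).
\<close>

section \<open>Calculus of smooth maps between finite-dimensional spaces\<close>

text \<open>Finite dimension of a vector space given as a type; dimension 0 is included.\<close>

definition finite_dim :: "'a::real_vector itself \<Rightarrow> bool" where
  "finite_dim _ \<longleftrightarrow> (\<exists>S::'a set. finite S \<and> span S = UNIV)"

text \<open>Expansion along a finite orthogonal spanning set \<open>C\<close>, which is not normalized and may contain 0:
  with \<open>0 / 0 = 0\<close> the term for \<open>b = 0\<close> vanishes.\<close>

lemma finite_dim_orthogonal_expansion:
  assumes "finite_dim TYPE('a::real_inner)"
  obtains C :: "'a::real_inner set" where "finite C" "\<And>x. x = (\<Sum>b\<in>C. ((x \<bullet> b) / (b \<bullet> b)) *\<^sub>R b)"
proof -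
  obtain S :: "'a set" where S: "finite S" "span S = UNIV"
    using assms by (auto simp: finite_dim_def)
  obtain C :: "'a set" where C: "finite C" "span C = UNIV" "pairwise orthogonal C"
    using basis_orthogonal[OF S(1)] S(2) by auto
  let ?f = "\<lambda>x::'a. \<Sum>b\<in>C. ((x \<bullet> b) / (b \<bullet> b)) *\<^sub>R b"
  have lin: "linear ?f"
    by (rule linearI)
       (simp_all add: inner_add_left add_divide_distrib scaleR_add_left sum.distrib scaleR_sum_right)
  have "x = ?f x" for x
  proof -
    have "id x = ?f x"
    proof (rule linear_eq_on_span[OF linear_id lin, of C])
      fix c assume c: "c \<in> C"
      have "?f c = (\<Sum>b\<in>C. if b = c then c else 0)"
      proof (rule sum.cong[OF refl])
        fix b assume b: "b \<in> C"
        show "((c \<bullet> b) / (b \<bullet> b)) *\<^sub>R b = (if b = c then c else 0)"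
          using C(3) b c by (auto simp: pairwise_def orthogonal_def)
      qed
      then show "id c = ?f c" using C(1) c by simp
    qed (use C in auto)
    then show ?thesis by simp
  qed
  with C(1) show thesis by (rule that)
qed

lemma linear_orthogonal_expansion:
  assumes "linear L" "\<And>x. x = (\<Sum>b\<in>C. ((x \<bullet> b) / (b \<bullet> b)) *\<^sub>R b)"
  shows "L x = (\<Sum>b\<in>C. (x \<bullet> (b /\<^sub>R (b \<bullet> b))) *\<^sub>R L b)"
proof -
  have "L x = L (\<Sum>b\<in>C. ((x \<bullet> b) / (b \<bullet> b)) *\<^sub>R b)" using assms(2)[of x] by simp
  also have "\<dots> = (\<Sum>b\<in>C. ((x \<bullet> b) / (b \<bullet> b)) *\<^sub>R L b)"
    by (simp add: linear_sum[OF assms(1)] linear_scale[OF assms(1)])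
  finally show ?thesis by (simp add: divide_inverse mult.commute)
qed

lemma finite_dim_prod:
  assumes "finite_dim TYPE('a::real_vector)" "finite_dim TYPE('b::real_vector)"
  shows "finite_dim TYPE('a \<times> 'b)"
proof -
  obtain S :: "'a set" and T :: "'b set" where S: "finite S" "span S = UNIV" "finite T" "span T = UNIV"
    using assms by (auto simp: finite_dim_def)
  let ?S = "(\<lambda>x. (x, 0)) ` S \<union> (\<lambda>y. (0, y)) ` T"
  have 1: "linear (\<lambda>x::'a. (x, 0::'b))" "linear (\<lambda>y::'b. (0::'a, y))"
    by (auto intro!: linearI)
  have "(x, y) \<in> span ?S" for x y
  proof -
    have "(x, 0) \<in> span ((\<lambda>x. (x, 0::'b)) ` S)" "(0, y) \<in> span ((\<lambda>y. (0::'a, y)) ` T)"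
      using S by (simp_all add: linear_span_image[OF 1(1)] linear_span_image[OF 1(2)])
    then have "(x, 0) + (0, y) \<in> span ?S"
      by (intro span_add) (meson in_mono span_mono sup_ge1 sup_ge2)+
    then show ?thesis by simp
  qed
  then have "span ?S = UNIV" by auto
  moreover have "finite ?S" using S by simp
  ultimately show ?thesis unfolding finite_dim_def by blast
qed

lemma frechet_derivative_eqI:
  "(f has_derivative f') (at x) \<Longrightarrow> frechet_derivative f (at x) v = f' v"
  by (metis frechet_derivative_at)

lemma frechet_derivative_cong_open:
  assumes "open S" "x \<in> S" "\<And>y. y \<in> S \<Longrightarrow> f y = g y"
  shows "frechet_derivative f (at x) = frechet_derivative g (at x)"
proof -
  have "(f has_derivative f') (at x) \<longleftrightarrow> (g has_derivative f') (at x)" for f'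
    using has_derivative_transform_within_open[of _ _ x UNIV S] assms by metis
  then show ?thesis unfolding frechet_derivative_def by simp
qed

lemma differentiable_cong_open:
  assumes "open S" "x \<in> S" "\<And>y. y \<in> S \<Longrightarrow> f y = g y"
  shows "f differentiable at x \<longleftrightarrow> g differentiable at x"
  unfolding differentiable_def
  using has_derivative_transform_within_open[of _ _ x UNIV S] assms by metis

lemma has_derivative_frechet_derivative:
  "f differentiable at x \<Longrightarrow> (f has_derivative (\<lambda>v. frechet_derivative f (at x) v)) (at x)"
  by (simp add: frechet_derivative_works[symmetric])

lemma Ck_on_cong:
  assumes "open S" "\<And>x. x \<in> S \<Longrightarrow> f x = g x"
  shows "Ck_on k S f \<longleftrightarrow> Ck_on k S g"
  using assms
proof (induction k arbitrary: f g)
  case 0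
  then show ?case using continuous_on_cong[of S S f g] by auto
next
  case (Suc k)
  have "Ck_on k S (\<lambda>x. frechet_derivative f (at x) v) \<longleftrightarrow> Ck_on k S (\<lambda>x. frechet_derivative g (at x) v)" for v
    using Suc.prems by (intro Suc.IH) (auto dest: frechet_derivative_cong_open[of S _ f g])
  then show ?case
    using Suc.prems differentiable_cong_open[of S _ f g] by auto
qed

lemma Ck_on_subset: "Ck_on k S f \<Longrightarrow> T \<subseteq> S \<Longrightarrow> Ck_on k T f"
  by (induction k arbitrary: f) (auto intro: continuous_on_subset)

lemma Ck_on_SucD: "Ck_on (Suc k) S f \<Longrightarrow> Ck_on k S f"
proof (induction k arbitrary: f)
  case 0
  then show ?case
    by (auto intro!: continuous_at_imp_continuous_on differentiable_imp_continuous_within)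
next
  case (Suc k)
  have "Ck_on k S (\<lambda>x. frechet_derivative f (at x) v)" for v
    by (rule Suc.IH) (use Suc.prems in simp)
  then show ?case using Suc.prems by simp
qed

lemma Ck_on_local:
  assumes "\<And>x. x \<in> S \<Longrightarrow> \<exists>W. open W \<and> x \<in> W \<and> Ck_on k W f"
  shows "Ck_on k S f"
  using assms
proof (induction k arbitrary: f)
  case 0
  have "isCont f x" if x: "x \<in> S" for x
  proof -
    obtain W where "open W" "x \<in> W" "continuous_on W f" using "0.prems"[OF x] by auto
    then show ?thesis by (simp add: continuous_on_eq_continuous_at)
  qed
  then show ?case by (simp add: continuous_at_imp_continuous_on)
next
  case (Suc k)
  have "f differentiable at x" if "x \<in> S" for x
    using Suc.prems[OF that] by auto
  moreover have "Ck_on k S (\<lambda>x. frechet_derivative f (at x) v)" for v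
  proof (rule Suc.IH)
    fix x assume "x \<in> S"
    then obtain W where "open W" "x \<in> W" "Ck_on (Suc k) W f" using Suc.prems by blast
    then show "\<exists>W. open W \<and> x \<in> W \<and> Ck_on k W (\<lambda>x. frechet_derivative f (at x) v)" by auto
  qed
  ultimately show ?case by simp
qed

lemma Ck_on_const: "Ck_on k S (\<lambda>x. c)"
  by (induction k arbitrary: c) auto

lemma Ck_on_bounded_linear:
  assumes "bounded_linear L"
  shows "Ck_on k S L"
proof (cases k)
  case 0
  then show ?thesis using assms by (simp add: linear_continuous_on)
next
  case (Suc m)
  have d: "(L has_derivative L) (at x)" for x
    using assms by (rule bounded_linear_imp_has_derivative)
  show ?thesis
    using d by (auto simp: Suc frechet_derivative_at[OF d, symmetric] Ck_on_const
        intro: differentiableI)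
qed

lemma Ck_on_bounded_linear_compose:
  assumes "bounded_linear L" "open S" "Ck_on k S f"
  shows "Ck_on k S (\<lambda>x. L (f x))"
  using assms(3)
proof (induction k arbitrary: f)
  case 0
  then show ?case using assms(1) by (simp add: bounded_linear.continuous_on)
next
  case (Suc k)
  have d: "((\<lambda>x. L (f x)) has_derivative (\<lambda>v. L (frechet_derivative f (at x) v))) (at x)" if "x \<in> S" for x
    using Suc.prems that
    by (intro bounded_linear.has_derivative[OF assms(1)] has_derivative_frechet_derivative) auto
  have "Ck_on k S (\<lambda>x. frechet_derivative (\<lambda>x. L (f x)) (at x) v)" for v
  proof -
    have "Ck_on k S (\<lambda>x. L (frechet_derivative f (at x) v))"
      using Suc by auto
    then show ?thesis
      by (rule Ck_on_cong[OF assms(2), THEN iffD1, rotated]) (simp add: frechet_derivative_eqI[OF d])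
  qed
  then show ?case using d by (auto intro: differentiableI)
qed

lemma Ck_on_add:
  assumes "open S" "Ck_on k S f" "Ck_on k S g"
  shows "Ck_on k S (\<lambda>x. f x + g x)"
  using assms(2,3)
proof (induction k arbitrary: f g)
  case 0
  then show ?case by (simp add: continuous_on_add)
next
  case (Suc k)
  have d: "((\<lambda>x. f x + g x) has_derivative
      (\<lambda>v. frechet_derivative f (at x) v + frechet_derivative g (at x) v)) (at x)" if "x \<in> S" for x
    using Suc.prems that by (intro has_derivative_add has_derivative_frechet_derivative) auto
  have "Ck_on k S (\<lambda>x. frechet_derivative (\<lambda>x. f x + g x) (at x) v)" for v
  proof -
    have "Ck_on k S (\<lambda>x. frechet_derivative f (at x) v + frechet_derivative g (at x) v)"
      using Suc by auto
    then show ?thesis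
      by (rule Ck_on_cong[OF assms(1), THEN iffD1, rotated]) (simp add: frechet_derivative_eqI[OF d])
  qed
  then show ?case using d by (auto intro: differentiableI)
qed

lemma Ck_on_sum:
  assumes "open S" "\<And>i. i \<in> A \<Longrightarrow> Ck_on k S (f i)"
  shows "Ck_on k S (\<lambda>x. \<Sum>i\<in>A. f i x)"
  using assms(2)
  by (induction A rule: infinite_finite_induct) (auto simp: Ck_on_const intro!: Ck_on_add[OF assms(1)])

lemma Ck_on_scaleR:
  assumes "open S" "Ck_on k S a" "Ck_on k S f"
  shows "Ck_on k S (\<lambda>x. a x *\<^sub>R f x)"
  using assms(2,3)
proof (induction k arbitrary: a f)
  case 0
  then show ?case by (simp add: continuous_on_scaleR)
next
  case (Suc k)
  have d: "((\<lambda>x. a x *\<^sub>R f x) has_derivative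
      (\<lambda>v. a x *\<^sub>R frechet_derivative f (at x) v + frechet_derivative a (at x) v *\<^sub>R f x)) (at x)"
    if "x \<in> S" for x
    using Suc.prems that by (intro has_derivative_scaleR has_derivative_frechet_derivative) auto
  have "Ck_on k S (\<lambda>x. frechet_derivative (\<lambda>x. a x *\<^sub>R f x) (at x) v)" for v
  proof -
    have "Ck_on k S (\<lambda>x. a x *\<^sub>R frechet_derivative f (at x) v + frechet_derivative a (at x) v *\<^sub>R f x)"
      using Suc.prems Ck_on_SucD[OF Suc.prems(1)] Ck_on_SucD[OF Suc.prems(2)]
      by (intro Ck_on_add[OF assms(1) Suc.IH Suc.IH]) simp_all
    then show ?thesis
      by (rule Ck_on_cong[OF assms(1), THEN iffD1, rotated]) (simp add: frechet_derivative_eqI[OF d])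
  qed
  then show ?case using d by (auto intro: differentiableI)
qed

lemma Ck_on_Pair:
  assumes "open S" "Ck_on k S f" "Ck_on k S g"
  shows "Ck_on k S (\<lambda>x. (f x, g x))"
  using assms(2,3)
proof (induction k arbitrary: f g)
  case 0
  then show ?case by (simp add: continuous_on_Pair)
next
  case (Suc k)
  have d: "((\<lambda>x. (f x, g x)) has_derivative
      (\<lambda>v. (frechet_derivative f (at x) v, frechet_derivative g (at x) v))) (at x)" if "x \<in> S" for x
    using Suc.prems that by (intro has_derivative_Pair has_derivative_frechet_derivative) auto
  have "Ck_on k S (\<lambda>x. frechet_derivative (\<lambda>x. (f x, g x)) (at x) v)" for v
  proof -
    have "Ck_on k S (\<lambda>x. (frechet_derivative f (at x) v, frechet_derivative g (at x) v))"
      using Suc by auto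
    then show ?thesis
      by (rule Ck_on_cong[OF assms(1), THEN iffD1, rotated]) (simp add: frechet_derivative_eqI[OF d])
  qed
  then show ?case using d by (auto intro: differentiableI)
qed

text \<open>The induction hypothesis applies to the derivative of \<open>g \<circ> f\<close> only after \<open>Dg(f x) (Df x v)\<close> is written as
  a finite sum of products of coordinates of \<open>Df x v\<close> with the functions \<open>Dg(f x) b\<close>, for \<open>b\<close> in an
  orthogonal spanning set. This is where the finite dimension of the middle space is used.\<close>

lemma Ck_on_compose:
  fixes f :: "'a::real_normed_vector \<Rightarrow> 'b::real_inner"
  assumes fd: "finite_dim TYPE('b)" and S: "open S" and fS: "f ` S \<subseteq> T"
    and f: "Ck_on k S f" and g: "Ck_on k T g"
  shows "Ck_on k S (\<lambda>x. g (f x))"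
  using f g
proof (induction k arbitrary: g)
  case 0
  then show ?case using fS by (auto intro: continuous_on_compose2)
next
  case (Suc k)
  obtain C :: "'b set" where C: "\<And>x. x = (\<Sum>b\<in>C. ((x \<bullet> b) / (b \<bullet> b)) *\<^sub>R b)"
    using finite_dim_orthogonal_expansion[OF fd] by metis
  have gd: "g differentiable at (f x)" if "x \<in> S" for x
    using Suc.prems that fS by auto
  have d: "((\<lambda>x. g (f x)) has_derivative
      (\<lambda>v. frechet_derivative g (at (f x)) (frechet_derivative f (at x) v))) (at x)" if "x \<in> S" for x
  proof -
    have "(f has_derivative (\<lambda>v. frechet_derivative f (at x) v)) (at x)"
      using Suc.prems that by (intro has_derivative_frechet_derivative) auto
    moreover have "(g has_derivative (\<lambda>v. frechet_derivative g (at (f x)) v)) (at (f x))"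
      by (rule has_derivative_frechet_derivative[OF gd[OF that]])
    ultimately show ?thesis by (rule has_derivative_compose)
  qed
  have "Ck_on k S (\<lambda>x. frechet_derivative (\<lambda>x. g (f x)) (at x) v)" for v
  proof -
    have "Ck_on k S (\<lambda>x. \<Sum>b\<in>C. (frechet_derivative f (at x) v \<bullet> (b /\<^sub>R (b \<bullet> b))) *\<^sub>R
            frechet_derivative g (at (f x)) b)"
    proof (intro Ck_on_sum Ck_on_scaleR S)
      fix b
      show "Ck_on k S (\<lambda>x. frechet_derivative f (at x) v \<bullet> (b /\<^sub>R (b \<bullet> b)))"
        by (rule Ck_on_bounded_linear_compose[OF bounded_linear_inner_left S]) (use Suc.prems(1) in simp)
      show "Ck_on k S (\<lambda>x. frechet_derivative g (at (f x)) b)"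
        by (rule Suc.IH[OF Ck_on_SucD[OF Suc.prems(1)]]) (use Suc.prems(2) in simp)
    qed
    then show ?thesis
    proof (rule Ck_on_cong[OF S, THEN iffD1, rotated])
      fix x assume x: "x \<in> S"
      show "(\<Sum>b\<in>C. (frechet_derivative f (at x) v \<bullet> (b /\<^sub>R (b \<bullet> b))) *\<^sub>R
            frechet_derivative g (at (f x)) b) = frechet_derivative (\<lambda>x. g (f x)) (at x) v"
        unfolding frechet_derivative_eqI[OF d[OF x]]
        by (rule linear_orthogonal_expansion[OF linear_frechet_derivative[OF gd[OF x]] C, symmetric])
    qed
  qed
  then show ?case using d by (auto intro: differentiableI)
qed

lemma smooth_on_cong:
  "open S \<Longrightarrow> (\<And>x. x \<in> S \<Longrightarrow> f x = g x) \<Longrightarrow> smooth_on S f \<longleftrightarrow> smooth_on S g"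
  by (simp add: smooth_on_def Ck_on_cong[of S f g])

lemma smooth_on_subset: "smooth_on S f \<Longrightarrow> T \<subseteq> S \<Longrightarrow> smooth_on T f"
  unfolding smooth_on_def using Ck_on_subset by blast

lemma smooth_on_local:
  assumes "\<And>x. x \<in> S \<Longrightarrow> \<exists>W. open W \<and> x \<in> W \<and> smooth_on W f"
  shows "smooth_on S f"
  unfolding smooth_on_def
proof (intro allI Ck_on_local)
  fix k x assume "x \<in> S"
  then obtain W where "open W" "x \<in> W" "smooth_on W f" using assms by blast
  then show "\<exists>W. open W \<and> x \<in> W \<and> Ck_on k W f" unfolding smooth_on_def by blast
qed

lemma smooth_on_const: "smooth_on S (\<lambda>x. c)"
  by (simp add: smooth_on_def Ck_on_const)

lemma smooth_on_bounded_linear: "bounded_linear L \<Longrightarrow> smooth_on S L"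
  by (simp add: smooth_on_def Ck_on_bounded_linear)

lemma smooth_on_inner: "open S \<Longrightarrow> smooth_on S f \<Longrightarrow> smooth_on S (\<lambda>x. f x \<bullet> c)"
  by (simp add: smooth_on_def Ck_on_bounded_linear_compose[OF bounded_linear_inner_left])

lemma smooth_on_add: "open S \<Longrightarrow> smooth_on S f \<Longrightarrow> smooth_on S g \<Longrightarrow> smooth_on S (\<lambda>x. f x + g x)"
  by (simp add: smooth_on_def Ck_on_add)

lemma smooth_on_sum: "open S \<Longrightarrow> (\<And>i. i \<in> A \<Longrightarrow> smooth_on S (f i)) \<Longrightarrow> smooth_on S (\<lambda>x. \<Sum>i\<in>A. f i x)"
  by (simp add: smooth_on_def Ck_on_sum)

lemma smooth_on_scaleR: "open S \<Longrightarrow> smooth_on S a \<Longrightarrow> smooth_on S f \<Longrightarrow> smooth_on S (\<lambda>x. a x *\<^sub>R f x)"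
  by (simp add: smooth_on_def Ck_on_scaleR)

lemma smooth_on_Pair: "open S \<Longrightarrow> smooth_on S f \<Longrightarrow> smooth_on S g \<Longrightarrow> smooth_on S (\<lambda>x. (f x, g x))"
  by (simp add: smooth_on_def Ck_on_Pair)

lemma smooth_on_compose:
  fixes f :: "'a::real_normed_vector \<Rightarrow> 'b::real_inner"
  assumes "finite_dim TYPE('b)" "open S" "f ` S \<subseteq> T" "smooth_on S f" "smooth_on T g"
  shows "smooth_on S (\<lambda>x. g (f x))"
  unfolding smooth_on_def
proof
  fix k show "Ck_on k S (\<lambda>x. g (f x))"
    by (rule Ck_on_compose[OF assms(1-3)]) (use assms(4,5) in \<open>simp_all add: smooth_on_def\<close>)
qed

lemma smooth_on_differentiable: "smooth_on S f \<Longrightarrow> x \<in> S \<Longrightarrow> f differentiable at x"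
proof -
  assume "smooth_on S f" "x \<in> S"
  then have "Ck_on (Suc 0) S f" by (simp only: smooth_on_def)
  then show ?thesis using \<open>x \<in> S\<close> by simp
qed

lemma smooth_on_frechet_derivative: "smooth_on S f \<Longrightarrow> smooth_on S (\<lambda>x. frechet_derivative f (at x) v)"
  unfolding smooth_on_def
proof
  fix k assume "\<forall>k. Ck_on k S f"
  then have "Ck_on (Suc k) S f" by blast
  then show "Ck_on k S (\<lambda>x. frechet_derivative f (at x) v)" by simp
qed

text \<open>The partial derivative of \<open>\<Psi>\<close> in its second variable, taken at a point that varies smoothly.\<close>

lemma smooth_on_partial_derivative:
  fixes a :: "'c::real_normed_vector \<Rightarrow> 'a::real_inner" and b :: "'c \<Rightarrow> 'b::real_inner"
  assumes fd: "finite_dim TYPE('a)" "finite_dim TYPE('b)" and \<Psi>: "smooth_on Q \<Psi>"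
    and S: "open S" and a: "smooth_on S a" and b: "smooth_on S b"
    and ab: "\<And>y. y \<in> S \<Longrightarrow> (a y, b y) \<in> Q"
  shows "smooth_on S (\<lambda>y. frechet_derivative (\<lambda>z. \<Psi> (a y, z)) (at (b y)) e)"
proof -
  have "smooth_on S (\<lambda>y. frechet_derivative \<Psi> (at (a y, b y)) (0, e))"
    by (rule smooth_on_compose[OF finite_dim_prod[OF fd] S _ smooth_on_Pair[OF S a b]
          smooth_on_frechet_derivative[OF \<Psi>]]) (use ab in auto)
  then show ?thesis
  proof (rule smooth_on_cong[OF S, THEN iffD1, rotated])
    fix y assume "y \<in> S"
    then have "\<Psi> differentiable at (a y, b y)" using smooth_on_differentiable[OF \<Psi>] ab by auto
    then have 1: "(\<Psi> has_derivative (\<lambda>v. frechet_derivative \<Psi> (at (a y, b y)) v)) (at (a y, b y))"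
      by (rule has_derivative_frechet_derivative)
    have "((\<lambda>z. (a y, z)) has_derivative (\<lambda>v. (0, v))) (at (b y))"
      by (auto intro!: derivative_eq_intros)
    from has_derivative_compose[OF this 1]
    show "frechet_derivative \<Psi> (at (a y, b y)) (0, e)
        = frechet_derivative (\<lambda>z. \<Psi> (a y, z)) (at (b y)) e"
      by (simp add: frechet_derivative_eqI)
  qed
qed

section \<open>Smooth maps between manifolds\<close>

text \<open>The conditions on a manifold that concern single charts: there is no requirement on chart
  transitions, nor on separation or countability. Compositions of smooth maps only need this much of the
  spaces involved, and it is evidently inherited by products.\<close>

definition locally_euclidean :: "('a, 'e::real_inner) mfd \<Rightarrow> bool" where
  "locally_euclidean M \<longleftrightarrow> finite_dim TYPE('e) \<and> (\<Union>k\<in>atlas M. fst k) = topspace (mtop M) \<and>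
     (\<forall>k\<in>atlas M. openin (mtop M) (fst k) \<and> open (snd k ` fst k) \<and>
        homeomorphic_map (subtopology (mtop M) (fst k)) (top_of_set (snd k ` fst k)) (snd k))"

lemma smooth_manifold_locally_euclidean: "smooth_manifold M \<Longrightarrow> locally_euclidean M"
  by (simp add: smooth_manifold_def locally_euclidean_def finite_dim_def)

lemma chart_subset_topspace: "locally_euclidean M \<Longrightarrow> k \<in> atlas M \<Longrightarrow> fst k \<subseteq> topspace (mtop M)"
  unfolding locally_euclidean_def by (meson openin_subset)

lemma chart_inv_chart:
  assumes "locally_euclidean M" "k \<in> atlas M" "x \<in> fst k"
  shows "chart_inv k (snd k x) = x"
proof -
  have "homeomorphic_map (subtopology (mtop M) (fst k)) (top_of_set (snd k ` fst k)) (snd k)"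
    using assms by (auto simp: locally_euclidean_def)
  then have "inj_on (snd k) (topspace (subtopology (mtop M) (fst k)))"
    by (rule homeomorphic_imp_injective_map)
  moreover have "topspace (subtopology (mtop M) (fst k)) = fst k"
    using chart_subset_topspace[OF assms(1,2)] by auto
  ultimately show ?thesis
    unfolding chart_inv_def using assms(3) by simp
qed

lemma chart_image_open:
  assumes "locally_euclidean M" "k \<in> atlas M" "openin (mtop M) W"
  shows "open (snd k ` (W \<inter> fst k))"
proof -
  have h: "homeomorphic_map (subtopology (mtop M) (fst k)) (top_of_set (snd k ` fst k)) (snd k)"
    and o: "open (snd k ` fst k)" using assms by (auto simp: locally_euclidean_def)
  have "openin (subtopology (mtop M) (fst k)) (W \<inter> fst k)"
    using assms(3) by (auto simp: openin_subtopology)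
  then have "openin (top_of_set (snd k ` fst k)) (snd k ` (W \<inter> fst k))"
    using homeomorphic_imp_open_map[OF h] by (simp add: open_map_def)
  then show ?thesis using o by (simp add: openin_open_eq)
qed

lemma charts_at_nonempty:
  assumes "locally_euclidean M" "x \<in> topspace (mtop M)"
  obtains k where "k \<in> charts_at M x"
  using assms unfolding locally_euclidean_def charts_at_def by blast

lemma charts_atD:
  assumes "k \<in> charts_at M x"
  shows "k \<in> atlas M" "x \<in> fst k"
  using assms by (auto simp: charts_at_def)

lemma openin_chart: "locally_euclidean M \<Longrightarrow> k \<in> atlas M \<Longrightarrow> openin (mtop M) (fst k)"
  by (simp add: locally_euclidean_def)

lemma openin_Int_vimage:
  assumes "openin X S" "continuous_map (subtopology X S) Y f" "openin Y V"
  shows "openin X (S \<inter> f -` V)"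
proof -
  have "openin (subtopology X S) {x \<in> topspace (subtopology X S). f x \<in> V}"
    using assms(2,3) by (rule openin_continuous_map_preimage)
  moreover have "{x \<in> topspace (subtopology X S). f x \<in> V} = S \<inter> f -` V"
    using openin_subset[OF assms(1)] by auto
  ultimately show ?thesis using assms(1) by (simp add: openin_open_subtopology)
qed

lemma smooth_map_on_continuous:
  "smooth_map_on M N S f \<Longrightarrow> continuous_map (subtopology (mtop M) S) (mtop N) f"
  by (simp add: smooth_map_on_def)

lemma smooth_map_on_chart_rep:
  "smooth_map_on M N S f \<Longrightarrow> k \<in> atlas M \<Longrightarrow> l \<in> atlas N \<Longrightarrow>
    smooth_on (snd k ` (S \<inter> fst k \<inter> f -` fst l)) (\<lambda>y. snd l (f (chart_inv k y)))"
  by (simp add: smooth_map_on_def o_def)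

lemma smooth_map_on_in_topspace:
  "smooth_map_on M N S f \<Longrightarrow> openin (mtop M) S \<Longrightarrow> x \<in> S \<Longrightarrow> f x \<in> topspace (mtop N)"
  using openin_subset[of "mtop M" S] by (auto simp: smooth_map_on_def continuous_map_def Pi_iff)

lemma openin_chart_rep_domain:
  assumes "locally_euclidean M" "locally_euclidean N" "openin (mtop M) S" "smooth_map_on M N S f"
    "k \<in> atlas M" "l \<in> atlas N"
  shows "openin (mtop M) (S \<inter> fst k \<inter> f -` fst l)"
proof -
  have "openin (mtop M) (S \<inter> f -` fst l)"
    using openin_Int_vimage[OF assms(3) smooth_map_on_continuous[OF assms(4)]]
      openin_chart[OF assms(2,6)] by blast
  then have "openin (mtop M) ((S \<inter> f -` fst l) \<inter> fst k)"
    using openin_chart[OF assms(1,5)] by (rule openin_Int)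
  then show ?thesis by (simp add: Int_ac)
qed

lemma open_chart_rep_domain:
  assumes "locally_euclidean M" "locally_euclidean N" "openin (mtop M) S" "smooth_map_on M N S f"
    "k \<in> atlas M" "l \<in> atlas N"
  shows "open (snd k ` (S \<inter> fst k \<inter> f -` fst l))"
proof -
  have "S \<inter> fst k \<inter> f -` fst l = (S \<inter> fst k \<inter> f -` fst l) \<inter> fst k" by auto
  then show ?thesis
    using chart_image_open[OF assms(1,5) openin_chart_rep_domain[OF assms]] by simp
qed

lemma smooth_map_onI:
  assumes "continuous_map (subtopology (mtop M) S) (mtop N) f"
    and "\<And>k l. k \<in> atlas M \<Longrightarrow> l \<in> atlas N \<Longrightarrow>
      smooth_on (snd k ` (S \<inter> fst k \<inter> f -` fst l)) (\<lambda>y. snd l (f (chart_inv k y)))"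
  shows "smooth_map_on M N S f"
  using assms by (simp add: smooth_map_on_def o_def)

lemma smooth_map_onI_local:
  assumes M: "locally_euclidean M" and "continuous_map (subtopology (mtop M) S) (mtop N) f"
    and loc: "\<And>k l x. k \<in> atlas M \<Longrightarrow> l \<in> atlas N \<Longrightarrow> x \<in> S \<Longrightarrow> x \<in> fst k \<Longrightarrow> f x \<in> fst l \<Longrightarrow>
      \<exists>W. openin (mtop M) W \<and> x \<in> W \<and> smooth_on (snd k ` (W \<inter> fst k)) (\<lambda>y. snd l (f (chart_inv k y)))"
  shows "smooth_map_on M N S f"
proof (rule smooth_map_onI[OF assms(2)])
  fix k l assume k: "k \<in> atlas M" and l: "l \<in> atlas N"
  show "smooth_on (snd k ` (S \<inter> fst k \<inter> f -` fst l)) (\<lambda>y. snd l (f (chart_inv k y)))"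
  proof (rule smooth_on_local)
    fix y assume "y \<in> snd k ` (S \<inter> fst k \<inter> f -` fst l)"
    then obtain x where x: "x \<in> S" "x \<in> fst k" "f x \<in> fst l" "y = snd k x" by auto
    from loc[OF k l x(1-3)] obtain W where W: "openin (mtop M) W" "x \<in> W"
      "smooth_on (snd k ` (W \<inter> fst k)) (\<lambda>y. snd l (f (chart_inv k y)))" by auto
    then show "\<exists>W. open W \<and> y \<in> W \<and> smooth_on W (\<lambda>y. snd l (f (chart_inv k y)))"
      using chart_image_open[OF M k W(1)] x by blast
  qed
qed

lemma smooth_map_on_subset:
  assumes "smooth_map_on M N S f" "T \<subseteq> S"
  shows "smooth_map_on M N T f"
proof (rule smooth_map_onI)
  show "continuous_map (subtopology (mtop M) T) (mtop N) f"
    using assms by (auto simp: smooth_map_on_def intro: continuous_map_from_subtopology_mono)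
  show "smooth_on (snd k ` (T \<inter> fst k \<inter> f -` fst l)) (\<lambda>y. snd l (f (chart_inv k y)))"
    if "k \<in> atlas M" "l \<in> atlas N" for k l
    by (rule smooth_on_subset[OF smooth_map_on_chart_rep[OF assms(1) that]]) (use assms(2) in auto)
qed

text \<open>Only the domain of the inner map has to be open.\<close>

lemma smooth_map_on_compose:
  assumes M: "locally_euclidean M" and N: "locally_euclidean N" and Q: "locally_euclidean Q"
    and S: "openin (mtop M) S"
    and f: "smooth_map_on M N S f" and fS: "f ` S \<subseteq> T" and g: "smooth_map_on N Q T g"
  shows "smooth_map_on M Q S (\<lambda>x. g (f x))"
proof (rule smooth_map_onI_local[OF M])
  have fc: "continuous_map (subtopology (mtop M) S) (subtopology (mtop N) T) f"
    using smooth_map_on_continuous[OF f] fS by (auto simp: continuous_map_in_subtopology)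
  show cont: "continuous_map (subtopology (mtop M) S) (mtop Q) (\<lambda>x. g (f x))"
    using continuous_map_compose[OF fc smooth_map_on_continuous[OF g]] by (simp add: o_def)
  fix k m x assume k: "k \<in> atlas M" and m: "m \<in> atlas Q" and x: "x \<in> S" "x \<in> fst k" "g (f x) \<in> fst m"
  have "f x \<in> topspace (mtop N)" by (rule smooth_map_on_in_topspace[OF f S x(1)])
  then obtain l where "l \<in> charts_at N (f x)" using charts_at_nonempty[OF N] by blast
  then have l: "l \<in> atlas N" "f x \<in> fst l" by (auto dest: charts_atD)
  define V where "V = (S \<inter> fst k \<inter> f -` fst l) \<inter> (S \<inter> (\<lambda>x. g (f x)) -` fst m)"
  have V: "openin (mtop M) V"
    unfolding V_def
    by (intro openin_Int openin_chart_rep_domain[OF M N S f k l(1)] openin_Int_vimage[OF S cont] openin_chart[OF Q m])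
  have fd: "finite_dim TYPE('d)" using N by (simp add: locally_euclidean_def)
  have "smooth_on (snd k ` (V \<inter> fst k)) (\<lambda>y. snd m (g (chart_inv l (snd l (f (chart_inv k y))))))"
  proof (rule smooth_on_compose[OF fd chart_image_open[OF M k V] _ _ smooth_map_on_chart_rep[OF g l(1) m]])
    show "(\<lambda>y. snd l (f (chart_inv k y))) ` snd k ` (V \<inter> fst k) \<subseteq> snd l ` (T \<inter> fst l \<inter> g -` fst m)"
      using fS chart_inv_chart[OF M k] by (auto simp: V_def)
    show "smooth_on (snd k ` (V \<inter> fst k)) (\<lambda>y. snd l (f (chart_inv k y)))"
      by (rule smooth_on_subset[OF smooth_map_on_chart_rep[OF f k l(1)]]) (auto simp: V_def)
  qed
  then have "smooth_on (snd k ` (V \<inter> fst k)) (\<lambda>y. snd m (g (f (chart_inv k y))))"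
    by (rule smooth_on_cong[OF chart_image_open[OF M k V], THEN iffD1, rotated])
      (use chart_inv_chart[OF N l(1)] chart_inv_chart[OF M k] in \<open>auto simp: V_def\<close>)
  then show "\<exists>W. openin (mtop M) W \<and> x \<in> W \<and>
      smooth_on (snd k ` (W \<inter> fst k)) (\<lambda>y. snd m (g (f (chart_inv k y))))"
    using V x l by (auto simp: V_def)
qed

lemma smooth_map_on_id:
  assumes "smooth_manifold M"
  shows "smooth_map_on M M S (\<lambda>x. x)"
proof (rule smooth_map_onI)
  show "continuous_map (subtopology (mtop M) S) (mtop M) (\<lambda>x. x)"
    by (simp add: continuous_map_from_subtopology)
  fix k l assume "k \<in> atlas M" "l \<in> atlas M"
  then have "smooth_on (snd k ` (fst k \<inter> fst l)) (snd l \<circ> chart_inv k)"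
    using assms by (simp add: smooth_manifold_def)
  then show "smooth_on (snd k ` (S \<inter> fst k \<inter> (\<lambda>x. x) -` fst l)) (\<lambda>y. snd l (chart_inv k y))"
    unfolding o_def by (rule smooth_on_subset) auto
qed

lemma smooth_map_on_const: "c \<in> topspace (mtop N) \<Longrightarrow> smooth_map_on M N S (\<lambda>x. c)"
  by (rule smooth_map_onI) (simp_all add: smooth_on_const)

lemma mtop_prod [simp]: "mtop (prod_mfd M N) = prod_topology (mtop M) (mtop N)"
  by (simp add: prod_mfd_def)

lemma prod_chartI:
  "k \<in> atlas M \<Longrightarrow> l \<in> atlas N \<Longrightarrow> (fst k \<times> fst l, map_prod (snd k) (snd l)) \<in> atlas (prod_mfd M N)"
  unfolding prod_mfd_def mfd.simps by blast

lemma prod_chartE: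
  assumes "c \<in> atlas (prod_mfd M N)"
  obtains k l where "k \<in> atlas M" "l \<in> atlas N" "c = (fst k \<times> fst l, map_prod (snd k) (snd l))"
  using assms by (auto simp: prod_mfd_def)

lemma locally_euclidean_prod:
  fixes M :: "('a, 'e::real_inner) mfd" and N :: "('b, 'f::real_inner) mfd"
  assumes M: "locally_euclidean M" and N: "locally_euclidean N"
  shows "locally_euclidean (prod_mfd M N)"
  unfolding locally_euclidean_def
proof (intro conjI ballI)
  show "finite_dim TYPE('e \<times> 'f)"
    using assms by (intro finite_dim_prod) (auto simp: locally_euclidean_def)
  have "(\<Union>c\<in>atlas (prod_mfd M N). fst c) = (\<Union>k\<in>atlas M. fst k) \<times> (\<Union>l\<in>atlas N. fst l)"
  proof
    show "(\<Union>c\<in>atlas (prod_mfd M N). fst c) \<subseteq> (\<Union>k\<in>atlas M. fst k) \<times> (\<Union>l\<in>atlas N. fst l)"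
      by (auto elim!: prod_chartE)
    show "(\<Union>k\<in>atlas M. fst k) \<times> (\<Union>l\<in>atlas N. fst l) \<subseteq> (\<Union>c\<in>atlas (prod_mfd M N). fst c)"
    proof
      fix p assume "p \<in> (\<Union>k\<in>atlas M. fst k) \<times> (\<Union>l\<in>atlas N. fst l)"
      then obtain k l where "k \<in> atlas M" "l \<in> atlas N" "p \<in> fst k \<times> fst l" by auto
      then show "p \<in> (\<Union>c\<in>atlas (prod_mfd M N). fst c)"
        by (intro UN_I[OF prod_chartI]) simp_all
    qed
  qed
  then show "(\<Union>c\<in>atlas (prod_mfd M N). fst c) = topspace (mtop (prod_mfd M N))"
    using assms by (simp add: locally_euclidean_def)
  fix c assume "c \<in> atlas (prod_mfd M N)"
  then obtain k l where k: "k \<in> atlas M" and l: "l \<in> atlas N"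
    and c: "c = (fst k \<times> fst l, map_prod (snd k) (snd l))" by (rule prod_chartE)
  show "openin (mtop (prod_mfd M N)) (fst c)"
    using openin_chart[OF M k] openin_chart[OF N l] by (simp add: c openin_prod_Times_iff)
  have im: "snd c ` fst c = (snd k ` fst k) \<times> (snd l ` fst l)"
    by (auto simp: c)
  have hk: "homeomorphic_map (subtopology (mtop M) (fst k)) (top_of_set (snd k ` fst k)) (snd k)"
    and hl: "homeomorphic_map (subtopology (mtop N) (fst l)) (top_of_set (snd l ` fst l)) (snd l)"
    and ok: "open (snd k ` fst k)" "open (snd l ` fst l)"
    using M N k l by (auto simp: locally_euclidean_def)
  show "open (snd c ` fst c)" unfolding im using ok by (rule open_Times)
  from hk hl obtain k' l' where
    "homeomorphic_maps (subtopology (mtop M) (fst k)) (top_of_set (snd k ` fst k)) (snd k) k'"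
    "homeomorphic_maps (subtopology (mtop N) (fst l)) (top_of_set (snd l ` fst l)) (snd l) l'"
    by (auto simp: homeomorphic_map_maps)
  then have "homeomorphic_maps (prod_topology (subtopology (mtop M) (fst k)) (subtopology (mtop N) (fst l)))
      (prod_topology (top_of_set (snd k ` fst k)) (top_of_set (snd l ` fst l)))
      (\<lambda>(x, y). (snd k x, snd l y)) (\<lambda>(x, y). (k' x, l' y))"
    unfolding homeomorphic_maps_prod by blast
  then have "homeomorphic_map (prod_topology (subtopology (mtop M) (fst k)) (subtopology (mtop N) (fst l)))
      (prod_topology (top_of_set (snd k ` fst k)) (top_of_set (snd l ` fst l)))
      (\<lambda>(x, y). (snd k x, snd l y))"
    by (auto simp: homeomorphic_map_maps)
  moreover have "(\<lambda>(x, y). (snd k x, snd l y)) = map_prod (snd k) (snd l)" by auto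
  moreover have "prod_topology (top_of_set (snd k ` fst k)) (top_of_set (snd l ` fst l))
      = top_of_set ((snd k ` fst k) \<times> (snd l ` fst l))"
    unfolding subtopology_Times[symmetric] prod_topology_euclidean ..
  ultimately show "homeomorphic_map (subtopology (mtop (prod_mfd M N)) (fst c)) (top_of_set (snd c ` fst c)) (snd c)"
    unfolding im by (simp only: c mtop_prod fst_conv snd_conv subtopology_Times)
qed

lemma chart_inv_prod:
  assumes "locally_euclidean M" "locally_euclidean N" "k \<in> atlas M" "l \<in> atlas N"
    and "y \<in> snd k ` fst k" "z \<in> snd l ` fst l"
  shows "chart_inv (fst k \<times> fst l, map_prod (snd k) (snd l)) (y, z) = (chart_inv k y, chart_inv l z)"
proof -
  obtain a b where ab: "a \<in> fst k" "y = snd k a" "b \<in> fst l" "z = snd l b" using assms by auto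
  show ?thesis
    using chart_inv_chart[OF locally_euclidean_prod[OF assms(1,2)] prod_chartI[OF assms(3,4)], of "(a, b)"]
      chart_inv_chart[OF assms(1,3) ab(1)] chart_inv_chart[OF assms(2,4) ab(3)] ab
    by simp
qed

lemma smooth_map_on_Pair:
  assumes M: "locally_euclidean M" and N: "locally_euclidean N" "locally_euclidean Q"
    and S: "openin (mtop M) S"
    and f: "smooth_map_on M N S f" and g: "smooth_map_on M Q S g"
  shows "smooth_map_on M (prod_mfd N Q) S (\<lambda>x. (f x, g x))"
proof (rule smooth_map_onI)
  show c: "continuous_map (subtopology (mtop M) S) (mtop (prod_mfd N Q)) (\<lambda>x. (f x, g x))"
    using f g by (simp add: smooth_map_on_def continuous_map_pairedI)
  fix k c assume k: "k \<in> atlas M" and "c \<in> atlas (prod_mfd N Q)"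
  then obtain l m where l: "l \<in> atlas N" and m: "m \<in> atlas Q"
    and c: "c = (fst l \<times> fst m, map_prod (snd l) (snd m))" by (auto elim: prod_chartE)
  let ?D = "snd k ` (S \<inter> fst k \<inter> (\<lambda>x. (f x, g x)) -` fst c)"
  have "S \<inter> fst k \<inter> (\<lambda>x. (f x, g x)) -` fst c = (S \<inter> fst k \<inter> f -` fst l) \<inter> (S \<inter> fst k \<inter> g -` fst m)"
    by (auto simp: c)
  moreover have "openin (mtop M) \<dots>"
    by (rule openin_Int[OF openin_chart_rep_domain[OF M N(1) S f k l] openin_chart_rep_domain[OF M N(2) S g k m]])
  ultimately have "openin (mtop M) (S \<inter> fst k \<inter> (\<lambda>x. (f x, g x)) -` fst c)" by simp
  from chart_image_open[OF M k this]
  have o: "open ?D" by (simp add: Int_ac)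
  have "smooth_on ?D (\<lambda>y. (snd l (f (chart_inv k y)), snd m (g (chart_inv k y))))"
    by (intro smooth_on_Pair[OF o] smooth_on_subset[OF smooth_map_on_chart_rep[OF f k l]]
        smooth_on_subset[OF smooth_map_on_chart_rep[OF g k m]]) (auto simp: c)
  then show "smooth_on ?D (\<lambda>y. snd c (f (chart_inv k y), g (chart_inv k y)))" by (simp add: c)
qed

lemma smooth_map_on_fst:
  fixes M :: "('a, 'e::real_inner) mfd" and N :: "('b, 'f::real_inner) mfd" and Q :: "('c, 'h::real_inner) mfd"
  assumes M: "locally_euclidean M" and N: "locally_euclidean N" and Q: "locally_euclidean Q"
    and S: "openin (mtop M) S" and T: "openin (mtop N) T" and f: "smooth_map_on M Q S f"
  shows "smooth_map_on (prod_mfd M N) Q (S \<times> T) (\<lambda>p. f (fst p))"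
proof (rule smooth_map_onI)
  have "continuous_map (subtopology (mtop (prod_mfd M N)) (S \<times> T)) (subtopology (mtop M) S) fst"
    by (simp add: continuous_map_fst subtopology_Times)
  from continuous_map_compose[OF this smooth_map_on_continuous[OF f]]
  show c: "continuous_map (subtopology (mtop (prod_mfd M N)) (S \<times> T)) (mtop Q) (\<lambda>p. f (fst p))"
    by (simp add: o_def)
  fix c m assume m: "m \<in> atlas Q" and "c \<in> atlas (prod_mfd M N)"
  then obtain k l where k: "k \<in> atlas M" and l: "l \<in> atlas N"
    and cc: "c = (fst k \<times> fst l, map_prod (snd k) (snd l))" by (auto elim: prod_chartE)
  let ?E = "S \<times> T \<inter> fst c \<inter> (\<lambda>p. f (fst p)) -` fst m"
  have "?E = (S \<inter> fst k \<inter> f -` fst m) \<times> (T \<inter> fst l)" by (auto simp: cc)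
  then have im: "snd c ` ?E = (snd k ` (S \<inter> fst k \<inter> f -` fst m)) \<times> (snd l ` (T \<inter> fst l))"
    by (simp add: cc map_prod_surj_on)
  have o: "open (snd c ` ?E)"
    unfolding im by (intro open_Times open_chart_rep_domain[OF M Q S f k m] chart_image_open[OF N l T])
  have fd: "finite_dim TYPE('e)" using M by (simp add: locally_euclidean_def)
  have "smooth_on (snd c ` ?E) (\<lambda>y. snd m (f (chart_inv k (fst y))))"
    by (rule smooth_on_compose[OF fd o _ smooth_on_bounded_linear[OF bounded_linear_fst] smooth_map_on_chart_rep[OF f k m]])
      (auto simp: im)
  then show "smooth_on (snd c ` ?E) (\<lambda>y. snd m (f (fst (chart_inv c y))))"
    by (rule smooth_on_cong[OF o, THEN iffD1, rotated])
      (auto simp: im cc chart_inv_prod[OF M N k l])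
qed

lemma smooth_map_on_snd:
  fixes M :: "('a, 'e::real_inner) mfd" and N :: "('b, 'f::real_inner) mfd" and Q :: "('c, 'h::real_inner) mfd"
  assumes M: "locally_euclidean M" and N: "locally_euclidean N" and Q: "locally_euclidean Q"
    and S: "openin (mtop M) S" and T: "openin (mtop N) T" and f: "smooth_map_on N Q T f"
  shows "smooth_map_on (prod_mfd M N) Q (S \<times> T) (\<lambda>p. f (snd p))"
proof (rule smooth_map_onI)
  have "continuous_map (subtopology (mtop (prod_mfd M N)) (S \<times> T)) (subtopology (mtop N) T) snd"
    by (simp add: continuous_map_snd subtopology_Times)
  from continuous_map_compose[OF this smooth_map_on_continuous[OF f]]
  show c: "continuous_map (subtopology (mtop (prod_mfd M N)) (S \<times> T)) (mtop Q) (\<lambda>p. f (snd p))"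
    by (simp add: o_def)
  fix c m assume m: "m \<in> atlas Q" and "c \<in> atlas (prod_mfd M N)"
  then obtain k l where k: "k \<in> atlas M" and l: "l \<in> atlas N"
    and cc: "c = (fst k \<times> fst l, map_prod (snd k) (snd l))" by (auto elim: prod_chartE)
  let ?E = "S \<times> T \<inter> fst c \<inter> (\<lambda>p. f (snd p)) -` fst m"
  have "?E = (S \<inter> fst k) \<times> (T \<inter> fst l \<inter> f -` fst m)" by (auto simp: cc)
  then have im: "snd c ` ?E = (snd k ` (S \<inter> fst k)) \<times> (snd l ` (T \<inter> fst l \<inter> f -` fst m))"
    by (simp add: cc map_prod_surj_on)
  have o: "open (snd c ` ?E)"
    unfolding im by (intro open_Times open_chart_rep_domain[OF N Q T f l m] chart_image_open[OF M k S])
  have fd: "finite_dim TYPE('f)" using N by (simp add: locally_euclidean_def)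
  have "smooth_on (snd c ` ?E) (\<lambda>y. snd m (f (chart_inv l (snd y))))"
    by (rule smooth_on_compose[OF fd o _ smooth_on_bounded_linear[OF bounded_linear_snd] smooth_map_on_chart_rep[OF f l m]])
      (auto simp: im)
  then show "smooth_on (snd c ` ?E) (\<lambda>y. snd m (f (snd (chart_inv c y))))"
    by (rule smooth_on_cong[OF o, THEN iffD1, rotated])
      (auto simp: im cc chart_inv_prod[OF M N k l])
qed

lemma smooth_map_on_snd_of:
  assumes M: "locally_euclidean M" and N: "locally_euclidean N" and Q: "locally_euclidean Q"
    and S: "openin (mtop M) S" and h: "smooth_map_on M (prod_mfd N Q) S h"
  shows "smooth_map_on M Q S (\<lambda>x. snd (h x))"
proof (rule smooth_map_onI_local[OF M])
  show "continuous_map (subtopology (mtop M) S) (mtop Q) (\<lambda>x. snd (h x))"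
    using continuous_map_compose[OF smooth_map_on_continuous[OF h, simplified] continuous_map_snd]
    by (simp add: o_def)
  fix k m x assume k: "k \<in> atlas M" and m: "m \<in> atlas Q" and x: "x \<in> S" "x \<in> fst k" "snd (h x) \<in> fst m"
  have "fst (h x) \<in> topspace (mtop N)"
    using smooth_map_on_in_topspace[OF h S x(1)] by (auto simp: mem_Times_iff)
  then obtain l where "l \<in> charts_at N (fst (h x))" using charts_at_nonempty[OF N] by blast
  then have l: "l \<in> atlas N" "fst (h x) \<in> fst l" by (auto dest: charts_atD)
  let ?c = "(fst l \<times> fst m, map_prod (snd l) (snd m))"
  have c: "?c \<in> atlas (prod_mfd N Q)" by (rule prod_chartI[OF l(1) m])
  define V where "V = S \<inter> fst k \<inter> h -` fst ?c"
  have V: "openin (mtop M) V"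
    unfolding V_def by (rule openin_chart_rep_domain[OF M locally_euclidean_prod[OF N Q] S h k c])
  have Vk: "V \<inter> fst k = V" by (auto simp: V_def)
  have o: "open (snd k ` V)" using chart_image_open[OF M k V] by (simp add: Vk)
  have fd: "finite_dim TYPE('d \<times> 'f)" using locally_euclidean_prod[OF N Q] by (simp add: locally_euclidean_def)
  have "smooth_on (snd k ` V) (\<lambda>y. snd (snd ?c (h (chart_inv k y))))"
    by (rule smooth_on_compose[OF fd o _ smooth_map_on_chart_rep[OF h k c, folded V_def]
          smooth_on_bounded_linear[OF bounded_linear_snd, of UNIV]]) simp
  then have "smooth_on (snd k ` (V \<inter> fst k)) (\<lambda>y. snd m (snd (h (chart_inv k y))))"
    by (simp add: Vk)
  then show "\<exists>W. openin (mtop M) W \<and> x \<in> W \<and>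
      smooth_on (snd k ` (W \<inter> fst k)) (\<lambda>y. snd m (snd (h (chart_inv k y))))"
    using V x l by (auto simp: V_def mem_Times_iff)
qed

text \<open>The chart representative of a map on a product, as a function of two variables with an open domain.\<close>

lemma smooth_on_prod_chart_rep:
  assumes M: "locally_euclidean M" and N: "locally_euclidean N" and Q: "locally_euclidean Q"
    and W: "openin (prod_topology (mtop M) (mtop N)) W" and F: "smooth_map_on (prod_mfd M N) Q W F"
    and k: "k \<in> atlas M" and l: "l \<in> atlas N" and m: "m \<in> atlas Q"
  defines "O' \<equiv> map_prod (snd k) (snd l) ` (W \<inter> fst k \<times> fst l \<inter> F -` fst m)"
  shows "open O'" "smooth_on O' (\<lambda>(y, z). snd m (F (chart_inv k y, chart_inv l z)))"
proof -
  let ?c = "(fst k \<times> fst l, map_prod (snd k) (snd l))"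
  have c: "?c \<in> atlas (prod_mfd M N)" by (rule prod_chartI[OF k l])
  have W': "openin (mtop (prod_mfd M N)) W" using W by simp
  show o: "open O'"
    using open_chart_rep_domain[OF locally_euclidean_prod[OF M N] Q W' F c m] by (simp add: O'_def)
  have "smooth_on O' (\<lambda>y. snd m (F (chart_inv ?c y)))"
    using smooth_map_on_chart_rep[OF F c m] by (simp add: O'_def)
  then show "smooth_on O' (\<lambda>(y, z). snd m (F (chart_inv k y, chart_inv l z)))"
    by (rule smooth_on_cong[OF o, THEN iffD1, rotated])
      (auto simp: O'_def chart_inv_prod[OF M N k l])
qed

section \<open>Tangent maps\<close>

lemma chart_rep_differentiable:
  assumes "smooth_map_on M N S f" "x \<in> S" "k \<in> charts_at M x" "l \<in> charts_at N (f x)"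
  shows "(\<lambda>y. snd l (f (chart_inv k y))) differentiable at (snd k x)"
  using assms by (intro smooth_on_differentiable[OF smooth_map_on_chart_rep[OF assms(1)]]) (auto simp: charts_at_def)

text \<open>The chain rule for chart representatives. With \<open>f\<close> or \<open>g\<close> the identity it is the rule
  for a change of charts.\<close>

lemma chart_rep_chain:
  assumes M: "locally_euclidean M" and N: "locally_euclidean N"
    and S: "openin (mtop M) S" "x \<in> S" and f: "smooth_map_on M N S f"
    and g: "f x \<in> T" "smooth_map_on N Q T g"
    and k: "k \<in> charts_at M x" and l: "l \<in> charts_at N (f x)" and m: "m \<in> charts_at Q (g (f x))"
  shows "frechet_derivative (\<lambda>y. snd m (g (f (chart_inv k y)))) (at (snd k x)) v =
    frechet_derivative (\<lambda>z. snd m (g (chart_inv l z))) (at (snd l (f x)))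
      (frechet_derivative (\<lambda>y. snd l (f (chart_inv k y))) (at (snd k x)) v)"
proof -
  note k' = charts_atD[OF k] and l' = charts_atD[OF l]
  have 1: "((\<lambda>y. snd l (f (chart_inv k y))) has_derivative
      (\<lambda>v. frechet_derivative (\<lambda>y. snd l (f (chart_inv k y))) (at (snd k x)) v)) (at (snd k x))"
    by (rule has_derivative_frechet_derivative[OF chart_rep_differentiable[OF f S(2) k l]])
  have e: "snd l (f (chart_inv k (snd k x))) = snd l (f x)" using chart_inv_chart[OF M k'] by simp
  have 2: "((\<lambda>z. snd m (g (chart_inv l z))) has_derivative
      (\<lambda>v. frechet_derivative (\<lambda>z. snd m (g (chart_inv l z))) (at (snd l (f x))) v))
      (at (snd l (f (chart_inv k (snd k x)))))"
    unfolding e by (rule has_derivative_frechet_derivative[OF chart_rep_differentiable[OF g(2,1) l m]])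
  have "frechet_derivative (\<lambda>y. snd m (g (chart_inv l (snd l (f (chart_inv k y)))))) (at (snd k x)) v =
    frechet_derivative (\<lambda>z. snd m (g (chart_inv l z))) (at (snd l (f x)))
      (frechet_derivative (\<lambda>y. snd l (f (chart_inv k y))) (at (snd k x)) v)"
    by (rule frechet_derivative_eqI[OF has_derivative_compose[OF 1 2]])
  moreover have "frechet_derivative (\<lambda>y. snd m (g (chart_inv l (snd l (f (chart_inv k y)))))) (at (snd k x))
    = frechet_derivative (\<lambda>y. snd m (g (f (chart_inv k y)))) (at (snd k x))"
    by (rule frechet_derivative_cong_open[OF open_chart_rep_domain[OF M N S(1) f k'(1) l'(1)]])
      (use S l' k' chart_inv_chart[OF M k'(1)] chart_inv_chart[OF N l'(1)] in auto)
  ultimately show ?thesis by simp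
qed

text \<open>A tangent map depends only on the germ of the map, whether or not the map is smooth.\<close>

lemma tangent_map_cong:
  assumes M: "locally_euclidean M" and W: "openin (mtop M) W" "x \<in> W" and eq: "\<And>y. y \<in> W \<Longrightarrow> f y = g y"
  shows "tangent_map M N f x = tangent_map M N g x"
proof -
  have "x \<in> topspace (mtop M)" using openin_subset[OF W(1)] W(2) by auto
  then have "\<exists>k. k \<in> charts_at M x" using charts_at_nonempty[OF M] by metis
  then have k: "(SOME k. k \<in> charts_at M x) \<in> charts_at M x" (is "?k \<in> _") by (rule someI_ex)
  note k' = charts_atD[OF k]
  have e: "frechet_derivative (snd l \<circ> f \<circ> chart_inv ?k) (at (snd ?k x)) =
      frechet_derivative (snd l \<circ> g \<circ> chart_inv ?k) (at (snd ?k x))" for l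
    by (rule frechet_derivative_cong_open[OF chart_image_open[OF M k'(1) W(1)]])
      (use W k' eq chart_inv_chart[OF M k'(1)] in auto)
  show ?thesis by (intro ext) (simp add: tangent_map_def Let_def e eq[OF W(2)])
qed

lemma tangent_spaceD:
  "v \<in> tangent_space M x \<Longrightarrow> k \<in> charts_at M x \<Longrightarrow> l \<in> charts_at M x \<Longrightarrow>
    v l = frechet_derivative (\<lambda>y. snd l (chart_inv k y)) (at (snd k x)) (v k)"
  unfolding tangent_space_def o_def by blast

lemma tangent_space_outside: "v \<in> tangent_space M x \<Longrightarrow> k \<notin> charts_at M x \<Longrightarrow> v k = 0"
  unfolding tangent_space_def by blast

lemma tangent_spaceI:
  assumes "\<And>k l. k \<in> charts_at M x \<Longrightarrow> l \<in> charts_at M x \<Longrightarrow>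
      v l = frechet_derivative (\<lambda>y. snd l (chart_inv k y)) (at (snd k x)) (v k)"
    and "\<And>k. k \<notin> charts_at M x \<Longrightarrow> v k = 0"
  shows "v \<in> tangent_space M x"
  using assms unfolding tangent_space_def o_def by blast

text \<open>\<open>tangent_map\<close> is defined with a selected chart around \<open>x\<close>; any other chart gives the same vector.\<close>

lemma tangent_map_chart:
  assumes M: "smooth_manifold M" and N: "locally_euclidean N"
    and S: "openin (mtop M) S" "x \<in> S" and f: "smooth_map_on M N S f" and v: "v \<in> tangent_space M x"
    and k: "k \<in> charts_at M x" and l: "l \<in> charts_at N (f x)"
  shows "tangent_map M N f x v l = frechet_derivative (\<lambda>y. snd l (f (chart_inv k y))) (at (snd k x)) (v k)"
proof -
  note M' = smooth_manifold_locally_euclidean[OF M]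
  define k0 where "k0 = (SOME k. k \<in> charts_at M x)"
  have k0: "k0 \<in> charts_at M x" unfolding k0_def using k by (rule someI)
  have "tangent_map M N f x v l = frechet_derivative (\<lambda>y. snd l (f (chart_inv k0 y))) (at (snd k0 x)) (v k0)"
    using l by (simp add: tangent_map_def Let_def k0_def o_def)
  also have "\<dots> = frechet_derivative (\<lambda>y. snd l (f (chart_inv k y))) (at (snd k x)) (v k)"
    using chart_rep_chain[OF M' M' S smooth_map_on_id[OF M] S(2) f k0 k l, of "v k0"]
      tangent_spaceD[OF v k0 k] by simp
  finally show ?thesis .
qed

lemma tangent_map_outside: "l \<notin> charts_at N (f x) \<Longrightarrow> tangent_map M N f x v l = 0"
  by (simp add: tangent_map_def)

lemma tangent_map_in_tangent_space:
  assumes M: "smooth_manifold M" and N: "smooth_manifold N"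
    and S: "openin (mtop M) S" "x \<in> S" and f: "smooth_map_on M N S f" and v: "v \<in> tangent_space M x"
  shows "tangent_map M N f x v \<in> tangent_space N (f x)"
proof -
  note M' = smooth_manifold_locally_euclidean[OF M] and N' = smooth_manifold_locally_euclidean[OF N]
  have "x \<in> topspace (mtop M)" using openin_subset[OF S(1)] S(2) by auto
  then obtain k where k: "k \<in> charts_at M x" using charts_at_nonempty[OF M'] by metis
  show ?thesis
  proof (rule tangent_spaceI)
    fix l m assume l: "l \<in> charts_at N (f x)" and m: "m \<in> charts_at N (f x)"
    show "tangent_map M N f x v m =
        frechet_derivative (\<lambda>y. snd m (chart_inv l y)) (at (snd l (f x))) (tangent_map M N f x v l)"
      unfolding tangent_map_chart[OF M N' S f v k l] tangent_map_chart[OF M N' S f v k m]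
      by (rule chart_rep_chain[OF M' N' S f UNIV_I smooth_map_on_id[OF N] k l m])
  qed (rule tangent_map_outside)
qed

lemma tangent_map_compose:
  assumes M: "smooth_manifold M" and N: "smooth_manifold N" and Q: "smooth_manifold Q"
    and S: "openin (mtop M) S" "x \<in> S" and f: "smooth_map_on M N S f" and fS: "f ` S \<subseteq> T"
    and T: "openin (mtop N) T" and g: "smooth_map_on N Q T g" and v: "v \<in> tangent_space M x"
  shows "tangent_map M Q (\<lambda>x. g (f x)) x v = tangent_map N Q g (f x) (tangent_map M N f x v)"
proof
  fix m
  note M' = smooth_manifold_locally_euclidean[OF M] and N' = smooth_manifold_locally_euclidean[OF N]
    and Q' = smooth_manifold_locally_euclidean[OF Q]
  have "x \<in> topspace (mtop M)" using openin_subset[OF S(1)] S(2) by auto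
  then obtain k where k: "k \<in> charts_at M x" using charts_at_nonempty[OF M'] by metis
  have fx: "f x \<in> T" using fS S by auto
  then have "f x \<in> topspace (mtop N)" using openin_subset[OF T] by auto
  then obtain l where l: "l \<in> charts_at N (f x)" using charts_at_nonempty[OF N'] by metis
  show "tangent_map M Q (\<lambda>x. g (f x)) x v m = tangent_map N Q g (f x) (tangent_map M N f x v) m"
  proof (cases "m \<in> charts_at Q (g (f x))")
    case m: True
    show ?thesis
      using chart_rep_chain[OF M' N' S f fx g k l m, of "v k"]
        tangent_map_chart[OF M Q' S smooth_map_on_compose[OF M' N' Q' S(1) f fS g] v k m]
        tangent_map_chart[OF N Q' T fx g tangent_map_in_tangent_space[OF M N S f v] l m]
        tangent_map_chart[OF M N' S f v k l] by simp
  qed (simp add: tangent_map_outside)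
qed

lemma tangent_map_linear:
  assumes M: "locally_euclidean M" and S: "openin (mtop M) S" "x \<in> S" and f: "smooth_map_on M N S f"
  shows "tangent_map M N f x (tv_add v w) = tv_add (tangent_map M N f x v) (tangent_map M N f x w)"
    and "tangent_map M N f x (tv_scale r v) = tv_scale r (tangent_map M N f x v)"
proof -
  have "x \<in> topspace (mtop M)" using openin_subset[OF S(1)] S(2) by auto
  then have "\<exists>k. k \<in> charts_at M x" using charts_at_nonempty[OF M] by metis
  then have k: "(SOME k. k \<in> charts_at M x) \<in> charts_at M x" (is "?k \<in> _") by (rule someI_ex)
  have "linear (frechet_derivative (snd l \<circ> f \<circ> chart_inv ?k) (at (snd ?k x)))" if "l \<in> charts_at N (f x)" for l
    using chart_rep_differentiable[OF f S(2) k that] by (intro linear_frechet_derivative) (simp add: o_def)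
  then show "tangent_map M N f x (tv_add v w) = tv_add (tangent_map M N f x v) (tangent_map M N f x w)"
    and "tangent_map M N f x (tv_scale r v) = tv_scale r (tangent_map M N f x v)"
    by (auto simp: fun_eq_iff tangent_map_def tv_add_def tv_scale_def Let_def linear_add linear_scale)
qed

lemma tangent_space_closed:
  assumes M: "smooth_manifold M" and v: "v \<in> tangent_space M x"
  shows "w \<in> tangent_space M x \<Longrightarrow> tv_add v w \<in> tangent_space M x" "tv_scale r v \<in> tangent_space M x"
proof -
  have lin: "linear (frechet_derivative (\<lambda>y. snd l (chart_inv k y)) (at (snd k x)))"
    if "k \<in> charts_at M x" "l \<in> charts_at M x" for k l
    by (rule linear_frechet_derivative[OF chart_rep_differentiable[OF smooth_map_on_id[OF M] UNIV_I that]])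
  show "tv_add v w \<in> tangent_space M x" if w: "w \<in> tangent_space M x"
  proof (rule tangent_spaceI)
    fix k l assume kl: "k \<in> charts_at M x" "l \<in> charts_at M x"
    show "tv_add v w l = frechet_derivative (\<lambda>y. snd l (chart_inv k y)) (at (snd k x)) (tv_add v w k)"
      unfolding tv_add_def linear_add[OF lin[OF kl]] tangent_spaceD[OF v kl] tangent_spaceD[OF w kl] ..
  qed (simp add: tv_add_def tangent_space_outside[OF v] tangent_space_outside[OF w])
  show "tv_scale r v \<in> tangent_space M x"
  proof (rule tangent_spaceI)
    fix k l assume kl: "k \<in> charts_at M x" "l \<in> charts_at M x"
    show "tv_scale r v l = frechet_derivative (\<lambda>y. snd l (chart_inv k y)) (at (snd k x)) (tv_scale r v k)"
      unfolding tv_scale_def linear_scale[OF lin[OF kl]] tangent_spaceD[OF v kl] ..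
  qed (simp add: tv_scale_def tangent_space_outside[OF v])
qed

lemma coord_vec_in_tangent_space:
  assumes M: "smooth_manifold M" and k: "k \<in> charts_at M x"
  shows "coord_vec M k x e \<in> tangent_space M x" "coord_vec M k x e k = e"
proof -
  note M' = smooth_manifold_locally_euclidean[OF M]
  have S: "openin (mtop M) (topspace (mtop M))" "x \<in> topspace (mtop M)"
    using chart_subset_topspace[OF M' charts_atD(1)[OF k]] charts_atD(2)[OF k] by auto
  show "coord_vec M k x e \<in> tangent_space M x"
  proof (rule tangent_spaceI)
    fix l m assume l: "l \<in> charts_at M x" and m: "m \<in> charts_at M x"
    show "coord_vec M k x e m = frechet_derivative (\<lambda>y. snd m (chart_inv l y)) (at (snd l x)) (coord_vec M k x e l)"
      using chart_rep_chain[OF M' M' S smooth_map_on_id[OF M] UNIV_I smooth_map_on_id[OF M] k l m]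
      by (simp add: coord_vec_def o_def l m)
  qed (simp add: coord_vec_def)
  have "frechet_derivative (snd k \<circ> chart_inv k) (at (snd k x)) = frechet_derivative (\<lambda>y. y) (at (snd k x))"
    by (rule frechet_derivative_cong_open[OF chart_image_open[OF M' charts_atD(1)[OF k] S(1)]])
      (use k S charts_atD[OF k] chart_inv_chart[OF M' charts_atD(1)[OF k]] in auto)
  then show "coord_vec M k x e k = e" using k by (simp add: coord_vec_def)
qed

text \<open>The derivative along the diagonal is the sum of the two partial derivatives.\<close>

lemma tangent_map_diagonal:
  assumes M: "smooth_manifold M" and Q: "smooth_manifold Q"
    and S: "openin (mtop M) S" "x \<in> S" and H: "smooth_map_on (prod_mfd M M) Q (S \<times> S) H"
    and v: "v \<in> tangent_space M x"
  shows "tangent_map M Q (\<lambda>y. H (y, y)) x v =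
    tv_add (tangent_map M Q (\<lambda>y. H (y, x)) x v) (tangent_map M Q (\<lambda>y. H (x, y)) x v)"
proof
  fix m
  note M' = smooth_manifold_locally_euclidean[OF M] and Q' = smooth_manifold_locally_euclidean[OF Q]
  note MM = locally_euclidean_prod[OF M' M']
  have xM: "x \<in> topspace (mtop M)" using openin_subset[OF S(1)] S(2) by auto
  then obtain k where k: "k \<in> charts_at M x" using charts_at_nonempty[OF M'] by metis
  note k' = charts_atD[OF k]
  have idS: "smooth_map_on M M S (\<lambda>y. y)" by (rule smooth_map_on_id[OF M])
  have c: "smooth_map_on M M S (\<lambda>y. x)" by (rule smooth_map_on_const[OF xM])
  have 1: "smooth_map_on M Q S (\<lambda>y. H (y, y))"
    by (rule smooth_map_on_compose[OF M' MM Q' S(1) smooth_map_on_Pair[OF M' M' M' S(1) idS idS] _ H]) auto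
  have 2: "smooth_map_on M Q S (\<lambda>y. H (y, x))"
    by (rule smooth_map_on_compose[OF M' MM Q' S(1) smooth_map_on_Pair[OF M' M' M' S(1) idS c] _ H]) (use S in auto)
  have 3: "smooth_map_on M Q S (\<lambda>y. H (x, y))"
    by (rule smooth_map_on_compose[OF M' MM Q' S(1) smooth_map_on_Pair[OF M' M' M' S(1) c idS] _ H]) (use S in auto)
  show "tangent_map M Q (\<lambda>y. H (y, y)) x v m =
    tv_add (tangent_map M Q (\<lambda>y. H (y, x)) x v) (tangent_map M Q (\<lambda>y. H (x, y)) x v) m"
  proof (cases "m \<in> charts_at Q (H (x, x))")
    case m: True
    let ?a = "snd k x"
    define \<Psi> where "\<Psi> = (\<lambda>(y, z). snd m (H (chart_inv k y, chart_inv k z)))"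
    have SS: "openin (prod_topology (mtop M) (mtop M)) (S \<times> S)"
      using S by (simp add: openin_prod_Times_iff)
    have inv: "chart_inv k ?a = x" by (rule chart_inv_chart[OF M' k'])
    have "\<Psi> differentiable at (?a, ?a)"
      unfolding \<Psi>_def
      by (rule smooth_on_differentiable[OF smooth_on_prod_chart_rep(2)[OF M' M' Q' SS H k'(1) k'(1) charts_atD(1)[OF m]]])
        (use S k' charts_atD[OF m] in \<open>auto intro!: image_eqI[of _ _ "(x, x)"]\<close>)
    then have d: "(\<Psi> has_derivative (\<lambda>w. frechet_derivative \<Psi> (at (?a, ?a)) w)) (at (?a, ?a))"
      and lin: "linear (frechet_derivative \<Psi> (at (?a, ?a)))"
      by (rule has_derivative_frechet_derivative, rule linear_frechet_derivative)
    have d1: "((\<lambda>y. \<Psi> (y, y)) has_derivative (\<lambda>w. frechet_derivative \<Psi> (at (?a, ?a)) (w, w))) (at ?a)"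
      by (rule has_derivative_compose[where f="\<lambda>y. (y, y)", OF _ d]) (auto intro!: derivative_eq_intros)
    have d2: "((\<lambda>y. \<Psi> (y, ?a)) has_derivative (\<lambda>w. frechet_derivative \<Psi> (at (?a, ?a)) (w, 0))) (at ?a)"
      by (rule has_derivative_compose[where f="\<lambda>y. (y, ?a)", OF _ d]) (auto intro!: derivative_eq_intros)
    have d3: "((\<lambda>y. \<Psi> (?a, y)) has_derivative (\<lambda>w. frechet_derivative \<Psi> (at (?a, ?a)) (0, w))) (at ?a)"
      by (rule has_derivative_compose[where f="\<lambda>y. (?a, y)", OF _ d]) (auto intro!: derivative_eq_intros)
    have "frechet_derivative \<Psi> (at (?a, ?a)) (v k, v k) =
        frechet_derivative \<Psi> (at (?a, ?a)) (v k, 0) + frechet_derivative \<Psi> (at (?a, ?a)) (0, v k)"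
      using linear_add[OF lin, of "(v k, 0)" "(0, v k)"] by simp
    then show ?thesis
      using tangent_map_chart[OF M Q' S 1 v k m] tangent_map_chart[OF M Q' S 2 v k m]
        tangent_map_chart[OF M Q' S 3 v k m]
        frechet_derivative_eqI[OF d1] frechet_derivative_eqI[OF d2] frechet_derivative_eqI[OF d3]
      by (simp add: \<Psi>_def inv tv_add_def)
  qed (simp add: tangent_map_outside tv_add_def)
qed

section \<open>Gauge transformations of Lie algebra valued forms\<close>

lemma tv_add_assoc: "tv_add (tv_add u v) w = tv_add u (tv_add v w)"
  by (simp add: tv_add_def add.assoc)

text \<open>A base manifold and a Lie group, independent of any bundle.\<close>

locale lie_group_forms =
  fixes B :: "('b, 'eb::real_inner) mfd" and G :: "('g, 'eg::real_inner) lie_group_data"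
  assumes manifold_B: "smooth_manifold B" and lie_group_G: "lie_group G"
begin

lemma group_G: "group G"
  and manifold_G: "smooth_manifold (gmfd G)"
  and topspace_G: "topspace (mtop (gmfd G)) = carrier G"
  using lie_group_G by (simp_all add: lie_group_def)

sublocale group G by (rule group_G)

lemmas locally_euclidean_B = smooth_manifold_locally_euclidean[OF manifold_B]
lemmas locally_euclidean_G = smooth_manifold_locally_euclidean[OF manifold_G]

lemma openin_carrier: "openin (mtop (gmfd G)) (carrier G)"
  by (simp flip: topspace_G)

lemma smooth_map_on_mult:
  assumes "locally_euclidean M" "openin (mtop M) S"
    and f: "smooth_map_on M (gmfd G) S f" and h: "smooth_map_on M (gmfd G) S h"
  shows "smooth_map_on M (gmfd G) S (\<lambda>x. f x \<otimes>\<^bsub>G\<^esub> h x)"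
proof -
  have m: "smooth_map_on (prod_mfd (gmfd G) (gmfd G)) (gmfd G) (carrier G \<times> carrier G) (\<lambda>(g, h). g \<otimes>\<^bsub>G\<^esub> h)"
    using lie_group_G by (simp add: lie_group_def)
  have "(\<lambda>x. (f x, h x)) ` S \<subseteq> carrier G \<times> carrier G"
    using smooth_map_on_in_topspace[OF f assms(2)] smooth_map_on_in_topspace[OF h assms(2)] topspace_G by auto
  from smooth_map_on_compose[OF assms(1) locally_euclidean_prod locally_euclidean_G assms(2) smooth_map_on_Pair this m]
  show ?thesis using assms locally_euclidean_G by simp
qed

lemma smooth_map_on_inv:
  assumes "locally_euclidean M" "openin (mtop M) S" and f: "smooth_map_on M (gmfd G) S f"
  shows "smooth_map_on M (gmfd G) S (\<lambda>x. inv\<^bsub>G\<^esub> f x)"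
proof -
  have i: "smooth_map_on (gmfd G) (gmfd G) (carrier G) (\<lambda>g. inv\<^bsub>G\<^esub> g)"
    using lie_group_G by (simp add: lie_group_def)
  have "f ` S \<subseteq> carrier G"
    using smooth_map_on_in_topspace[OF f assms(2)] topspace_G by auto
  from smooth_map_on_compose[OF assms(1) locally_euclidean_G locally_euclidean_G assms(2) f this i]
  show ?thesis .
qed

lemma group_map_closed:
  "smooth_map_on M (gmfd G) S f \<Longrightarrow> openin (mtop M) S \<Longrightarrow> x \<in> S \<Longrightarrow> f x \<in> carrier G"
  using smooth_map_on_in_topspace[of M "gmfd G" S f x] topspace_G by simp

lemma smooth_map_on_const_G: "a \<in> carrier G \<Longrightarrow> smooth_map_on M (gmfd G) S (\<lambda>x. a)"
  by (simp add: smooth_map_on_const topspace_G)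

lemma smooth_conjugation:
  assumes "a \<in> carrier G"
  shows "smooth_map_on (gmfd G) (gmfd G) (carrier G) (\<lambda>h. a \<otimes>\<^bsub>G\<^esub> h \<otimes>\<^bsub>G\<^esub> inv\<^bsub>G\<^esub> a)"
  using assms
  by (intro smooth_map_on_mult locally_euclidean_G openin_carrier smooth_map_on_const_G
      smooth_map_on_id[OF manifold_G] inv_closed)

lemma conjugation_one: "a \<in> carrier G \<Longrightarrow> a \<otimes>\<^bsub>G\<^esub> \<one>\<^bsub>G\<^esub> \<otimes>\<^bsub>G\<^esub> inv\<^bsub>G\<^esub> a = \<one>\<^bsub>G\<^esub>"
  by simp

lemma Ad_closed:
  assumes a: "a \<in> carrier G" and u: "u \<in> lie_algebra G"
  shows "Ad G a u \<in> lie_algebra G"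
  using tangent_map_in_tangent_space[OF manifold_G manifold_G openin_carrier one_closed smooth_conjugation[OF a]]
    u conjugation_one[OF a] by (simp add: Ad_def lie_algebra_def)

lemma Ad_add:
  assumes a: "a \<in> carrier G"
  shows "Ad G a (tv_add u w) = tv_add (Ad G a u) (Ad G a w)"
  unfolding Ad_def
  by (rule tangent_map_linear[OF locally_euclidean_G openin_carrier one_closed smooth_conjugation[OF a]])

lemma Ad_scale:
  assumes a: "a \<in> carrier G"
  shows "Ad G a (tv_scale r u) = tv_scale r (Ad G a u)"
  unfolding Ad_def
  by (rule tangent_map_linear[OF locally_euclidean_G openin_carrier one_closed smooth_conjugation[OF a]])

lemma Ad_mult:
  assumes a: "a \<in> carrier G" and b: "b \<in> carrier G" and u: "u \<in> lie_algebra G"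
  shows "Ad G (a \<otimes>\<^bsub>G\<^esub> b) u = Ad G a (Ad G b u)"
proof -
  let ?c = "\<lambda>a h. a \<otimes>\<^bsub>G\<^esub> h \<otimes>\<^bsub>G\<^esub> inv\<^bsub>G\<^esub> a"
  have 1: "tangent_map (gmfd G) (gmfd G) (?c (a \<otimes>\<^bsub>G\<^esub> b)) \<one>\<^bsub>G\<^esub> =
      tangent_map (gmfd G) (gmfd G) (\<lambda>h. ?c a (?c b h)) \<one>\<^bsub>G\<^esub>"
    by (rule tangent_map_cong[OF locally_euclidean_G openin_carrier one_closed])
      (use a b in \<open>simp add: inv_mult_group m_assoc\<close>)
  have 2: "tangent_map (gmfd G) (gmfd G) (\<lambda>h. ?c a (?c b h)) \<one>\<^bsub>G\<^esub> u = tangent_map (gmfd G) (gmfd G) (?c a) (?c b \<one>\<^bsub>G\<^esub>) (tangent_map (gmfd G) (gmfd G) (?c b) \<one>\<^bsub>G\<^esub> u)"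
    by (rule tangent_map_compose[OF manifold_G manifold_G manifold_G openin_carrier one_closed
          smooth_conjugation[OF b] _ openin_carrier smooth_conjugation[OF a]])
      (use b u in \<open>auto simp: lie_algebra_def\<close>)
  show ?thesis unfolding Ad_def 1 2 conjugation_one[OF b] ..
qed

text \<open>With the left translation absorbed, \<open>f\<^sup>-\<^sup>1 df\<close> at \<open>x\<close> is the tangent map at \<open>x\<close> of the single map
  \<open>y \<mapsto> f(x)\<^sup>-\<^sup>1 f(y)\<close>, which takes \<open>x\<close> to \<open>e\<close>.\<close>

lemma maurer_cartan_eq:
  assumes S: "openin (mtop B) S" "x \<in> S" and f: "smooth_map_on B (gmfd G) S f" and v: "v \<in> tangent_space B x"
  shows "maurer_cartan B G f x v = tangent_map B (gmfd G) (\<lambda>y. inv\<^bsub>G\<^esub> f x \<otimes>\<^bsub>G\<^esub> f y) x v"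
proof -
  have fS: "f ` S \<subseteq> carrier G" using group_map_closed[OF f S(1)] by auto
  then have c: "inv\<^bsub>G\<^esub> f x \<in> carrier G" using S by auto
  show ?thesis
    using tangent_map_compose[OF manifold_B manifold_G manifold_G S f fS openin_carrier
        smooth_map_on_mult[OF locally_euclidean_G openin_carrier smooth_map_on_const_G[OF c]
            smooth_map_on_id[OF manifold_G]] v] v
    by (simp add: maurer_cartan_def)
qed

lemma smooth_left_quotient:
  assumes S: "openin (mtop B) S" and f: "smooth_map_on B (gmfd G) S f" and a: "a \<in> carrier G"
  shows "smooth_map_on B (gmfd G) S (\<lambda>y. a \<otimes>\<^bsub>G\<^esub> f y)"
  by (intro smooth_map_on_mult locally_euclidean_B S smooth_map_on_const_G a f)

lemma maurer_cartan_closed: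
  assumes S: "openin (mtop B) S" "x \<in> S" and f: "smooth_map_on B (gmfd G) S f" and v: "v \<in> tangent_space B x"
  shows "maurer_cartan B G f x v \<in> lie_algebra G"
proof -
  have c: "f x \<in> carrier G" by (rule group_map_closed[OF f S])
  then show ?thesis
    using tangent_map_in_tangent_space[OF manifold_B manifold_G S
        smooth_left_quotient[OF S(1) f inv_closed[OF c]] v]
    by (simp add: maurer_cartan_eq[OF S f v] lie_algebra_def)
qed

text \<open>The Leibniz rule: \<open>(f h)\<^sup>-\<^sup>1 d(f h)\<close> at \<open>x\<close> is the derivative along the diagonal of
  \<open>(y, z) \<mapsto> h(x)\<^sup>-\<^sup>1 f(x)\<^sup>-\<^sup>1 f(y) h(z)\<close>. For \<open>y = x\<close> this map is \<open>z \<mapsto> h(x)\<^sup>-\<^sup>1 h(z)\<close>, and for \<open>z = x\<close> it is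
  the conjugation by \<open>h(x)\<^sup>-\<^sup>1\<close> after \<open>y \<mapsto> f(x)\<^sup>-\<^sup>1 f(y)\<close>.\<close>

lemma maurer_cartan_mult:
  assumes S: "openin (mtop B) S" "x \<in> S" and f: "smooth_map_on B (gmfd G) S f"
    and h: "smooth_map_on B (gmfd G) S h" and v: "v \<in> tangent_space B x"
  shows "maurer_cartan B G (\<lambda>y. f y \<otimes>\<^bsub>G\<^esub> h y) x v =
    tv_add (Ad G (inv\<^bsub>G\<^esub> h x) (maurer_cartan B G f x v)) (maurer_cartan B G h x v)"
proof -
  let ?T = "tangent_map B (gmfd G)"
  have fc: "f y \<in> carrier G" and hc: "h y \<in> carrier G" if "y \<in> S" for y
    using group_map_closed[OF f S(1) that] group_map_closed[OF h S(1) that] by auto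
  define a where "a = inv\<^bsub>G\<^esub> f x"
  define b where "b = inv\<^bsub>G\<^esub> h x"
  have a: "a \<in> carrier G" and b: "b \<in> carrier G" and hb: "h x = inv\<^bsub>G\<^esub> b"
    and fa: "a \<otimes>\<^bsub>G\<^esub> f x = \<one>\<^bsub>G\<^esub>"
    using fc[OF S(2)] hc[OF S(2)] by (auto simp: a_def b_def)
  define H where "H = (\<lambda>p. b \<otimes>\<^bsub>G\<^esub> (a \<otimes>\<^bsub>G\<^esub> f (fst p)) \<otimes>\<^bsub>G\<^esub> h (snd p))"
  have SS: "openin (mtop (prod_mfd B B)) (S \<times> S)" using S by (simp add: openin_prod_Times_iff)
  note BB = locally_euclidean_prod[OF locally_euclidean_B locally_euclidean_B]
  have "smooth_map_on (prod_mfd B B) (gmfd G) (S \<times> S) H"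
    unfolding H_def
    by (intro smooth_map_on_mult BB SS smooth_map_on_const_G a b
        smooth_map_on_fst[OF locally_euclidean_B locally_euclidean_B locally_euclidean_G S(1) S(1) f]
        smooth_map_on_snd[OF locally_euclidean_B locally_euclidean_B locally_euclidean_G S(1) S(1) h])
  from tangent_map_diagonal[OF manifold_B manifold_G S this v]
  have *: "?T (\<lambda>y. H (y, y)) x v = tv_add (?T (\<lambda>y. H (y, x)) x v) (?T (\<lambda>y. H (x, y)) x v)" .
  have "maurer_cartan B G (\<lambda>y. f y \<otimes>\<^bsub>G\<^esub> h y) x v = ?T (\<lambda>y. inv\<^bsub>G\<^esub> (f x \<otimes>\<^bsub>G\<^esub> h x) \<otimes>\<^bsub>G\<^esub> (f y \<otimes>\<^bsub>G\<^esub> h y)) x v"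
    by (rule maurer_cartan_eq[OF S smooth_map_on_mult[OF locally_euclidean_B S(1) f h] v])
  also have "\<dots> = ?T (\<lambda>y. H (y, y)) x v"
    by (rule arg_cong[where f="\<lambda>t. t v", OF tangent_map_cong[OF locally_euclidean_B S]])
      (use fc hc S in \<open>simp add: H_def a_def b_def inv_mult_group m_assoc\<close>)
  finally have 1: "maurer_cartan B G (\<lambda>y. f y \<otimes>\<^bsub>G\<^esub> h y) x v = ?T (\<lambda>y. H (y, y)) x v" .
  have "?T (\<lambda>y. H (x, y)) x v = ?T (\<lambda>y. b \<otimes>\<^bsub>G\<^esub> h y) x v"
    by (rule arg_cong[where f="\<lambda>t. t v", OF tangent_map_cong[OF locally_euclidean_B S]])
      (use fc hc S b in \<open>simp add: H_def fa\<close>)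
  also have "\<dots> = maurer_cartan B G h x v"
    unfolding b_def by (rule maurer_cartan_eq[OF S h v, symmetric])
  finally have 2: "?T (\<lambda>y. H (x, y)) x v = maurer_cartan B G h x v" .
  have "?T (\<lambda>y. H (y, x)) x v =
      tangent_map (gmfd G) (gmfd G) (\<lambda>u. b \<otimes>\<^bsub>G\<^esub> u \<otimes>\<^bsub>G\<^esub> inv\<^bsub>G\<^esub> b) (a \<otimes>\<^bsub>G\<^esub> f x) (?T (\<lambda>y. a \<otimes>\<^bsub>G\<^esub> f y) x v)"
    unfolding H_def fst_conv snd_conv hb
    by (rule tangent_map_compose[OF manifold_B manifold_G manifold_G S smooth_left_quotient[OF S(1) f a]
          _ openin_carrier smooth_conjugation[OF b] v]) (use fc a in auto)
  also have "\<dots> = Ad G b (maurer_cartan B G f x v)"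
    unfolding fa Ad_def maurer_cartan_eq[OF S f v, folded a_def] ..
  finally show ?thesis using * 1 2 by (simp add: b_def)
qed

lemma smooth_form1_closed:
  assumes "smooth_form1_on B G U \<theta>" "x \<in> U" "v \<in> tangent_space B x"
  shows "\<theta> x v \<in> lie_algebra G"
  using assms unfolding smooth_form1_on_def by blast

lemma smooth_form1_linear:
  assumes "smooth_form1_on B G U \<theta>" "x \<in> U" "v \<in> tangent_space B x"
  shows "w \<in> tangent_space B x \<Longrightarrow> \<theta> x (tv_add v w) = tv_add (\<theta> x v) (\<theta> x w)"
    and "\<theta> x (tv_scale r v) = tv_scale r (\<theta> x v)"
  using assms unfolding smooth_form1_on_def by blast+

lemma smooth_form1_component:
  assumes "smooth_form1_on B G U \<theta>" "k \<in> atlas B" "l \<in> charts_at (gmfd G) \<one>\<^bsub>G\<^esub>"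
  shows "smooth_on (snd k ` (U \<inter> fst k)) (\<lambda>y. \<theta> (chart_inv k y) (coord_vec B k (chart_inv k y) e) l)"
  using assms unfolding smooth_form1_on_def by blast

text \<open>A criterion for smoothness of a form in which points of \<open>U\<close> replace their coordinates: the components
  of the form are to be given as \<open>h \<circ> snd k\<close> with smooth \<open>h\<close>.\<close>

lemma smooth_form1_restrictI:
  assumes U: "openin (mtop B) U"
    and closed: "\<And>x v. x \<in> U \<Longrightarrow> v \<in> tangent_space B x \<Longrightarrow> \<eta> x v \<in> lie_algebra G"
    and add: "\<And>x v w. x \<in> U \<Longrightarrow> v \<in> tangent_space B x \<Longrightarrow> w \<in> tangent_space B x \<Longrightarrow>
        \<eta> x (tv_add v w) = tv_add (\<eta> x v) (\<eta> x w)"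
    and scale: "\<And>x v r. x \<in> U \<Longrightarrow> v \<in> tangent_space B x \<Longrightarrow> \<eta> x (tv_scale r v) = tv_scale r (\<eta> x v)"
    and smooth: "\<And>k l e. k \<in> atlas B \<Longrightarrow> l \<in> charts_at (gmfd G) \<one>\<^bsub>G\<^esub> \<Longrightarrow>
        \<exists>h. smooth_on (snd k ` (U \<inter> fst k)) h \<and>
          (\<forall>x\<in>U \<inter> fst k. h (snd k x) = \<eta> x (coord_vec B k x e) l)"
  shows "smooth_form1_on B G U (\<lambda>x. \<lambda>v\<in>tangent_space B x. \<eta> x v)"
  unfolding smooth_form1_on_def
proof (intro conjI ballI allI)
  fix x assume x: "x \<in> U"
  show "(\<lambda>v\<in>tangent_space B x. \<eta> x v) \<in> tangent_space B x \<rightarrow>\<^sub>E lie_algebra G"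
    using closed[OF x] by auto
  fix v r assume v: "v \<in> tangent_space B x"
  show "(\<lambda>v\<in>tangent_space B x. \<eta> x v) (tv_scale r v) = tv_scale r ((\<lambda>v\<in>tangent_space B x. \<eta> x v) v)"
    using scale[OF x v] v tangent_space_closed(2)[OF manifold_B v] by simp
  fix w assume w: "w \<in> tangent_space B x"
  show "(\<lambda>v\<in>tangent_space B x. \<eta> x v) (tv_add v w) =
      tv_add ((\<lambda>v\<in>tangent_space B x. \<eta> x v) v) ((\<lambda>v\<in>tangent_space B x. \<eta> x v) w)"
    using add[OF x v w] v w tangent_space_closed(1)[OF manifold_B v w] by simp
next
  fix k l e assume k: "k \<in> atlas B" and l: "l \<in> charts_at (gmfd G) \<one>\<^bsub>G\<^esub>"
  obtain h where h: "smooth_on (snd k ` (U \<inter> fst k)) h"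
    "\<And>x. x \<in> U \<inter> fst k \<Longrightarrow> h (snd k x) = \<eta> x (coord_vec B k x e) l"
    using smooth[OF k l] by blast
  show "smooth_on (snd k ` (U \<inter> fst k))
      (\<lambda>y. (\<lambda>v\<in>tangent_space B (chart_inv k y). \<eta> (chart_inv k y) v) (coord_vec B k (chart_inv k y) e) l)"
    using h(1)
  proof (rule smooth_on_cong[OF chart_image_open[OF locally_euclidean_B k U], THEN iffD1, rotated])
    fix y assume "y \<in> snd k ` (U \<inter> fst k)"
    then obtain x where x: "x \<in> U \<inter> fst k" "y = snd k x" by auto
    then have "k \<in> charts_at B x" using k by (simp add: charts_at_def)
    then show "h y = (\<lambda>v\<in>tangent_space B (chart_inv k y). \<eta> (chart_inv k y) v) (coord_vec B k (chart_inv k y) e) l"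
      using x h(2)[OF x(1)] chart_inv_chart[OF locally_euclidean_B k] coord_vec_in_tangent_space(1)[OF manifold_B]
      by simp
  qed
qed

lemma smooth_form1_component_at:
  assumes "smooth_form1_on B G U \<theta>" "k \<in> atlas B" "l \<in> charts_at (gmfd G) \<one>\<^bsub>G\<^esub>"
  shows "\<exists>h. smooth_on (snd k ` (U \<inter> fst k)) h \<and> (\<forall>x\<in>U \<inter> fst k. h (snd k x) = \<theta> x (coord_vec B k x e) l)"
  using smooth_form1_component[OF assms, of e] chart_inv_chart[OF locally_euclidean_B assms(2)]
  by (intro exI conjI ballI) (assumption, simp)

lemma smooth_form1_add:
  assumes U: "openin (mtop B) U" and t: "smooth_form1_on B G U \<theta>" and e: "smooth_form1_on B G U \<eta>"
  shows "smooth_form1_on B G U (form1_add B \<theta> \<eta>)"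
  unfolding form1_add_def
proof (rule smooth_form1_restrictI[OF U])
  show "tv_add (\<theta> x v) (\<eta> x v) \<in> lie_algebra G" if "x \<in> U" "v \<in> tangent_space B x" for x v
    using smooth_form1_closed[OF t that] smooth_form1_closed[OF e that] tangent_space_closed(1)[OF manifold_G]
    by (simp add: lie_algebra_def)
  show "tv_add (\<theta> x (tv_add v w)) (\<eta> x (tv_add v w)) = tv_add (tv_add (\<theta> x v) (\<eta> x v)) (tv_add (\<theta> x w) (\<eta> x w))"
    if "x \<in> U" "v \<in> tangent_space B x" "w \<in> tangent_space B x" for x v w
    using smooth_form1_linear(1)[OF t that] smooth_form1_linear(1)[OF e that] by (simp add: tv_add_def ac_simps)
  show "tv_add (\<theta> x (tv_scale r v)) (\<eta> x (tv_scale r v)) = tv_scale r (tv_add (\<theta> x v) (\<eta> x v))"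
    if "x \<in> U" "v \<in> tangent_space B x" for x v r
    using smooth_form1_linear(2)[OF t that] smooth_form1_linear(2)[OF e that] by (simp add: tv_add_def tv_scale_def scaleR_add_right)
  fix k :: "('b, 'eb) chart" and l e'
  assume k: "k \<in> atlas B" and l: "l \<in> charts_at (gmfd G) \<one>\<^bsub>G\<^esub>"
  obtain h1 where h1: "smooth_on (snd k ` (U \<inter> fst k)) h1"
    "\<And>x. x \<in> U \<inter> fst k \<Longrightarrow> h1 (snd k x) = \<theta> x (coord_vec B k x e') l"
    using smooth_form1_component_at[OF t k l] by blast
  obtain h2 where h2: "smooth_on (snd k ` (U \<inter> fst k)) h2"
    "\<And>x. x \<in> U \<inter> fst k \<Longrightarrow> h2 (snd k x) = \<eta> x (coord_vec B k x e') l"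
    using smooth_form1_component_at[OF e k l] by blast
  show "\<exists>h. smooth_on (snd k ` (U \<inter> fst k)) h \<and>
      (\<forall>x\<in>U \<inter> fst k. h (snd k x) = tv_add (\<theta> x (coord_vec B k x e')) (\<eta> x (coord_vec B k x e')) l)"
    using smooth_on_add[OF chart_image_open[OF locally_euclidean_B k U] h1(1) h2(1)] h1(2) h2(2)
    by (intro exI[of _ "\<lambda>y. h1 y + h2 y"]) (simp add: tv_add_def)
qed

lemma smooth_maurer_cartan:
  assumes U: "openin (mtop B) U" and f: "smooth_map_on B (gmfd G) U f"
  shows "smooth_form1_on B G U (maurer_cartan B G f)"
proof -
  let ?m = "\<lambda>x v. tangent_map B (gmfd G) (\<lambda>y. inv\<^bsub>G\<^esub> f x \<otimes>\<^bsub>G\<^esub> f y) x v"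
  have eq: "maurer_cartan B G f x = (\<lambda>v\<in>tangent_space B x. maurer_cartan B G f x v)" for x
    by (auto simp: maurer_cartan_def)
  have fc: "f x \<in> carrier G" if "x \<in> U" for x using group_map_closed[OF f U that] .
  note q = smooth_left_quotient[OF U f inv_closed[OF fc]]
  have "smooth_form1_on B G U (\<lambda>x. \<lambda>v\<in>tangent_space B x. maurer_cartan B G f x v)"
  proof (rule smooth_form1_restrictI[OF U])
    show "maurer_cartan B G f x v \<in> lie_algebra G" if "x \<in> U" "v \<in> tangent_space B x" for x v
      by (rule maurer_cartan_closed[OF U that(1) f that(2)])
    show "maurer_cartan B G f x (tv_add v w) = tv_add (maurer_cartan B G f x v) (maurer_cartan B G f x w)"
      if "x \<in> U" "v \<in> tangent_space B x" "w \<in> tangent_space B x" for x v w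
      using that tangent_space_closed(1)[OF manifold_B that(2,3)]
        tangent_map_linear(1)[OF locally_euclidean_B U that(1) q[OF that(1)]]
      by (simp add: maurer_cartan_eq[OF U that(1) f])
    show "maurer_cartan B G f x (tv_scale r v) = tv_scale r (maurer_cartan B G f x v)"
      if "x \<in> U" "v \<in> tangent_space B x" for x v r
      using that tangent_space_closed(2)[OF manifold_B that(2)]
        tangent_map_linear(2)[OF locally_euclidean_B U that(1) q[OF that(1)]]
      by (simp add: maurer_cartan_eq[OF U that(1) f])
    fix k :: "('b, 'eb) chart" and l e
    assume k: "k \<in> atlas B" and l: "l \<in> charts_at (gmfd G) \<one>\<^bsub>G\<^esub>"
    note l' = charts_atD[OF l]
    define F where "F = (\<lambda>p. inv\<^bsub>G\<^esub> f (fst p) \<otimes>\<^bsub>G\<^esub> f (snd p))"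
    note BB = locally_euclidean_prod[OF locally_euclidean_B locally_euclidean_B]
    have UU: "openin (prod_topology (mtop B) (mtop B)) (U \<times> U)" using U by (simp add: openin_prod_Times_iff)
    have F: "smooth_map_on (prod_mfd B B) (gmfd G) (U \<times> U) F"
      unfolding F_def
      by (intro smooth_map_on_mult smooth_map_on_inv BB
        smooth_map_on_fst[OF locally_euclidean_B locally_euclidean_B locally_euclidean_G U U f]
        smooth_map_on_snd[OF locally_euclidean_B locally_euclidean_B locally_euclidean_G U U f])
        (use UU in simp_all)
    note rep = smooth_on_prod_chart_rep[OF locally_euclidean_B locally_euclidean_B locally_euclidean_G UU F k k l'(1)]
    have fd: "finite_dim TYPE('eb)" using locally_euclidean_B by (simp add: locally_euclidean_def)
    have "smooth_on (snd k ` (U \<inter> fst k))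
       (\<lambda>y. frechet_derivative (\<lambda>z. (\<lambda>(y, z). snd l (F (chart_inv k y, chart_inv k z))) (y, z)) (at y) e)"
    proof (rule smooth_on_partial_derivative[OF fd fd rep(2) chart_image_open[OF locally_euclidean_B k U]
          smooth_on_bounded_linear[OF bounded_linear_ident] smooth_on_bounded_linear[OF bounded_linear_ident]])
      fix y assume "y \<in> snd k ` (U \<inter> fst k)"
      then obtain x where "x \<in> U" "x \<in> fst k" "y = snd k x" by auto
      then show "(y, y) \<in> map_prod (snd k) (snd k) ` (U \<times> U \<inter> fst k \<times> fst k \<inter> F -` fst l)"
        using fc l'(2) by (intro image_eqI[of _ _ "(x, x)"]) (auto simp: F_def)
    qed
    moreover have "frechet_derivative (\<lambda>z. snd l (F (chart_inv k (snd k x), chart_inv k z))) (at (snd k x)) e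
        = maurer_cartan B G f x (coord_vec B k x e) l" if x: "x \<in> U \<inter> fst k" for x
    proof -
      have kx: "k \<in> charts_at B x" and xU: "x \<in> U" using x k by (auto simp: charts_at_def)
      have lx: "l \<in> charts_at (gmfd G) (inv\<^bsub>G\<^esub> f x \<otimes>\<^bsub>G\<^esub> f x)" using l fc[OF xU] by simp
      show ?thesis
        using tangent_map_chart[OF manifold_B locally_euclidean_G U xU q[OF xU]
            coord_vec_in_tangent_space(1)[OF manifold_B kx] kx lx]
          chart_inv_chart[OF locally_euclidean_B k] x
        by (simp add: maurer_cartan_eq[OF U xU f coord_vec_in_tangent_space(1)[OF manifold_B kx]]
            coord_vec_in_tangent_space(2)[OF manifold_B kx] F_def)
    qed
    ultimately show "\<exists>h. smooth_on (snd k ` (U \<inter> fst k)) h \<and>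
        (\<forall>x\<in>U \<inter> fst k. h (snd k x) = maurer_cartan B G f x (coord_vec B k x e) l)"
      by (intro exI conjI ballI) (assumption, simp)
  qed
  then show ?thesis using eq by (metis (no_types, lifting) ext)
qed

lemma smooth_form1_Ad:
  assumes U: "openin (mtop B) U" and g: "smooth_map_on B (gmfd G) U g" and t: "smooth_form1_on B G U \<theta>"
  shows "smooth_form1_on B G U (form1_Ad B G g \<theta>)"
  unfolding form1_Ad_def
proof (rule smooth_form1_restrictI[OF U])
  have gc: "g x \<in> carrier G" if "x \<in> U" for x using group_map_closed[OF g U that] .
  show "Ad G (g x) (\<theta> x v) \<in> lie_algebra G" if "x \<in> U" "v \<in> tangent_space B x" for x v
    by (rule Ad_closed[OF gc[OF that(1)] smooth_form1_closed[OF t that]])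
  show "Ad G (g x) (\<theta> x (tv_add v w)) = tv_add (Ad G (g x) (\<theta> x v)) (Ad G (g x) (\<theta> x w))"
    if "x \<in> U" "v \<in> tangent_space B x" "w \<in> tangent_space B x" for x v w
    by (simp add: smooth_form1_linear(1)[OF t that] Ad_add[OF gc[OF that(1)]])
  show "Ad G (g x) (\<theta> x (tv_scale r v)) = tv_scale r (Ad G (g x) (\<theta> x v))"
    if "x \<in> U" "v \<in> tangent_space B x" for x v r
    by (simp add: smooth_form1_linear(2)[OF t that] Ad_scale[OF gc[OF that(1)]])
  fix k :: "('b, 'eb) chart" and l e
  assume k: "k \<in> atlas B" and l: "l \<in> charts_at (gmfd G) \<one>\<^bsub>G\<^esub>"
  note l' = charts_atD[OF l]
  let ?D = "snd k ` (U \<inter> fst k)"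
  note D = chart_image_open[OF locally_euclidean_B k U]
  define F where "F = (\<lambda>p. g (fst p) \<otimes>\<^bsub>G\<^esub> snd p \<otimes>\<^bsub>G\<^esub> inv\<^bsub>G\<^esub> g (fst p))"
  note BG = locally_euclidean_prod[OF locally_euclidean_B locally_euclidean_G]
  have UG: "openin (prod_topology (mtop B) (mtop (gmfd G))) (U \<times> carrier G)"
    using U openin_carrier by (simp add: openin_prod_Times_iff)
  have F: "smooth_map_on (prod_mfd B (gmfd G)) (gmfd G) (U \<times> carrier G) F"
    unfolding F_def
    by (intro smooth_map_on_mult smooth_map_on_inv BG
      smooth_map_on_fst[OF locally_euclidean_B locally_euclidean_G locally_euclidean_G U openin_carrier g]
      smooth_map_on_snd[OF locally_euclidean_B locally_euclidean_G locally_euclidean_G U openin_carrier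
        smooth_map_on_id[OF manifold_G]])
      (use UG in simp_all)
  note rep = smooth_on_prod_chart_rep[OF locally_euclidean_B locally_euclidean_G locally_euclidean_G UG F k l'(1) l'(1)]
  have fd: "finite_dim TYPE('eb)" "finite_dim TYPE('eg)"
    using locally_euclidean_B locally_euclidean_G by (auto simp: locally_euclidean_def)
  obtain C :: "'eg set" where C: "\<And>x. x = (\<Sum>b\<in>C. ((x \<bullet> b) / (b \<bullet> b)) *\<^sub>R b)"
    using finite_dim_orthogonal_expansion[OF fd(2)] by metis
  \<comment> \<open>\<open>P b y\<close> is the \<open>l\<close>-coordinate of \<open>Ad(g x)\<close> applied to the vector with \<open>l\<close>-coordinate \<open>b\<close>, for \<open>y = k x\<close>\<close>
  define P where "P = (\<lambda>b y. frechet_derivative (\<lambda>z. (\<lambda>(y, z). snd l (F (chart_inv k y, chart_inv l z))) (y, z))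
      (at (snd l \<one>\<^bsub>G\<^esub>)) b)"
  have P: "smooth_on ?D (P b)" for b
    unfolding P_def
  proof (rule smooth_on_partial_derivative[OF fd rep(2) D
        smooth_on_bounded_linear[OF bounded_linear_ident] smooth_on_const])
    fix y assume "y \<in> snd k ` (U \<inter> fst k)"
    then obtain x where "x \<in> U" "x \<in> fst k" "y = snd k x" by auto
    then show "(y, snd l \<one>\<^bsub>G\<^esub>) \<in> map_prod (snd k) (snd l) ` (U \<times> carrier G \<inter> fst k \<times> fst l \<inter> F -` fst l)"
      using gc l'(2) by (intro image_eqI[of _ _ "(x, \<one>\<^bsub>G\<^esub>)"]) (auto simp: F_def)
  qed
  obtain h where h: "smooth_on ?D h" "\<And>x. x \<in> U \<inter> fst k \<Longrightarrow> h (snd k x) = \<theta> x (coord_vec B k x e) l"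
    using smooth_form1_component_at[OF t k l] by blast
  have "smooth_on ?D (\<lambda>y. \<Sum>b\<in>C. (h y \<bullet> (b /\<^sub>R (b \<bullet> b))) *\<^sub>R P b y)"
    by (intro smooth_on_sum[OF D] smooth_on_scaleR[OF D] smooth_on_inner[OF D] h(1) P)
  moreover have "(\<Sum>b\<in>C. (h (snd k x) \<bullet> (b /\<^sub>R (b \<bullet> b))) *\<^sub>R P b (snd k x)) = Ad G (g x) (\<theta> x (coord_vec B k x e)) l"
    if x: "x \<in> U \<inter> fst k" for x
  proof -
    have kx: "k \<in> charts_at B x" and xU: "x \<in> U" using x k by (auto simp: charts_at_def)
    have lx: "l \<in> charts_at (gmfd G) (g x \<otimes>\<^bsub>G\<^esub> \<one>\<^bsub>G\<^esub> \<otimes>\<^bsub>G\<^esub> inv\<^bsub>G\<^esub> g x)"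
      using l conjugation_one[OF gc[OF xU]] by simp
    let ?c = "\<lambda>z. snd l (g x \<otimes>\<^bsub>G\<^esub> chart_inv l z \<otimes>\<^bsub>G\<^esub> inv\<^bsub>G\<^esub> g x)"
    note sc = smooth_conjugation[OF gc[OF xU]]
    have lin: "linear (frechet_derivative ?c (at (snd l \<one>\<^bsub>G\<^esub>)))"
      by (rule linear_frechet_derivative[OF chart_rep_differentiable[OF sc one_closed l lx]])
    have u: "\<theta> x (coord_vec B k x e) \<in> tangent_space (gmfd G) \<one>\<^bsub>G\<^esub>"
      using smooth_form1_closed[OF t xU coord_vec_in_tangent_space(1)[OF manifold_B kx]] by (simp add: lie_algebra_def)
    have "Ad G (g x) (\<theta> x (coord_vec B k x e)) l =
        frechet_derivative ?c (at (snd l \<one>\<^bsub>G\<^esub>)) (\<theta> x (coord_vec B k x e) l)"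
      unfolding Ad_def
      by (rule tangent_map_chart[OF manifold_G locally_euclidean_G openin_carrier one_closed sc u l lx])
    also have "\<dots> = (\<Sum>b\<in>C. (\<theta> x (coord_vec B k x e) l \<bullet> (b /\<^sub>R (b \<bullet> b))) *\<^sub>R frechet_derivative ?c (at (snd l \<one>\<^bsub>G\<^esub>)) b)"
      by (rule linear_orthogonal_expansion[OF lin C])
    also have "\<dots> = (\<Sum>b\<in>C. (h (snd k x) \<bullet> (b /\<^sub>R (b \<bullet> b))) *\<^sub>R P b (snd k x))"
      using x chart_inv_chart[OF locally_euclidean_B k] by (simp add: h(2)[OF x] P_def F_def)
    finally show ?thesis by simp
  qed
  ultimately show "\<exists>h. smooth_on ?D h \<and>
      (\<forall>x\<in>U \<inter> fst k. h (snd k x) = Ad G (g x) (\<theta> x (coord_vec B k x e)) l)"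
    by blast
qed

text \<open>The right action of \<open>G\<close>-valued maps on forms, \<open>\<theta> \<bullet> a = Ad(a\<^sup>-\<^sup>1) \<theta> + a\<^sup>-\<^sup>1 da\<close>.\<close>

definition gauge_transform :: "('b, 'eb, 'g, 'eg) form1 \<Rightarrow> ('b \<Rightarrow> 'g) \<Rightarrow> ('b, 'eb, 'g, 'eg) form1" where
  "gauge_transform \<theta> a = form1_add B (form1_Ad B G (\<lambda>x. inv\<^bsub>G\<^esub> a x) \<theta>) (maurer_cartan B G a)"

lemma smooth_gauge_transform:
  assumes U: "openin (mtop B) U" and t: "smooth_form1_on B G U \<theta>" and a: "smooth_map_on B (gmfd G) U a"
  shows "smooth_form1_on B G U (gauge_transform \<theta> a)"
  unfolding gauge_transform_def
  by (intro smooth_form1_add smooth_form1_Ad smooth_maurer_cartan smooth_map_on_inv locally_euclidean_B U t a)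

lemma gauge_transform_mult:
  assumes U: "openin (mtop B) U" "x \<in> U" and t: "smooth_form1_on B G U \<theta>"
    and a: "smooth_map_on B (gmfd G) U a" and b: "smooth_map_on B (gmfd G) U b"
  shows "gauge_transform (gauge_transform \<theta> a) b x = gauge_transform \<theta> (\<lambda>y. a y \<otimes>\<^bsub>G\<^esub> b y) x"
proof
  fix v
  show "gauge_transform (gauge_transform \<theta> a) b x v = gauge_transform \<theta> (\<lambda>y. a y \<otimes>\<^bsub>G\<^esub> b y) x v"
  proof (cases "v \<in> tangent_space B x")
    case v: True
    have c: "a x \<in> carrier G" "b x \<in> carrier G"
      using group_map_closed[OF a U] group_map_closed[OF b U] by auto
    have "Ad G (inv\<^bsub>G\<^esub> (a x \<otimes>\<^bsub>G\<^esub> b x)) (\<theta> x v) = Ad G (inv\<^bsub>G\<^esub> b x) (Ad G (inv\<^bsub>G\<^esub> a x) (\<theta> x v))"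
      using c smooth_form1_closed[OF t U(2) v] by (simp add: inv_mult_group Ad_mult)
    then show ?thesis
      using v c by (simp add: gauge_transform_def form1_add_def form1_Ad_def maurer_cartan_mult[OF U a b v]
          Ad_add tv_add_assoc)
  qed (simp add: gauge_transform_def form1_add_def)
qed

end

section \<open>Germs and the etale topology\<close>

text \<open>Presheaves here are families of sets of functions; the restriction maps are inclusions.\<close>

definition restriction_closed :: "'b topology \<Rightarrow> ('b, 'c) presheaf \<Rightarrow> bool" where
  "restriction_closed T F \<longleftrightarrow> (\<forall>U V s. openin T U \<longrightarrow> openin T V \<longrightarrow> V \<subseteq> U \<longrightarrow> s \<in> F U \<longrightarrow> s \<in> F V)"

lemma restriction_closedD:
  "restriction_closed T F \<Longrightarrow> openin T U \<Longrightarrow> openin T V \<Longrightarrow> V \<subseteq> U \<Longrightarrow> s \<in> F U \<Longrightarrow> s \<in> F V"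
  by (auto simp: restriction_closed_def)

lemma fst_germ_at [simp]: "fst (germ_at T s x) = x"
  by (simp add: germ_at_def)

lemma germ_at_cong:
  assumes W: "openin T W" "x \<in> W" and eq: "\<And>y. y \<in> W \<Longrightarrow> s y = t y"
  shows "germ_at T s x = germ_at T t x"
proof -
  have "(\<exists>V. openin T V \<and> x \<in> V \<and> (\<forall>y\<in>V. r y = s y)) \<longleftrightarrow> (\<exists>V. openin T V \<and> x \<in> V \<and> (\<forall>y\<in>V. r y = t y))" for r
  proof
    assume "\<exists>V. openin T V \<and> x \<in> V \<and> (\<forall>y\<in>V. r y = s y)"
    then obtain V where "openin T V" "x \<in> V" "\<forall>y\<in>V. r y = s y" by blast
    then show "\<exists>V. openin T V \<and> x \<in> V \<and> (\<forall>y\<in>V. r y = t y)"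
      using W eq by (intro exI[of _ "V \<inter> W"]) auto
  next
    assume "\<exists>V. openin T V \<and> x \<in> V \<and> (\<forall>y\<in>V. r y = t y)"
    then obtain V where "openin T V" "x \<in> V" "\<forall>y\<in>V. r y = t y" by blast
    then show "\<exists>V. openin T V \<and> x \<in> V \<and> (\<forall>y\<in>V. r y = s y)"
      using W eq by (intro exI[of _ "V \<inter> W"]) auto
  qed
  then show ?thesis by (simp add: germ_at_def)
qed

lemma germ_at_eqD:
  assumes "germ_at T s x = germ_at T t x'" and x: "x \<in> topspace T"
  obtains W where "openin T W" "x \<in> W" "\<And>y. y \<in> W \<Longrightarrow> s y = t y" "x' = x"
proof -
  have "s \<in> {r. \<exists>V. openin T V \<and> x \<in> V \<and> (\<forall>y\<in>V. r y = s y)}"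
    using x by auto
  then have "s \<in> {r. \<exists>V. openin T V \<and> x \<in> V \<and> (\<forall>y\<in>V. r y = t y)}" "x' = x"
    using assms(1) by (auto simp: germ_at_def)
  then show thesis using that by blast
qed

lemma germ_in_etale:
  "openin T U \<Longrightarrow> s \<in> F U \<Longrightarrow> x \<in> U \<Longrightarrow> germ_at T s x \<in> topspace (etale T F)"
  by (auto simp: etale_def)

lemma etale_germE:
  assumes "w \<in> topspace (etale T F)"
  obtains U s x where "openin T U" "s \<in> F U" "x \<in> U" "w = germ_at T s x"
  using assms by (auto simp: etale_def)

lemma openin_etale_image: "openin T U \<Longrightarrow> s \<in> F U \<Longrightarrow> openin (etale T F) (germ_at T s ` U)"
  unfolding etale_def by (rule topology_generated_by_Basis) blast

text \<open>The map \<open>germ_at T s\<close> is continuous on \<open>U\<close> for \<open>s \<in> F U\<close>. The sets \<open>germ_at T s ` U\<close> are introduced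
  as a subbase only; closure under restriction makes them a base.\<close>

lemma openin_etale_germ:
  assumes F: "restriction_closed T F" and A: "openin (etale T F) A"
    and U: "openin T U" "s \<in> F U" "x \<in> U" and x: "germ_at T s x \<in> A"
  obtains V where "openin T V" "x \<in> V" "V \<subseteq> U" "germ_at T s ` V \<subseteq> A"
proof -
  have "generate_topology_on {germ_at T s ` U | U s. openin T U \<and> s \<in> F U} A"
    using A by (simp add: etale_def openin_topology_generated_by_iff)
  then have "germ_at T s x \<in> A \<longrightarrow> (\<exists>V. openin T V \<and> x \<in> V \<and> V \<subseteq> U \<and> germ_at T s ` V \<subseteq> A)"
  proof (induction rule: generate_topology_on.induct)
    case Empty
    show ?case by simp
  next
    case (Int A B)
    show ?case
    proof
      assume "germ_at T s x \<in> A \<inter> B"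
      then obtain V W where V: "openin T V" "x \<in> V" "V \<subseteq> U" "germ_at T s ` V \<subseteq> A"
        "openin T W" "x \<in> W" "W \<subseteq> U" "germ_at T s ` W \<subseteq> B" using Int by blast
      show "\<exists>V. openin T V \<and> x \<in> V \<and> V \<subseteq> U \<and> germ_at T s ` V \<subseteq> A \<inter> B"
        by (rule exI[of _ "V \<inter> W"]) (use V in auto)
    qed
  next
    case (UN K)
    then show ?case by (meson UnionE Union_upper subset_trans)
  next
    case (Basis A)
    then obtain U' t where t: "A = germ_at T t ` U'" "openin T U'" by blast
    show ?case
    proof
      assume "germ_at T s x \<in> A"
      then obtain x' where x': "x' \<in> U'" "germ_at T s x = germ_at T t x'" using t by blast
      have "x \<in> topspace T" using openin_subset[OF U(1)] U(3) by auto
      with x'(2) obtain W where W: "openin T W" "x \<in> W" "\<And>y. y \<in> W \<Longrightarrow> s y = t y" "x' = x"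
        by (rule germ_at_eqD) auto
      have "germ_at T s y \<in> A" if "y \<in> U \<inter> U' \<inter> W" for y
        using germ_at_cong[OF W(1) _ W(3), of y] that t by auto
      then show "\<exists>V. openin T V \<and> x \<in> V \<and> V \<subseteq> U \<and> germ_at T s ` V \<subseteq> A"
        using U t W x' by (intro exI[of _ "U \<inter> U' \<inter> W"]) auto
    qed
  qed
  then show thesis using x that by blast
qed

text \<open>A continuous section of the etale space is locally the family of germs of one element of the
  presheaf.\<close>

lemma sheaf_section_germE:
  assumes F: "restriction_closed T F" and \<sigma>: "\<sigma> \<in> sheaf_sections T (etale T F) U"
    and U: "openin T U" "x \<in> U"
  obtains W s where "openin T W" "x \<in> W" "W \<subseteq> U" "s \<in> F W" "\<And>y. y \<in> W \<Longrightarrow> \<sigma> y = germ_at T s y"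
proof -
  have c: "continuous_map (subtopology T U) (etale T F) \<sigma>" and f: "\<And>y. y \<in> U \<Longrightarrow> fst (\<sigma> y) = y"
    using \<sigma> by (auto simp: sheaf_sections_def)
  have top: "topspace (subtopology T U) = U" using openin_subset[OF U(1)] by auto
  then have "\<sigma> x \<in> topspace (etale T F)"
    using c U(2) by (auto simp: continuous_map_def)
  then obtain V s x' where V: "openin T V" "s \<in> F V" "x' \<in> V" "\<sigma> x = germ_at T s x'"
    by (rule etale_germE)
  define W where "W = V \<inter> {y \<in> U. \<sigma> y \<in> germ_at T s ` V}"
  have "openin (subtopology T U) {y \<in> topspace (subtopology T U). \<sigma> y \<in> germ_at T s ` V}"
    by (rule openin_continuous_map_preimage[OF c openin_etale_image[where F=F, OF V(1,2)]])
  then have "openin T {y \<in> U. \<sigma> y \<in> germ_at T s ` V}"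
    unfolding top openin_open_subtopology[OF U(1)] by blast
  then have W: "openin T W" unfolding W_def using V(1) by blast
  have "x' = x" using f[OF U(2)] V(4) by simp
  then have xW: "x \<in> W" using U V by (auto simp: W_def)
  have sW: "s \<in> F W" by (rule restriction_closedD[OF F V(1) W _ V(2)]) (auto simp: W_def)
  have germ: "\<sigma> y = germ_at T s y" if "y \<in> W" for y
  proof -
    have "\<sigma> y \<in> germ_at T s ` V" using that by (simp add: W_def)
    then obtain z where "\<sigma> y = germ_at T s z" by blast
    moreover have "fst (\<sigma> y) = y" using that f by (auto simp: W_def)
    ultimately show ?thesis by simp
  qed
  have "W \<subseteq> U" by (auto simp: W_def)
  from that[OF W xW this sW germ] show thesis .
qed

text \<open>A map between etale spaces is continuous if it locally turns the germs of one element into the germs of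
  one element.\<close>

lemma continuous_map_etaleI:
  assumes F: "restriction_closed T F" and F': "restriction_closed T F'"
    and loc: "\<And>U s x. openin T U \<Longrightarrow> s \<in> F U \<Longrightarrow> x \<in> U \<Longrightarrow>
      \<exists>W r. openin T W \<and> x \<in> W \<and> W \<subseteq> U \<and> r \<in> F' W \<and> (\<forall>y\<in>W. D (germ_at T s y) = germ_at T r y)"
  shows "continuous_map (etale T F) (etale T F') D"
  unfolding continuous_map_def
proof (intro conjI allI impI)
  show "D \<in> topspace (etale T F) \<rightarrow> topspace (etale T F')"
  proof
    fix w assume "w \<in> topspace (etale T F)"
    then obtain U s x where U: "openin T U" "s \<in> F U" "x \<in> U" "w = germ_at T s x" by (rule etale_germE)
    from loc[OF U(1-3)] obtain W r where "openin T W" "x \<in> W" "r \<in> F' W" "D w = germ_at T r x"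
      using U(4) by blast
    then show "D w \<in> topspace (etale T F')" by (simp add: germ_in_etale)
  qed
  fix A assume A: "openin (etale T F') A"
  show "openin (etale T F) {w \<in> topspace (etale T F). D w \<in> A}"
  proof (subst openin_subopen, intro ballI)
    fix w assume w: "w \<in> {w \<in> topspace (etale T F). D w \<in> A}"
    then have "w \<in> topspace (etale T F)" by simp
    then obtain U s x where U: "openin T U" "s \<in> F U" "x \<in> U" "w = germ_at T s x" by (rule etale_germE)
    from loc[OF U(1-3)] obtain W r where W: "openin T W" "x \<in> W" "W \<subseteq> U" "r \<in> F' W"
      "\<And>y. y \<in> W \<Longrightarrow> D (germ_at T s y) = germ_at T r y" by blast
    have "germ_at T r x \<in> A" using w U(4) W(2,5) by auto
    then obtain V where V: "openin T V" "x \<in> V" "V \<subseteq> W" "germ_at T r ` V \<subseteq> A"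
      by (rule openin_etale_germ[OF F' A W(1,4,2)])
    have sV: "s \<in> F V" by (rule restriction_closedD[OF F U(1) V(1) _ U(2)]) (use V W in auto)
    show "\<exists>B. openin (etale T F) B \<and> w \<in> B \<and> B \<subseteq> {w \<in> topspace (etale T F). D w \<in> A}"
    proof (intro exI conjI)
      show "openin (etale T F) (germ_at T s ` V)" by (rule openin_etale_image[where F=F, OF V(1) sV])
      show "w \<in> germ_at T s ` V" using U(4) V(2) by simp
      show "germ_at T s ` V \<subseteq> {w \<in> topspace (etale T F). D w \<in> A}"
      proof
        fix u assume "u \<in> germ_at T s ` V"
        then obtain y where y: "y \<in> V" "u = germ_at T s y" by blast
        have "D u = germ_at T r y" using y V(3) W(5) by blast
        then show "u \<in> {w \<in> topspace (etale T F). D w \<in> A}"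
          using germ_in_etale[where F=F, OF V(1) sV y(1)] y V(4) by auto
      qed
    qed
  qed
qed

text \<open>A local operation, whose value at \<open>y\<close> depends only on the germs of its arguments at \<open>y\<close>, acts on
  germs through arbitrary representatives.\<close>

lemma germ_map_germ:
  assumes local: "\<And>W s t y. openin T W \<Longrightarrow> y \<in> W \<Longrightarrow> (\<And>z. z \<in> W \<Longrightarrow> s z = t z) \<Longrightarrow> \<phi> s y = \<phi> t y"
    and U: "openin T U" "x \<in> U" "s \<in> F U"
  shows "germ_map T F \<phi> (germ_at T s x) = germ_at T (\<phi> s) x"
  unfolding germ_map_def fst_germ_at
proof (rule the_equality)
  show "\<exists>V t. openin T V \<and> x \<in> V \<and> t \<in> F V \<and> germ_at T s x = germ_at T t x \<and>
      germ_at T (\<phi> s) x = germ_at T (\<phi> t) x"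
    using U by blast
next
  fix b
  assume "\<exists>V t. openin T V \<and> x \<in> V \<and> t \<in> F V \<and> germ_at T s x = germ_at T t x \<and> b = germ_at T (\<phi> t) x"
  then obtain t where t: "germ_at T s x = germ_at T t x" "b = germ_at T (\<phi> t) x" by blast
  have "x \<in> topspace T" using openin_subset[OF U(1)] U(2) by auto
  with t(1) obtain W where W: "openin T W" "x \<in> W" "\<And>y. y \<in> W \<Longrightarrow> s y = t y"
    by (rule germ_at_eqD) auto
  show "b = germ_at T (\<phi> s) x"
    unfolding t(2) by (rule germ_at_cong[OF W(1,2)]) (use local[OF W(1) _ W(3)] in simp)
qed

lemma germ_map2_germ:
  assumes local: "\<And>W s s' t t' y. openin T W \<Longrightarrow> y \<in> W \<Longrightarrow> (\<And>z. z \<in> W \<Longrightarrow> s z = s' z) \<Longrightarrow>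
      (\<And>z. z \<in> W \<Longrightarrow> t z = t' z) \<Longrightarrow> \<phi> s t y = \<phi> s' t' y"
    and U: "openin T U" "x \<in> U" "s \<in> F U" "t \<in> F' U"
  shows "germ_map2 T F F' \<phi> (germ_at T s x) (germ_at T t x) = germ_at T (\<phi> s t) x"
  unfolding germ_map2_def fst_germ_at
proof (rule the_equality)
  show "\<exists>V s' t'. openin T V \<and> x \<in> V \<and> s' \<in> F V \<and> t' \<in> F' V \<and> germ_at T s x = germ_at T s' x \<and>
      germ_at T t x = germ_at T t' x \<and> germ_at T (\<phi> s t) x = germ_at T (\<phi> s' t') x"
    using U by blast
next
  fix b
  assume "\<exists>V s' t'. openin T V \<and> x \<in> V \<and> s' \<in> F V \<and> t' \<in> F' V \<and> germ_at T s x = germ_at T s' x \<and>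
      germ_at T t x = germ_at T t' x \<and> b = germ_at T (\<phi> s' t') x"
  then obtain s' t' where st: "germ_at T s x = germ_at T s' x" "germ_at T t x = germ_at T t' x"
    "b = germ_at T (\<phi> s' t') x" by blast
  have x: "x \<in> topspace T" using openin_subset[OF U(1)] U(2) by auto
  from st(1) x obtain W where W: "openin T W" "x \<in> W" "\<And>y. y \<in> W \<Longrightarrow> s y = s' y"
    by (rule germ_at_eqD) auto
  from st(2) x obtain V where V: "openin T V" "x \<in> V" "\<And>y. y \<in> V \<Longrightarrow> t y = t' y"
    by (rule germ_at_eqD) auto
  have o: "openin T (W \<inter> V)" using W V by blast
  show "b = germ_at T (\<phi> s t) x"
    unfolding st(3)
    by (rule germ_at_cong[OF o], use W V in simp, rule local[OF o]) (use W V in auto)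
qed

section \<open>Gauge transformations of germs\<close>

lemma restriction_closed_bundle_sections: "restriction_closed (mtop B) (bundle_sections P B pr)"
  by (auto simp: restriction_closed_def bundle_sections_def intro: smooth_map_on_subset)

lemma restriction_closed_group_maps: "restriction_closed (mtop B) (group_maps B G)"
  by (auto simp: restriction_closed_def group_maps_def intro: smooth_map_on_subset)

lemma restriction_closed_lie_forms: "restriction_closed (mtop B) (lie_forms B G)"
  unfolding restriction_closed_def lie_forms_def mem_Collect_eq
proof (intro allI impI)
  fix U V \<theta> assume VU: "V \<subseteq> U" and t: "smooth_form1_on B G U \<theta>"
  have "smooth_on (snd k ` (V \<inter> fst k)) (\<lambda>y. \<theta> (chart_inv k y) (coord_vec B k (chart_inv k y) e) l)"
    if "k \<in> atlas B" "l \<in> charts_at (gmfd G) \<one>\<^bsub>G\<^esub>" for k l e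
  proof (rule smooth_on_subset)
    show "smooth_on (snd k ` (U \<inter> fst k)) (\<lambda>y. \<theta> (chart_inv k y) (coord_vec B k (chart_inv k y) e) l)"
      using t that unfolding smooth_form1_on_def by blast
  qed (use VU in auto)
  then show "smooth_form1_on B G V \<theta>"
    using t VU unfolding smooth_form1_on_def by (meson subset_iff)
qed

text \<open>The group component of a local section \<open>t\<close> in the trivialization \<open>\<Phi>\<close>: the map \<open>a\<close> with
  \<open>t = s \<cdot> a\<close> for the natural section \<open>s\<close> of \<open>\<Phi>\<close>.\<close>

definition fibre_coord :: "('p \<Rightarrow> 'b \<times> 'g) \<Rightarrow> ('b \<Rightarrow> 'p) \<Rightarrow> 'b \<Rightarrow> 'g" where
  "fibre_coord \<Phi> t = (\<lambda>x. snd (\<Phi> (t x)))"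

context lie_group_forms
begin

text \<open>The gauge transformation on germs, \<open>\<Theta> \<bullet> a = Ad(a\<^sup>-\<^sup>1) \<Theta> + \<partial> a\<close>.\<close>

definition germ_gauge ::
  "('b, ('b, 'eb) tvec \<Rightarrow> ('g, 'eg) tvec) germ \<Rightarrow> ('b, 'g) germ \<Rightarrow> ('b, ('b, 'eb) tvec \<Rightarrow> ('g, 'eg) tvec) germ"
  where "germ_gauge \<Theta> a = germ_add B G (germ_Ad B G (germ_inv B G a) \<Theta>) (germ_mc B G a)"

lemma maurer_cartan_cong:
  assumes "openin (mtop B) W" "y \<in> W" "\<And>z. z \<in> W \<Longrightarrow> f z = h z"
  shows "maurer_cartan B G f y = maurer_cartan B G h y"
  using tangent_map_cong[where N="gmfd G", OF locally_euclidean_B assms] assms(3)[OF assms(2)]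
  by (simp add: maurer_cartan_def)

lemma germ_gauge_germ:
  assumes U: "openin (mtop B) U" "x \<in> U" and t: "\<theta> \<in> lie_forms B G U" and a: "a \<in> group_maps B G U"
  shows "germ_gauge (germ_at (mtop B) \<theta> x) (germ_at (mtop B) a x) = germ_at (mtop B) (gauge_transform \<theta> a) x"
proof -
  have ai: "(\<lambda>x. inv\<^bsub>G\<^esub> a x) \<in> group_maps B G U"
    using a smooth_map_on_inv[OF locally_euclidean_B U(1)] by (simp add: group_maps_def)
  have 1: "germ_inv B G (germ_at (mtop B) a x) = germ_at (mtop B) (\<lambda>x. inv\<^bsub>G\<^esub> a x) x"
    unfolding germ_inv_def by (rule germ_map_germ[where F="group_maps B G", OF _ U a]) simp
  have 2: "germ_mc B G (germ_at (mtop B) a x) = germ_at (mtop B) (maurer_cartan B G a) x"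
    unfolding germ_mc_def by (rule germ_map_germ[where F="group_maps B G", OF _ U a]) (rule maurer_cartan_cong)
  have 3: "germ_Ad B G (germ_at (mtop B) (\<lambda>x. inv\<^bsub>G\<^esub> a x) x) (germ_at (mtop B) \<theta> x) =
      germ_at (mtop B) (form1_Ad B G (\<lambda>x. inv\<^bsub>G\<^esub> a x) \<theta>) x"
    unfolding germ_Ad_def by (rule germ_map2_germ[where F="group_maps B G" and F'="lie_forms B G", OF _ U ai t]) (simp add: form1_Ad_def)
  have 4: "form1_Ad B G (\<lambda>x. inv\<^bsub>G\<^esub> a x) \<theta> \<in> lie_forms B G U" "maurer_cartan B G a \<in> lie_forms B G U"
    using smooth_form1_Ad[OF U(1)] smooth_maurer_cartan[OF U(1)] ai a t
    by (auto simp: lie_forms_def group_maps_def)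
  have "germ_add B G (germ_at (mtop B) (form1_Ad B G (\<lambda>x. inv\<^bsub>G\<^esub> a x) \<theta>) x) (germ_at (mtop B) (maurer_cartan B G a) x)
      = germ_at (mtop B) (form1_add B (form1_Ad B G (\<lambda>x. inv\<^bsub>G\<^esub> a x) \<theta>) (maurer_cartan B G a)) x"
    unfolding germ_add_def by (rule germ_map2_germ[where F="lie_forms B G" and F'="lie_forms B G", OF _ U 4]) (simp add: form1_add_def)
  then show ?thesis by (simp add: germ_gauge_def 1 2 3 gauge_transform_def)
qed

lemma gauge_transform_lie_forms:
  "openin (mtop B) U \<Longrightarrow> \<theta> \<in> lie_forms B G U \<Longrightarrow> a \<in> group_maps B G U \<Longrightarrow> gauge_transform \<theta> a \<in> lie_forms B G U"
  using smooth_gauge_transform by (simp add: lie_forms_def group_maps_def)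

lemma group_maps_mult:
  "openin (mtop B) U \<Longrightarrow> a \<in> group_maps B G U \<Longrightarrow> b \<in> group_maps B G U \<Longrightarrow>
    (\<lambda>y. a y \<otimes>\<^bsub>G\<^esub> b y) \<in> group_maps B G U"
  using smooth_map_on_mult[OF locally_euclidean_B] by (simp add: group_maps_def)

lemma germ_gauge_mult:
  assumes U: "openin (mtop B) U" "x \<in> U" and t: "\<theta> \<in> lie_forms B G U"
    and a: "a \<in> group_maps B G U" and b: "b \<in> group_maps B G U"
  shows "germ_gauge (germ_gauge (germ_at (mtop B) \<theta> x) (germ_at (mtop B) a x)) (germ_at (mtop B) b x) =
    germ_gauge (germ_at (mtop B) \<theta> x) (germ_at (mtop B) (\<lambda>y. a y \<otimes>\<^bsub>G\<^esub> b y) x)"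
proof -
  have "germ_at (mtop B) (gauge_transform (gauge_transform \<theta> a) b) x = germ_at (mtop B) (gauge_transform \<theta> (\<lambda>y. a y \<otimes>\<^bsub>G\<^esub> b y)) x"
    by (rule germ_at_cong[OF U]) (use gauge_transform_mult[OF U(1)] t a b in \<open>simp add: lie_forms_def group_maps_def\<close>)
  then show ?thesis
    using germ_gauge_germ[OF U t a] germ_gauge_germ[OF U gauge_transform_lie_forms[OF U(1) t a] b]
      germ_gauge_germ[OF U t group_maps_mult[OF U(1) a b]] by simp
qed

end

section \<open>Local sections of a principal bundle\<close>

locale principal_bundle_data =
  fixes P :: "('p, 'ep::real_inner) mfd" and G :: "('g, 'eg::real_inner) lie_group_data"
    and B :: "('b, 'eb::real_inner) mfd" and pr :: "'p \<Rightarrow> 'b" and act :: "'p \<Rightarrow> 'g \<Rightarrow> 'p"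
  assumes principal: "principal_bundle P G B pr act"
begin

sublocale lie_group_forms B G
  using principal by unfold_locales (auto simp: principal_bundle_def)

lemma locally_euclidean_P: "locally_euclidean P"
  using principal smooth_manifold_locally_euclidean by (auto simp: principal_bundle_def)

lemma smooth_act:
  "smooth_map_on (prod_mfd P (gmfd G)) P (topspace (mtop P) \<times> carrier G) (\<lambda>(p, g). act p g)"
  using principal by (simp add: principal_bundle_def)

lemma act_closed:
  assumes "p \<in> topspace (mtop P)" "a \<in> carrier G"
  shows "act p a \<in> topspace (mtop P)"
proof -
  have "openin (mtop (prod_mfd P (gmfd G))) (topspace (mtop P) \<times> carrier G)"
    using openin_carrier by (simp add: openin_prod_Times_iff)
  from smooth_map_on_in_topspace[OF smooth_act this, of "(p, a)"] show ?thesis using assms by simp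
qed

lemma pr_act: "p \<in> topspace (mtop P) \<Longrightarrow> a \<in> carrier G \<Longrightarrow> pr (act p a) = pr p"
  using principal by (simp add: principal_bundle_def)

lemma section_closed:
  "t \<in> bundle_sections P B pr V \<Longrightarrow> openin (mtop B) V \<Longrightarrow> x \<in> V \<Longrightarrow> t x \<in> topspace (mtop P)"
  using smooth_map_on_in_topspace[of B P V t x] by (simp add: bundle_sections_def)

lemma group_maps_closed:
  "a \<in> group_maps B G V \<Longrightarrow> openin (mtop B) V \<Longrightarrow> x \<in> V \<Longrightarrow> a x \<in> carrier G"
  using group_map_closed by (simp add: group_maps_def)

lemma bundle_sections_act:
  assumes V: "openin (mtop B) V" and t: "t \<in> bundle_sections P B pr V" and a: "a \<in> group_maps B G V"
  shows "(\<lambda>x. act (t x) (a x)) \<in> bundle_sections P B pr V"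
proof -
  have "smooth_map_on B P V (\<lambda>x. (\<lambda>(p, g). act p g) (t x, a x))"
    by (rule smooth_map_on_compose[OF locally_euclidean_B locally_euclidean_prod[OF locally_euclidean_P locally_euclidean_G]
          locally_euclidean_P V smooth_map_on_Pair[OF locally_euclidean_B locally_euclidean_P locally_euclidean_G V] _ smooth_act])
      (use t a section_closed[OF t V] group_maps_closed[OF a V] in \<open>auto simp: bundle_sections_def group_maps_def\<close>)
  moreover have "pr (act (t x) (a x)) = x" if "x \<in> V" for x
    using pr_act[OF section_closed[OF t V that] group_maps_closed[OF a V that]] t that
    by (simp add: bundle_sections_def)
  ultimately show ?thesis by (simp add: bundle_sections_def)
qed

lemma germ_act_germ:
  assumes V: "openin (mtop B) V" "x \<in> V" and t: "t \<in> bundle_sections P B pr V" and a: "a \<in> group_maps B G V"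
  shows "germ_act P G B pr act (germ_at (mtop B) t x) (germ_at (mtop B) a x) =
    germ_at (mtop B) (\<lambda>x. act (t x) (a x)) x"
  unfolding germ_act_def by (rule germ_map2_germ[where F="bundle_sections P B pr" and F'="group_maps B G", OF _ V t a]) simp

context
  fixes U :: "'b set" and \<Phi> :: "'p \<Rightarrow> 'b \<times> 'g"
  assumes triv: "local_trivialization P G B pr act U \<Phi>"
begin

lemma trivD:
  shows "openin (mtop B) U"
    and "bij_betw \<Phi> {p \<in> topspace (mtop P). pr p \<in> U} (U \<times> carrier G)"
    and "smooth_map_on P (prod_mfd B (gmfd G)) {p \<in> topspace (mtop P). pr p \<in> U} \<Phi>"
    and "smooth_map_on (prod_mfd B (gmfd G)) P (U \<times> carrier G) (inv_into {p \<in> topspace (mtop P). pr p \<in> U} \<Phi>)"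
    and "\<And>p. p \<in> topspace (mtop P) \<Longrightarrow> pr p \<in> U \<Longrightarrow> fst (\<Phi> p) = pr p"
    and "\<And>p a. p \<in> topspace (mtop P) \<Longrightarrow> pr p \<in> U \<Longrightarrow> a \<in> carrier G \<Longrightarrow>
      \<Phi> (act p a) = (pr p, snd (\<Phi> p) \<otimes>\<^bsub>G\<^esub> a)"
  using triv by (auto simp: local_trivialization_def Let_def)

lemma triv_eqI:
  assumes "p \<in> topspace (mtop P)" "p' \<in> topspace (mtop P)" "pr p \<in> U" "pr p' \<in> U" "\<Phi> p = \<Phi> p'"
  shows "p = p'"
  using trivD(2) assms by (auto simp: bij_betw_def dest: inj_onD)

lemma fibre_coord_group_maps:
  assumes V: "openin (mtop B) V" "V \<subseteq> U" and t: "t \<in> bundle_sections P B pr V"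
  shows "fibre_coord \<Phi> t \<in> group_maps B G V"
proof -
  note BG = locally_euclidean_prod[OF locally_euclidean_B locally_euclidean_G]
  have "t ` V \<subseteq> {p \<in> topspace (mtop P). pr p \<in> U}"
    using section_closed[OF t V(1)] V(2) t by (auto simp: bundle_sections_def)
  from smooth_map_on_compose[OF locally_euclidean_B locally_euclidean_P BG V(1) _ this trivD(3)]
  have "smooth_map_on B (prod_mfd B (gmfd G)) V (\<lambda>x. \<Phi> (t x))"
    using t by (simp add: bundle_sections_def)
  from smooth_map_on_snd_of[OF locally_euclidean_B locally_euclidean_B locally_euclidean_G V(1) this]
  show ?thesis by (simp add: group_maps_def fibre_coord_def)
qed

lemma natural_section_properties:
  assumes "x \<in> U"
  shows "natural_section P G pr U \<Phi> x \<in> topspace (mtop P)" "pr (natural_section P G pr U \<Phi> x) = x"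
    "\<Phi> (natural_section P G pr U \<Phi> x) = (x, \<one>\<^bsub>G\<^esub>)"
proof -
  have im: "(x, \<one>\<^bsub>G\<^esub>) \<in> \<Phi> ` {p \<in> topspace (mtop P). pr p \<in> U}"
    using trivD(2) assms by (simp add: bij_betw_def)
  show 1: "\<Phi> (natural_section P G pr U \<Phi> x) = (x, \<one>\<^bsub>G\<^esub>)"
    unfolding natural_section_def by (rule f_inv_into_f[OF im])
  have 2: "natural_section P G pr U \<Phi> x \<in> {p \<in> topspace (mtop P). pr p \<in> U}"
    unfolding natural_section_def by (rule inv_into_into[OF im])
  then show "natural_section P G pr U \<Phi> x \<in> topspace (mtop P)" by simp
  show "pr (natural_section P G pr U \<Phi> x) = x" using trivD(5) 1 2 by force
qed

lemma natural_section_in_bundle_sections: "natural_section P G pr U \<Phi> \<in> bundle_sections P B pr U"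
proof -
  note BG = locally_euclidean_prod[OF locally_euclidean_B locally_euclidean_G]
  have p: "smooth_map_on B (prod_mfd B (gmfd G)) U (\<lambda>x. (x, \<one>\<^bsub>G\<^esub>))"
    by (rule smooth_map_on_Pair[OF locally_euclidean_B locally_euclidean_B locally_euclidean_G trivD(1)
          smooth_map_on_id[OF manifold_B] smooth_map_on_const_G[OF one_closed]])
  have "smooth_map_on B P U (natural_section P G pr U \<Phi>)"
    unfolding natural_section_def[abs_def]
    by (rule smooth_map_on_compose[OF locally_euclidean_B BG locally_euclidean_P trivD(1) p _ trivD(4)]) auto
  then show ?thesis using natural_section_properties(2) by (simp add: bundle_sections_def)
qed

lemma natural_section_act_eq_iff:
  assumes x: "x \<in> U" and p: "p \<in> topspace (mtop P)" "pr p = x" and a: "a \<in> carrier G"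
  shows "p = act (natural_section P G pr U \<Phi> x) a \<longleftrightarrow> a = snd (\<Phi> p)"
proof -
  note n = natural_section_properties[OF x]
  have "\<Phi> (act (natural_section P G pr U \<Phi> x) a) = (x, a)"
    using trivD(6)[OF n(1) _ a] n x a by simp
  moreover have "\<Phi> p = (x, snd (\<Phi> p))"
    using trivD(5)[OF p(1)] p(2) x by (metis prod.collapse)
  moreover have "p = act (natural_section P G pr U \<Phi> x) a \<longleftrightarrow> \<Phi> p = \<Phi> (act (natural_section P G pr U \<Phi> x) a)"
    using triv_eqI[OF p(1) act_closed[OF n(1) a]] pr_act[OF n(1) a] n(2) p(2) x by auto
  ultimately show ?thesis by auto
qed

lemma section_eq_natural_section_act:
  assumes V: "openin (mtop B) V" "V \<subseteq> U" and t: "t \<in> bundle_sections P B pr V" and x: "x \<in> V"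
  shows "t x = act (natural_section P G pr U \<Phi> x) (fibre_coord \<Phi> t x)"
proof -
  have "fibre_coord \<Phi> t x \<in> carrier G"
    by (rule group_maps_closed[OF fibre_coord_group_maps[OF V t] V(1) x])
  then show ?thesis
    using natural_section_act_eq_iff[of x "t x"] section_closed[OF t V(1) x] t x V(2)
    by (auto simp: bundle_sections_def fibre_coord_def)
qed

lemma transition_function_eq_fibre_coord:
  assumes V: "openin (mtop B) V" "V \<subseteq> U" and t: "t \<in> bundle_sections P B pr V" and x: "x \<in> V"
  shows "transition_function G act (natural_section P G pr U \<Phi>) t x = fibre_coord \<Phi> t x"
  unfolding transition_function_def
proof (rule the_equality)
  show "fibre_coord \<Phi> t x \<in> carrier G \<and> t x = act (natural_section P G pr U \<Phi> x) (fibre_coord \<Phi> t x)"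
    using group_maps_closed[OF fibre_coord_group_maps[OF V t] V(1) x]
      section_eq_natural_section_act[OF V t x] by simp
  show "a = fibre_coord \<Phi> t x" if "a \<in> carrier G \<and> t x = act (natural_section P G pr U \<Phi> x) a" for a
  proof -
    have "x \<in> U" "pr (t x) = x" using t x V(2) by (auto simp: bundle_sections_def)
    then show ?thesis
      using natural_section_act_eq_iff[OF _ section_closed[OF t V(1) x]] that unfolding fibre_coord_def by blast
  qed
qed

lemma fibre_coord_act:
  assumes V: "openin (mtop B) V" "V \<subseteq> U" and t: "t \<in> bundle_sections P B pr V" and x: "x \<in> V"
    and a: "a \<in> group_maps B G V"
  shows "fibre_coord \<Phi> (\<lambda>x. act (t x) (a x)) x = fibre_coord \<Phi> t x \<otimes>\<^bsub>G\<^esub> a x"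
  using trivD(6)[OF section_closed[OF t V(1) x] _ group_maps_closed[OF a V(1) x]] t x V(2)
  by (auto simp: bundle_sections_def fibre_coord_def)

end

end

section \<open>Existence and uniqueness of the morphism\<close>

theorem theorem5p1:
  fixes P :: "('p, 'ep::real_inner) mfd"
    and G :: "('g, 'eg::real_inner) lie_group_data"
    and B :: "('b, 'eb::real_inner) mfd"
    and pr :: "'p \<Rightarrow> 'b"
    and act :: "'p \<Rightarrow> 'g \<Rightarrow> 'p"
    and I :: "'i set"
    and U :: "'i \<Rightarrow> 'b set"
    and \<Phi> :: "'i \<Rightarrow> 'p \<Rightarrow> 'b \<times> 'g"
    and s :: "'i \<Rightarrow> 'b \<Rightarrow> 'p"
    and g :: "'i \<Rightarrow> 'i \<Rightarrow> 'b \<Rightarrow> 'g"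
    and \<sigma> :: "'i \<Rightarrow> 'b \<Rightarrow> ('b, 'p) germ"
    and \<gamma> :: "'i \<Rightarrow> 'i \<Rightarrow> 'b \<Rightarrow> ('b, 'g) germ"
    and \<theta> :: "'i \<Rightarrow> 'b \<Rightarrow> ('b, ('b, 'eb) tvec \<Rightarrow> ('g, 'eg) tvec) germ"
  assumes principal: "principal_bundle P G B pr act"
    and cover: "(\<Union>\<alpha>\<in>I. U \<alpha>) = topspace (mtop B)"
    and triv: "\<And>\<alpha>. \<alpha> \<in> I \<Longrightarrow> local_trivialization P G B pr act (U \<alpha>) (\<Phi> \<alpha>)"
    and s: "\<And>\<alpha>. \<alpha> \<in> I \<Longrightarrow> s \<alpha> = natural_section P G pr (U \<alpha>) (\<Phi> \<alpha>)"
    and g: "\<And>\<alpha> \<beta>. \<alpha> \<in> I \<Longrightarrow> \<beta> \<in> I \<Longrightarrow> g \<alpha> \<beta> = transition_function G act (s \<alpha>) (s \<beta>)"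
    and \<sigma>: "\<And>\<alpha>. \<alpha> \<in> I \<Longrightarrow> \<sigma> \<alpha> = germ_at (mtop B) (s \<alpha>)"
    and \<gamma>: "\<And>\<alpha> \<beta>. \<alpha> \<in> I \<Longrightarrow> \<beta> \<in> I \<Longrightarrow> \<gamma> \<alpha> \<beta> = germ_at (mtop B) (g \<alpha> \<beta>)"
    and \<theta>: "\<And>\<alpha>. \<alpha> \<in> I \<Longrightarrow> \<theta> \<alpha> \<in> sheaf_sections (mtop B) (sheaf_Omega1 B G) (U \<alpha>)"
    and compat: "\<And>\<alpha> \<beta> x. \<alpha> \<in> I \<Longrightarrow> \<beta> \<in> I \<Longrightarrow> x \<in> U \<alpha> \<inter> U \<beta> \<Longrightarrow>
      \<theta> \<beta> x = germ_add B G (germ_Ad B G (germ_inv B G (\<gamma> \<alpha> \<beta> x)) (\<theta> \<alpha> x)) (germ_mc B G (\<gamma> \<alpha> \<beta> x))"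
  shows "\<exists>!D. sheaf_morphism (sheaf_P P B pr) (sheaf_Omega1 B G) D \<and>
    (\<forall>w\<in>topspace (sheaf_P P B pr). \<forall>a\<in>topspace (sheaf_G B G). fst w = fst a \<longrightarrow>
       D (germ_act P G B pr act w a) =
         germ_add B G (germ_Ad B G (germ_inv B G a) (D w)) (germ_mc B G a)) \<and>
    (\<forall>\<alpha>\<in>I. \<forall>x\<in>U \<alpha>. D (\<sigma> \<alpha> x) = \<theta> \<alpha> x)"
proof -
  interpret principal_bundle_data P G B pr act by unfold_locales (rule principal)
  let ?T = "mtop B"
  let ?S = "bundle_sections P B pr"
  note germ_gauge_def[symmetric, simp]
  note rS = restriction_closedD[OF restriction_closed_bundle_sections]
    and rG = restriction_closedD[OF restriction_closed_group_maps]
    and rL = restriction_closedD[OF restriction_closed_lie_forms]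
  have oU: "openin ?T (U \<alpha>)" if "\<alpha> \<in> I" for \<alpha> by (rule trivD(1)[OF triv[OF that]])
  have sS: "s \<alpha> \<in> ?S (U \<alpha>)" if "\<alpha> \<in> I" for \<alpha>
    unfolding s[OF that] by (rule natural_section_in_bundle_sections[OF triv[OF that]])
  \<comment> \<open>near each point, \<open>\<theta> \<alpha>\<close> consists of the germs of an actual smooth form\<close>
  have form: "\<exists>W \<omega>. openin ?T W \<and> x \<in> W \<and> W \<subseteq> V \<and> W \<subseteq> U \<alpha> \<and> \<omega> \<in> lie_forms B G W \<and>
      (\<forall>y\<in>W. \<theta> \<alpha> y = germ_at ?T \<omega> y)" if \<alpha>: "\<alpha> \<in> I" "x \<in> U \<alpha>" and V: "openin ?T V" "x \<in> V" for \<alpha> x V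
  proof -
    obtain W \<omega> where W: "openin ?T W" "x \<in> W" "W \<subseteq> U \<alpha>" "\<omega> \<in> lie_forms B G W"
      "\<And>y. y \<in> W \<Longrightarrow> \<theta> \<alpha> y = germ_at ?T \<omega> y"
      using sheaf_section_germE[where F="lie_forms B G", OF restriction_closed_lie_forms
        \<theta>[OF \<alpha>(1), unfolded sheaf_Omega1_def] oU[OF \<alpha>(1)] \<alpha>(2)]
      by metis
    then show ?thesis
      using V rL[OF W(1) _ _ W(4), of "W \<inter> V"] by (intro exI[of _ "W \<inter> V"] exI[of _ \<omega>]) auto
  qed
  have \<gamma>_coord: "\<gamma> \<alpha> \<beta> x = germ_at ?T (fibre_coord (\<Phi> \<alpha>) (s \<beta>)) x"
    if i: "\<alpha> \<in> I" "\<beta> \<in> I" and x: "x \<in> U \<alpha> \<inter> U \<beta>" for \<alpha> \<beta> x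
  proof -
    have o: "openin ?T (U \<alpha> \<inter> U \<beta>)" using oU i by blast
    have "s \<beta> \<in> ?S (U \<alpha> \<inter> U \<beta>)" by (rule rS[OF oU[OF i(2)] o _ sS[OF i(2)]]) blast
    from transition_function_eq_fibre_coord[OF triv[OF i(1)] o _ this]
    show ?thesis unfolding \<gamma>[OF i] g[OF i] s[OF i(1)] by (intro germ_at_cong[OF o x]) simp
  qed
  \<comment> \<open>\<open>D\<close> is defined with a selected trivialization around each point; the fact \<open>D\<close> below says that any
     other trivialization of the family gives the same value\<close>
  define idx where "idx x = (SOME \<alpha>. \<alpha> \<in> I \<and> x \<in> U \<alpha>)" for x
  have idx: "idx x \<in> I" "x \<in> U (idx x)" if "x \<in> topspace ?T" for x
    using someI_ex[of "\<lambda>\<alpha>. \<alpha> \<in> I \<and> x \<in> U \<alpha>"] cover that unfolding idx_def by blast+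
  define D where "D = (\<lambda>w\<in>topspace (sheaf_P P B pr). germ_gauge (\<theta> (idx (fst w)) (fst w))
      (germ_map ?T ?S (fibre_coord (\<Phi> (idx (fst w)))) w))"
  have D: "D (germ_at ?T t x) = germ_gauge (\<theta> \<alpha> x) (germ_at ?T (fibre_coord (\<Phi> \<alpha>) t) x)"
    if V: "openin ?T V" "x \<in> V" and t: "t \<in> ?S V" and \<alpha>: "\<alpha> \<in> I" "x \<in> U \<alpha>" for V t x \<alpha>
  proof -
    define \<beta> where "\<beta> = idx x"
    have "x \<in> topspace ?T" using openin_subset[OF V(1)] V(2) by auto
    then have \<beta>: "\<beta> \<in> I" "x \<in> U \<beta>" using idx by (auto simp: \<beta>_def)
    have "openin ?T (V \<inter> (U \<alpha> \<inter> U \<beta>))" using V(1) oU \<alpha>(1) \<beta>(1) by blast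
    from form[OF \<alpha> this] V(2) \<alpha> \<beta> obtain W \<omega> where W: "openin ?T W" "x \<in> W" "W \<subseteq> V" "W \<subseteq> U \<alpha>" "W \<subseteq> U \<beta>"
      and \<omega>: "\<omega> \<in> lie_forms B G W" "\<theta> \<alpha> x = germ_at ?T \<omega> x" by auto
    have tW: "t \<in> ?S W" by (rule rS[OF V(1) W(1,3) t])
    have sW: "s \<beta> \<in> ?S W" by (rule rS[OF oU[OF \<beta>(1)] W(1,5) sS[OF \<beta>(1)]])
    let ?a = "fibre_coord (\<Phi> \<alpha>) t" and ?b = "fibre_coord (\<Phi> \<beta>) t" and ?c = "fibre_coord (\<Phi> \<alpha>) (s \<beta>)"
    have b: "?b \<in> group_maps B G W" by (rule fibre_coord_group_maps[OF triv[OF \<beta>(1)] W(1,5) tW])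
    have c: "?c \<in> group_maps B G W" by (rule fibre_coord_group_maps[OF triv[OF \<alpha>(1)] W(1,4) sW])
    have "?a y = ?c y \<otimes>\<^bsub>G\<^esub> ?b y" if y: "y \<in> W" for y
    proof -
      have "t y = act (s \<beta> y) (?b y)"
        unfolding s[OF \<beta>(1)] by (rule section_eq_natural_section_act[OF triv[OF \<beta>(1)] W(1,5) tW y])
      then have "?a y = fibre_coord (\<Phi> \<alpha>) (\<lambda>y. act (s \<beta> y) (?b y)) y" by (simp add: fibre_coord_def)
      also have "\<dots> = ?c y \<otimes>\<^bsub>G\<^esub> ?b y"
        by (rule fibre_coord_act[OF triv[OF \<alpha>(1)] W(1,4) sW y b])
      finally show ?thesis .
    qed
    then have a: "germ_at ?T ?a x = germ_at ?T (\<lambda>y. ?c y \<otimes>\<^bsub>G\<^esub> ?b y) x"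
      by (rule germ_at_cong[OF W(1,2)])
    have "germ_at ?T t x \<in> topspace (sheaf_P P B pr)"
      unfolding sheaf_P_def by (rule germ_in_etale[where F="?S", OF V(1) t V(2)])
    moreover have "germ_map ?T ?S (fibre_coord (\<Phi> \<beta>)) (germ_at ?T t x) = germ_at ?T ?b x"
      by (rule germ_map_germ[where F="?S", OF _ V t]) (simp add: fibre_coord_def)
    ultimately have "D (germ_at ?T t x) = germ_gauge (\<theta> \<beta> x) (germ_at ?T ?b x)"
      by (simp add: D_def flip: \<beta>_def)
    also have "\<theta> \<beta> x = germ_gauge (\<theta> \<alpha> x) (germ_at ?T ?c x)"
      using compat[OF \<alpha>(1) \<beta>(1)] \<gamma>_coord[OF \<alpha>(1) \<beta>(1)] \<alpha>(2) \<beta>(2) by simp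
    finally show ?thesis
      unfolding \<omega>(2) a germ_gauge_mult[OF W(1,2) \<omega>(1) c b] .
  qed
  have D_local: "\<exists>W r. openin ?T W \<and> x \<in> W \<and> W \<subseteq> V \<and> r \<in> lie_forms B G W \<and>
      (\<forall>y\<in>W. D (germ_at ?T t y) = germ_at ?T r y)"
    if V: "openin ?T V" "t \<in> ?S V" "x \<in> V" for V t x
  proof -
    have "x \<in> topspace ?T" using openin_subset[OF V(1)] V(3) by auto
    from idx[OF this] obtain \<alpha> where \<alpha>: "\<alpha> \<in> I" "x \<in> U \<alpha>" by blast
    from form[OF \<alpha> V(1,3)] obtain W \<omega> where W: "openin ?T W" "x \<in> W" "W \<subseteq> V" "W \<subseteq> U \<alpha>"
      and \<omega>: "\<omega> \<in> lie_forms B G W" "\<And>y. y \<in> W \<Longrightarrow> \<theta> \<alpha> y = germ_at ?T \<omega> y" by auto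
    have tW: "t \<in> ?S W" by (rule rS[OF V(1) W(1,3) V(2)])
    note a = fibre_coord_group_maps[OF triv[OF \<alpha>(1)] W(1,4) tW]
    have "D (germ_at ?T t y) = germ_at ?T (gauge_transform \<omega> (fibre_coord (\<Phi> \<alpha>) t)) y" if y: "y \<in> W" for y
      using D[OF W(1) y tW \<alpha>(1)] W(4) y \<omega>(2)[OF y] germ_gauge_germ[OF W(1) y \<omega>(1) a] by auto
    then show ?thesis
      using W gauge_transform_lie_forms[OF W(1) \<omega>(1) a] by blast
  qed
  show ?thesis
  proof (rule ex1I[of _ D], intro conjI ballI impI)
    show "sheaf_morphism (sheaf_P P B pr) (sheaf_Omega1 B G) D"
      unfolding sheaf_morphism_def
    proof (intro conjI ballI)
      show "D \<in> extensional (topspace (sheaf_P P B pr))" by (simp add: D_def)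
      show "continuous_map (sheaf_P P B pr) (sheaf_Omega1 B G) D"
        unfolding sheaf_P_def sheaf_Omega1_def
        by (rule continuous_map_etaleI[OF restriction_closed_bundle_sections restriction_closed_lie_forms D_local])
      fix w assume "w \<in> topspace (sheaf_P P B pr)"
      then obtain V t x where V: "openin ?T V" "t \<in> ?S V" "x \<in> V" "w = germ_at ?T t x"
        unfolding sheaf_P_def by (rule etale_germE)
      then show "fst (D w) = fst w" using D_local[OF V(1-3)] by auto
    qed
  next
    fix w a assume w: "w \<in> topspace (sheaf_P P B pr)" and a: "a \<in> topspace (sheaf_G B G)" and wa: "fst w = fst a"
    from w obtain V t x where V: "openin ?T V" "t \<in> ?S V" "x \<in> V" "w = germ_at ?T t x"
      unfolding sheaf_P_def by (rule etale_germE)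
    from a obtain V' f x' where V': "openin ?T V'" "f \<in> group_maps B G V'" "x' \<in> V'" "a = germ_at ?T f x'"
      unfolding sheaf_G_def by (rule etale_germE)
    have x': "x' = x" using wa V(4) V'(4) by simp
    have "x \<in> topspace ?T" using openin_subset[OF V(1)] V(3) by auto
    from idx[OF this] obtain \<alpha> where \<alpha>: "\<alpha> \<in> I" "x \<in> U \<alpha>" by blast
    have "openin ?T (V \<inter> V')" using V V' by blast
    from form[OF \<alpha> this] V(3) V'(3) x' obtain W \<omega> where W: "openin ?T W" "x \<in> W" "W \<subseteq> V" "W \<subseteq> V'" "W \<subseteq> U \<alpha>"
      and \<omega>: "\<omega> \<in> lie_forms B G W" "\<theta> \<alpha> x = germ_at ?T \<omega> x" by auto
    have tW: "t \<in> ?S W" by (rule rS[OF V(1) W(1,3) V(2)])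
    have fW: "f \<in> group_maps B G W" by (rule rG[OF V'(1) W(1,4) V'(2)])
    note c = fibre_coord_group_maps[OF triv[OF \<alpha>(1)] W(1,5) tW]
    have "germ_at ?T (fibre_coord (\<Phi> \<alpha>) (\<lambda>x. act (t x) (f x))) x =
        germ_at ?T (\<lambda>y. fibre_coord (\<Phi> \<alpha>) t y \<otimes>\<^bsub>G\<^esub> f y) x"
      by (rule germ_at_cong[OF W(1,2)], rule fibre_coord_act[OF triv[OF \<alpha>(1)] W(1,5) tW _ fW])
    then have "D (germ_act P G B pr act w a) = germ_gauge (D w) a"
      unfolding V(4) V'(4) x' germ_act_germ[OF W(1,2) tW fW]
        D[OF W(1,2) bundle_sections_act[OF W(1) tW fW] \<alpha>] D[OF W(1,2) tW \<alpha>]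
      using germ_gauge_mult[OF W(1,2) \<omega>(1) c fW] by (simp add: \<omega>(2))
    then show "D (germ_act P G B pr act w a) =
        germ_add B G (germ_Ad B G (germ_inv B G a) (D w)) (germ_mc B G a)" by simp
  next
    fix \<alpha> x assume \<alpha>: "\<alpha> \<in> I" "x \<in> U \<alpha>"
    \<comment> \<open>the compatibility condition for \<open>\<beta> = \<alpha>\<close> replaces the computation that \<open>g \<alpha> \<alpha>\<close> is constantly \<open>e\<close>\<close>
    have "D (\<sigma> \<alpha> x) = germ_gauge (\<theta> \<alpha> x) (\<gamma> \<alpha> \<alpha> x)"
      using D[OF oU[OF \<alpha>(1)] \<alpha>(2) sS[OF \<alpha>(1)] \<alpha>] \<gamma>_coord[OF \<alpha>(1,1)] \<alpha>(2) by (simp add: \<sigma>[OF \<alpha>(1)])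
    then show "D (\<sigma> \<alpha> x) = \<theta> \<alpha> x" using compat[OF \<alpha>(1,1), of x] \<alpha>(2) by simp
  next
    fix E assume E: "sheaf_morphism (sheaf_P P B pr) (sheaf_Omega1 B G) E \<and>
      (\<forall>w\<in>topspace (sheaf_P P B pr). \<forall>a\<in>topspace (sheaf_G B G). fst w = fst a \<longrightarrow>
         E (germ_act P G B pr act w a) =
           germ_add B G (germ_Ad B G (germ_inv B G a) (E w)) (germ_mc B G a)) \<and>
      (\<forall>\<alpha>\<in>I. \<forall>x\<in>U \<alpha>. E (\<sigma> \<alpha> x) = \<theta> \<alpha> x)"
    show "E = D"
    proof (rule extensionalityI[of _ "topspace (sheaf_P P B pr)"])
      show "E \<in> extensional (topspace (sheaf_P P B pr))" using E by (simp add: sheaf_morphism_def)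
      show "D \<in> extensional (topspace (sheaf_P P B pr))" by (simp add: D_def)
      fix w assume "w \<in> topspace (sheaf_P P B pr)"
      then obtain V t x where V: "openin ?T V" "t \<in> ?S V" "x \<in> V" "w = germ_at ?T t x"
        unfolding sheaf_P_def by (rule etale_germE)
      have "x \<in> topspace ?T" using openin_subset[OF V(1)] V(3) by auto
      from idx[OF this] obtain \<alpha> where \<alpha>: "\<alpha> \<in> I" "x \<in> U \<alpha>" by blast
      define W where "W = V \<inter> U \<alpha>"
      have W: "openin ?T W" "x \<in> W" "W \<subseteq> V" "W \<subseteq> U \<alpha>"
        using V oU[OF \<alpha>(1)] \<alpha>(2) by (auto simp: W_def)
      have tW: "t \<in> ?S W" by (rule rS[OF V(1) W(1,3) V(2)])
      have sW: "s \<alpha> \<in> ?S W" by (rule rS[OF oU[OF \<alpha>(1)] W(1,4) sS[OF \<alpha>(1)]])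
      let ?a = "fibre_coord (\<Phi> \<alpha>) t"
      have a: "?a \<in> group_maps B G W" by (rule fibre_coord_group_maps[OF triv[OF \<alpha>(1)] W(1,4) tW])
      have "germ_at ?T t x = germ_at ?T (\<lambda>y. act (s \<alpha> y) (?a y)) x"
        by (rule germ_at_cong[OF W(1,2)], unfold s[OF \<alpha>(1)])
          (rule section_eq_natural_section_act[OF triv[OF \<alpha>(1)] W(1,4) tW])
      \<comment> \<open>\<open>w\<close> lies in the orbit of \<open>\<sigma> \<alpha> x\<close>, on which equivariance determines \<open>E\<close>\<close>
      then have w: "w = germ_act P G B pr act (\<sigma> \<alpha> x) (germ_at ?T ?a x)"
        by (simp add: V(4) \<sigma>[OF \<alpha>(1)] germ_act_germ[OF W(1,2) sW a])
      have "\<sigma> \<alpha> x \<in> topspace (sheaf_P P B pr)" "germ_at ?T ?a x \<in> topspace (sheaf_G B G)"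
        unfolding \<sigma>[OF \<alpha>(1)] sheaf_P_def sheaf_G_def
        using germ_in_etale[where F="?S", OF W(1) sW W(2)] germ_in_etale[where F="group_maps B G", OF W(1) a W(2)]
        by auto
      moreover have "fst (\<sigma> \<alpha> x) = fst (germ_at ?T ?a x)" by (simp add: \<sigma>[OF \<alpha>(1)])
      ultimately have "E w = germ_gauge (E (\<sigma> \<alpha> x)) (germ_at ?T ?a x)"
        using E unfolding w germ_gauge_def by blast
      also have "E (\<sigma> \<alpha> x) = \<theta> \<alpha> x" using E \<alpha> by blast
      also have "germ_gauge (\<theta> \<alpha> x) (germ_at ?T ?a x) = D w"
        unfolding V(4) by (rule D[OF W(1,2) tW \<alpha>, symmetric])
      finally show "E w = D w" .
    qed
  qed
qed

end
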